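(* Let $\{(X_{\alpha}(t),V_{\alpha}(t))\}_{t\ge 0}$ be the telegraph process with Mittag-Leffler waiting times and velocity driven by iid random trials (defined in the context). For $t>0$ and $-v_2t<x<v_1t$ put $\theta=\frac{v_2t+x}{v_1+v_2}$. The absolutely continuous component of the conditional probability law of $X_\alpha(t)$ given $V_\alpha(0)=v_1$ is given by its forward and backward densities $$\begin{aligned}f(x,t|v_1)={}&\frac{\mu(t-\theta)^{\alpha-1}}{v_1+v_2}\sum_{n=2}^{\infty}\sum_{k=0}^{n-2}\sum_{i=0}^{n-k-2}\sum_{j=0}^{k+1}(-1)^{i+j}\binom{n-1}{k}\binom{n-k-2}{i}\binom{k+1}{j}(n-k-1)\\&\cdot p^{k+1}(1-p)^{n-k-1}E_{\alpha}(-\lambda(j+1)\theta^{\alpha})E_{\alpha,\alpha}(-\mu(i+1)(t-\theta)^{\alpha})\end{aligned}$$ and $$\begin{aligned}b(x,t|v_1)={}&\frac{\lambda\theta^{\alpha-1}}{v_1+v_2}\sum_{n=1}^{\infty}\sum_{k=0}^{n-1}\sum_{i=0}^{k}\sum_{j=0}^{n-k-1}(-1)^{i+j}\binom{n-1}{k}\binom{k}{i}\binom{n-k-1}{j}(k+1)p^{k}(1-p)^{n-k}\\&\cdot E_{\alpha}(-\mu(j+1)(t-\theta)^{\alpha})E_{\alpha,\alpha}(-\lambda(i+1)\theta^{\alpha}).\end{aligned}$$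
   Context: Mittag-Leffler functions: for $\alpha,\beta>0$, $E_{\alpha,\beta}(x)=\sum_{k\ge 0}\frac{x^k}{\Gamma(\alpha k+\beta)}$ and $E_\alpha=E_{\alpha,1}$. The process: fix $0<\alpha\le 1$, positive constants $v_1,v_2,\lambda,\mu$, positive constants $b,r$, and put $p=b/(b+r)$ (the constant $b$ is unrelated to the density $b(x,t|v_1)$). Let $\{Y_n\}_{n\ge 1}$ be iid Bernoulli random variables with $\mathrm{Pr}\{Y_n=1\}=p$. Let $\{R_n\}_{n\ge1}$ and $\{L_n\}_{n\ge1}$ be positive random variables with $\mathrm{Pr}\{R_n>t\}=E_{\alpha}(-n\lambda t^{\alpha})$ and $\mathrm{Pr}\{L_n>t\}=E_{\alpha}(-n\mu t^{\alpha})$, $t\ge0$; all the random variables $Y_n,R_n,L_n$, $n\ge 1$, are mutually independent. For $n\ge0$ set $S_n=v_1$ if $Y_{n+1}=1$ and $S_n=-v_2$ if $Y_{n+1}=0$. Set $T_0=0$ and, for $n\ge0$, $T_{n+1}=T_n+R_i$ if $S_n=v_1$ and $Y_1+\dots+Y_n=i-1$, while $T_{n+1}=T_n+L_i$ if $S_n=-v_2$ and $Y_1+\dots+Y_n=n-i+1$. Let $\mathcal{N}(t)=\max\{n\ge0:T_n\le t\}$, $V_\alpha(t)=S_{\mathcal{N}(t)}$ and $X_\alpha(t)=\int_0^tV_\alpha(s)\,\mathrm{d}s$. Forward and backward densities: on $-v_2t<x<v_1t$, $f(x,t|v_1)=\frac{\partial}{\partial x}\mathrm{Pr}\{X_\alpha(t)\le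 x,V_\alpha(t)=v_1\mid V_\alpha(0)=v_1\}$ and $b(x,t|v_1)=\frac{\partial}{\partial x}\mathrm{Pr}\{X_\alpha(t)\le x,V_\alpha(t)=-v_2\mid V_\alpha(0)=v_1\}$; the conditional density of the absolutely continuous part of $X_\alpha(t)$ given $V_\alpha(0)=v_1$ is $p(x,t|v_1)=f(x,t|v_1)+b(x,t|v_1)$. *)

theory Defs
  imports "HOL-Probability.Probability"
begin

definition mittag_leffler :: "real \<Rightarrow> real \<Rightarrow> real \<Rightarrow> real" where
  "mittag_leffler \<alpha> \<beta> x = (\<Sum>k. x ^ k / Gamma (\<alpha> * real k + \<beta>))"

text \<open>
  The families \<open>Y\<close>, \<open>R\<close>, \<open>L\<close> are indexed from 1; their values at index 0 are unconstrained and
  never used. Mutual independence of all the variables is independence of the single family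
  indexed by the disjoint sum of the three index sets (measurability is part of
  \<^term>\<open>prob_space.indep_vars\<close>).
\<close>

locale ml_telegraph = prob_space M for M :: "'a measure" +
  fixes \<alpha> v1 v2 lam mu b r :: real
    and Y :: "nat \<Rightarrow> 'a \<Rightarrow> nat"
    and R L :: "nat \<Rightarrow> 'a \<Rightarrow> real"
  assumes alpha: "0 < \<alpha>" "\<alpha> \<le> 1"
    and v_pos: "0 < v1" "0 < v2"
    and rate_pos: "0 < lam" "0 < mu"
    and trial_pos: "0 < b" "0 < r"
    and Y_range: "\<And>n \<omega>. 1 \<le> n \<Longrightarrow> \<omega> \<in> space M \<Longrightarrow> Y n \<omega> \<in> {0, 1}"
    and Y_prob: "\<And>n. 1 \<le> n \<Longrightarrow> \<P>(\<omega> in M. Y n \<omega> = 1) = b / (b + r)"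
    and R_pos: "\<And>n \<omega>. 1 \<le> n \<Longrightarrow> \<omega> \<in> space M \<Longrightarrow> 0 < R n \<omega>"
    and L_pos: "\<And>n \<omega>. 1 \<le> n \<Longrightarrow> \<omega> \<in> space M \<Longrightarrow> 0 < L n \<omega>"
    and R_tail: "\<And>n t. 1 \<le> n \<Longrightarrow> 0 \<le> t \<Longrightarrow>
      \<P>(\<omega> in M. R n \<omega> > t) = mittag_leffler \<alpha> 1 (- real n * lam * t powr \<alpha>)"
    and L_tail: "\<And>n t. 1 \<le> n \<Longrightarrow> 0 \<le> t \<Longrightarrow>
      \<P>(\<omega> in M. L n \<omega> > t) = mittag_leffler \<alpha> 1 (- real n * mu * t powr \<alpha>)"
    and indep: "indep_vars (\<lambda>_. borel)
      (case_sum (\<lambda>n \<omega>. real (Y n \<omega>)) (case_sum R L)) ({1..} <+> ({1..} <+> {1..}))"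
begin

definition trial_velocity :: "nat \<Rightarrow> 'a \<Rightarrow> real" where
  "trial_velocity n \<omega> = (if Y (Suc n) \<omega> = 1 then v1 else - v2)"

text \<open>
  The waiting time after the \<open>n\<close>-th epoch is \<open>R\<^sub>i\<close> with \<open>i - 1 = Y\<^sub>1 + \<dots> + Y\<^sub>n\<close>, or \<open>L\<^sub>i\<close> with
  \<open>i - 1 = n - (Y\<^sub>1 + \<dots> + Y\<^sub>n)\<close>; the subtraction does not truncate, as each \<open>Y\<^sub>k\<close> is at most 1.
\<close>

primrec epoch :: "nat \<Rightarrow> 'a \<Rightarrow> real" where
  "epoch 0 \<omega> = 0"
| "epoch (Suc n) \<omega> = epoch n \<omega> +
     (if trial_velocity n \<omega> = v1 then R ((\<Sum>k=1..n. Y k \<omega>) + 1) \<omega>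
      else L (n - (\<Sum>k=1..n. Y k \<omega>) + 1) \<omega>)"

text \<open>The set below is infinite only on the null event that the epochs stay bounded.\<close>

definition num_epochs :: "real \<Rightarrow> 'a \<Rightarrow> nat" where
  "num_epochs t \<omega> = Max {n. epoch n \<omega> \<le> t}"

definition velocity :: "real \<Rightarrow> 'a \<Rightarrow> real" where
  "velocity t \<omega> = trial_velocity (num_epochs t \<omega>) \<omega>"

definition position :: "real \<Rightarrow> 'a \<Rightarrow> real" where
  "position t \<omega> = (LBINT s:{0..t}. velocity s \<omega>)"

definition forward_cdf :: "real \<Rightarrow> real \<Rightarrow> real" where
  "forward_cdf t x =
     \<P>(\<omega> in M. position t \<omega> \<le> x \<and> velocity t \<omega> = v1 \<bar> velocity 0 \<omega> = v1)"

definition backward_cdf :: "real \<Rightarrow> real \<Rightarrow> real" where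
  "backward_cdf t x =
     \<P>(\<omega> in M. position t \<omega> \<le> x \<and> velocity t \<omega> = - v2 \<bar> velocity 0 \<omega> = v1)"

definition forward_density :: "real \<Rightarrow> real \<Rightarrow> real" where
  "forward_density t x = deriv (forward_cdf t) x"

definition backward_density :: "real \<Rightarrow> real \<Rightarrow> real" where
  "backward_density t x = deriv (backward_cdf t) x"

definition cond_law :: "real \<Rightarrow> real measure" where
  "cond_law t =
     distr (uniform_measure M {\<omega> \<in> space M. velocity 0 \<omega> = v1}) borel (position t)"

end

text \<open>
  Lebesgue decomposition: \<open>g\<close> is a density of the absolutely continuous component of \<open>\<nu>\<close>
  with respect to Lebesgue measure, the remainder \<open>\<sigma>\<close> being singular.
\<close>

definition has_ac_component :: "real measure \<Rightarrow> (real \<Rightarrow> real) \<Rightarrow> bool" where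
  "has_ac_component \<nu> g \<longleftrightarrow>
     g \<in> borel_measurable borel \<and> (\<forall>x. 0 \<le> g x) \<and>
     (\<exists>\<sigma> N. sets \<sigma> = sets borel \<and> N \<in> null_sets lborel \<and> emeasure \<sigma> (- N) = 0 \<and>
       (\<forall>A\<in>sets borel. emeasure \<nu> A = (\<integral>\<^sup>+x\<in>A. ennreal (g x) \<partial>lborel) + emeasure \<sigma> A))"

definition forward_term ::
    "real \<Rightarrow> real \<Rightarrow> real \<Rightarrow> real \<Rightarrow> real \<Rightarrow> real \<Rightarrow> nat \<Rightarrow> real" where
  "forward_term \<alpha> lam mu p t \<theta> n =
     (\<Sum>k=0..n-2. \<Sum>i=0..n-k-2. \<Sum>j=0..k+1.
        (-1) ^ (i + j) * real ((n-1) choose k) * real ((n-k-2) choose i) * real ((k+1) choose j)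
        * real (n-k-1) * p ^ (k+1) * (1 - p) ^ (n-k-1)
        * mittag_leffler \<alpha> 1 (- lam * real (j+1) * \<theta> powr \<alpha>)
        * mittag_leffler \<alpha> \<alpha> (- mu * real (i+1) * (t - \<theta>) powr \<alpha>))"

definition backward_term ::
    "real \<Rightarrow> real \<Rightarrow> real \<Rightarrow> real \<Rightarrow> real \<Rightarrow> real \<Rightarrow> nat \<Rightarrow> real" where
  "backward_term \<alpha> lam mu p t \<theta> n =
     (\<Sum>k=0..n-1. \<Sum>i=0..k. \<Sum>j=0..n-k-1.
        (-1) ^ (i + j) * real ((n-1) choose k) * real (k choose i) * real ((n-k-1) choose j)
        * real (k+1) * p ^ k * (1 - p) ^ (n-k)
        * mittag_leffler \<alpha> 1 (- mu * real (j+1) * (t - \<theta>) powr \<alpha>)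
        * mittag_leffler \<alpha> \<alpha> (- lam * real (i+1) * \<theta> powr \<alpha>))"

end

theory Submission
  imports Defs
begin

text \<open>
  The idea is that the position at time \<open>t\<close> is an affine function of a single sum of
  waiting times. Let the path start at velocity \<open>v1\<close>, and let \<open>n\<close> waiting times be
  completed at time \<open>t\<close>, \<open>K\<close> of them rightward and \<open>m = n - K\<close> leftward. Whatever
  the order of the trials, these are \<open>R\<^sub>1, \<dots>, R\<^sub>K\<close> and \<open>L\<^sub>1, \<dots>, L\<^sub>m\<close>
  (lemma \<open>epoch_eq\<close>). If the path moves right at time \<open>t\<close>, it has spent the time
  \<open>\<Lambda> = L\<^sub>1 + \<dots> + L\<^sub>m\<close> at velocity \<open>- v2\<close> and is at \<open>v1 t - (v1 + v2) \<Lambda>\<close>;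
  moreover exactly \<open>K\<close> rightward waiting times are completed within \<open>t - \<Lambda>\<close>. Being at \<open>x\<close>
  means \<open>\<Lambda> = t - \<theta>\<close>, and trials, rightward and leftward waiting times are independent.
  So \<open>n\<close> and \<open>K\<close> contribute to the density a binomial weight, times the density of
  \<open>\<Lambda>\<close> at \<open>t - \<theta>\<close>, times the probability of exactly \<open>K\<close> rightward completions within
  \<open>\<theta>\<close>, divided by \<open>v1 + v2\<close> (\<open>fwd_stage\<close>, \<open>fwd_law\<close>). If the path moves left, the
  two directions exchange their roles (\<open>bwd_stage\<close>, \<open>bwd_law\<close>). The paths with
  \<open>m = 0\<close> that move right sit at \<open>v1 t\<close> and make up the singular part.

  The law of a sum \<open>W\<^sub>1 + \<dots> + W\<^sub>m\<close>, where \<open>W\<^sub>j\<close> has the tail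
  \<open>E\<^sub>\<alpha>(- j c t\<^sup>\<alpha>)\<close>, comes from the kernels
  \<open>e\<^sub>c(s) = s\<^sup>\<alpha>\<^sup>-\<^sup>1 E\<^sub>\<alpha>\<^sub>,\<^sub>\<alpha>(c s\<^sup>\<alpha>)\<close>. Such a kernel is a
  geometric series in the convolution powers of the Riemann-Liouville kernel, and therefore
  \<open>e\<^sub>c * e\<^sub>d = (e\<^sub>c - e\<^sub>d) / (c - d)\<close> (\<open>ml_kernel_resolvent\<close>). Convolution of
  \<open>W\<^sub>1, \<dots>, W\<^sub>m\<close> is thus a matter of partial fractions, which give the alternating
  binomial sums of the theorem (\<open>density_Suc\<close>, \<open>yule_cdf_diff\<close>).

  The series over \<open>n\<close> has to be differentiated at every point of the interval. This rests on
  the bound of \<open>6 c / ((m + 1) (m + 2))\<close> times \<open>e\<^sub>3\<^sub>c\<close> for the density of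
  \<open>W\<^sub>1 + \<dots> + W\<^sub>m\<close>, which is summable in \<open>m\<close> (\<open>density_bound\<close>). For \<open>\<alpha> = 1\<close> it is
  a moment estimate for the Yule process, whose moments of order 3 grow like
  \<open>e\<^sup>3\<^sup>c\<^sup>t\<close>; in general it follows from the resolvent identity between \<open>e\<^sub>3\<^sub>c\<close> and the
  kernels of negative parameter, all of which are nonnegative because the tails decrease. The
  bound also controls the probability of \<open>m\<close> completions. Hence the double series is dominated,
  locally uniformly, by the Cauchy product of two convergent series
  (\<open>fwd_summand_locally_bounded\<close>), its sum is continuous, and the distribution functions are
  differentiable with the sums as derivatives. The same bound shows that almost no path completes
  infinitely many waiting times in finite time (\<open>no_explosion\<close>).
\<close>

section \<open>The Mittag-Leffler function\<close>

text \<open>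
  Log-convexity of \<^const>\<open>Gamma\<close>, applied to the points \<open>x - 1 < x < x +
  a\<close>. It makes the ratio of consecutive coefficients of a Mittag-Leffler series tend to
  0.
\<close>

lemma Gamma_ratio_le:
  assumes x: "1 < (x::real)" and a: "0 < a"
  shows "Gamma x \<le> (x - 1) powr (- a) * Gamma (x + a)"
proof -
  have "(ln \<circ> Gamma) x \<le> ((ln \<circ> Gamma) (x + a) - (ln \<circ> Gamma) (x - 1)) / (x + a - (x - 1)) * (x - (x - 1))
      + (ln \<circ> Gamma) (x - 1)"
    using x a by (intro convex_onD_Icc' convex_on_subset[OF log_convex_Gamma_real]) auto
  then have "(1 + a) * ln (Gamma x) \<le> ln (Gamma (x + a)) + a * ln (Gamma (x - 1))"
    using a by (simp add: field_simps)
  moreover have "ln (Gamma x) = ln (x - 1) + ln (Gamma (x - 1))"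
    using Gamma_plus1[of "x - 1"] x
    by (subst ln_mult_pos[symmetric]) (auto simp: nonpos_Ints_def)
  ultimately have "ln (Gamma x) \<le> ln ((x - 1) powr (- a) * Gamma (x + a))"
    using x a by (subst ln_mult_pos) (auto simp: algebra_simps ln_powr)
  then show ?thesis using x a by (subst (asm) ln_le_cancel_iff) auto
qed

lemma mittag_leffler_summable:
  assumes a: "0 < \<alpha>" and b: "0 < \<beta>"
  shows "summable (\<lambda>k. x ^ k / Gamma (\<alpha> * real k + \<beta>))"
proof -
  have "((\<lambda>n. \<bar>x\<bar> * (\<alpha> * real n + \<beta> - 1) powr (- \<alpha>)) \<longlongrightarrow> \<bar>x\<bar> * 0) sequentially"
  proof (intro tendsto_mult tendsto_const tendsto_neg_powr)
    show "filterlim (\<lambda>n. \<alpha> * real n + \<beta> - 1) at_top sequentially"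
      using filterlim_tendsto_add_at_top[OF tendsto_const[of "\<beta> - 1"]
        filterlim_tendsto_pos_mult_at_top[OF tendsto_const[of \<alpha>] a filterlim_real_sequentially]]
      by (simp add: algebra_simps)
  qed (use a in simp)
  then have "eventually (\<lambda>n. \<bar>x\<bar> * (\<alpha> * real n + \<beta> - 1) powr (- \<alpha>) < 1/2) sequentially"
    by (rule order_tendstoD) simp
  moreover have "eventually (\<lambda>n. \<alpha> * real n + \<beta> > 1) sequentially"
    using a by real_asymp
  ultimately have "eventually (\<lambda>n. norm (x ^ Suc n / Gamma (\<alpha> * real (Suc n) + \<beta>))
       \<le> 1/2 * norm (x ^ n / Gamma (\<alpha> * real n + \<beta>))) sequentially"
  proof eventually_elim
    case (elim n)
    let ?z = "\<alpha> * real n + \<beta>"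
    have G: "Gamma ?z > 0" "Gamma (?z + \<alpha>) > 0" using elim a by auto
    have "Gamma ?z / Gamma (?z + \<alpha>) \<le> (?z - 1) powr (- \<alpha>)"
      using Gamma_ratio_le[OF elim(2) a] G by (simp add: field_simps)
    then have "\<bar>x\<bar> * (Gamma ?z / Gamma (?z + \<alpha>)) \<le> 1/2"
      using elim(1) mult_left_mono[of "Gamma ?z / Gamma (?z + \<alpha>)" "(?z - 1) powr (- \<alpha>)" "\<bar>x\<bar>"] by linarith
    then have "\<bar>x\<bar>^n / Gamma ?z * (\<bar>x\<bar> * (Gamma ?z / Gamma (?z + \<alpha>))) \<le> \<bar>x\<bar>^n / Gamma ?z * (1/2)"
      using G by (intro mult_left_mono) auto
    then show ?case using G
      by (simp add: norm_divide abs_mult power_abs algebra_simps)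
  qed
  then obtain N where "\<And>n. n \<ge> N \<Longrightarrow> norm (x ^ Suc n / Gamma (\<alpha> * real (Suc n) + \<beta>))
       \<le> 1/2 * norm (x ^ n / Gamma (\<alpha> * real n + \<beta>))"
    by (auto simp: eventually_sequentially)
  then show ?thesis by (intro summable_ratio_test[of "1/2" N]) auto
qed

lemma mittag_leffler_isCont:
  assumes "0 < \<alpha>" "0 < \<beta>"
  shows "isCont (mittag_leffler \<alpha> \<beta>) x"
proof -
  have "isCont (\<lambda>x. \<Sum>k. inverse (Gamma (\<alpha> * real k + \<beta>)) * x ^ k) x"
    using mittag_leffler_summable[OF assms]
    by (intro isCont_powser_converges_everywhere) (simp add: field_simps)
  then show ?thesis by (simp add: mittag_leffler_def[abs_def] field_simps)
qed

lemma mittag_leffler_measurable: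
  assumes "0 < \<alpha>" "0 < \<beta>"
  shows "mittag_leffler \<alpha> \<beta> \<in> borel_measurable borel"
  using mittag_leffler_isCont[OF assms]
  by (intro borel_measurable_continuous_onI continuous_at_imp_continuous_on) auto

lemma mittag_leffler_0: "mittag_leffler \<alpha> 1 0 = 1"
  using powser_zero[of "\<lambda>k. inverse (Gamma (\<alpha> * real k + 1))"]
  by (simp add: mittag_leffler_def field_simps)

lemma mittag_leffler_ge_1:
  assumes a: "0 < \<alpha>" and x: "0 \<le> x"
  shows "1 \<le> mittag_leffler \<alpha> 1 x"
proof -
  have "0 < Gamma (\<alpha> * real k + 1)" for k using a by (intro Gamma_real_pos add_nonneg_pos) auto
  then have "(\<Sum>k<1. x ^ k / Gamma (\<alpha> * real k + 1)) \<le> mittag_leffler \<alpha> 1 x"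
    unfolding mittag_leffler_def using x
    by (intro sum_le_suminf mittag_leffler_summable a) (auto simp: less_imp_le)
  then show ?thesis by simp
qed

lemma mittag_leffler_deriv:
  assumes a: "0 < \<alpha>"
  shows "(mittag_leffler \<alpha> 1 has_real_derivative mittag_leffler \<alpha> \<alpha> x / \<alpha>) (at x)"
proof -
  let ?c = "\<lambda>k. inverse (Gamma (\<alpha> * real k + 1))"
  have "((\<lambda>x. \<Sum>k. ?c k * x ^ k) has_real_derivative (\<Sum>k. diffs ?c k * x ^ k)) (at x)"
    using mittag_leffler_summable[OF a, of 1]
    by (intro termdiffs_strong_converges_everywhere) (simp add: field_simps)
  moreover have "diffs ?c k * x ^ k = (x ^ k / Gamma (\<alpha> * real k + \<alpha>)) / \<alpha>" for k
  proof -
    have "Gamma (\<alpha> * real (Suc k) + 1) = (\<alpha> * real (Suc k)) * Gamma (\<alpha> * real k + \<alpha>)"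
      using Gamma_plus1[of "\<alpha> * real (Suc k)"] nonpos_Ints_nonpos[of "\<alpha> * real (Suc k)"]
        mult_pos_pos[OF a, of "real (Suc k)"]
      by (force simp: algebra_simps)
    moreover have "Gamma (\<alpha> * real k + \<alpha>) > 0" using a by (intro Gamma_real_pos add_nonneg_pos) auto
    ultimately show ?thesis using a by (simp add: diffs_def field_simps del: of_nat_Suc)
  qed
  ultimately show ?thesis
    using suminf_divide[OF mittag_leffler_summable[OF a a, of x], of \<alpha>]
    by (simp add: mittag_leffler_def[abs_def] field_simps)
qed

section \<open>Mittag-Leffler kernels and their resolvent identity\<close>

text \<open>
  The Riemann-Liouville kernel: convolution with it is fractional integration of order
  \<open>\<beta>\<close>.
\<close>

definition rl_kernel :: "real \<Rightarrow> real \<Rightarrow> real" where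
  "rl_kernel \<beta> s = (if 0 < s then s powr (\<beta> - 1) / Gamma \<beta> else 0)"

text \<open>
  Up to a factor \<open>- c\<close>, this is the density belonging to the tail
  \<open>E\<^sub>\<alpha>(c s\<^sup>\<alpha>)\<close>; the theory below takes it for every
  real \<open>c\<close>, including the growing case \<open>c > 0\<close>.
\<close>

definition ml_kernel :: "real \<Rightarrow> real \<Rightarrow> real \<Rightarrow> real" where
  "ml_kernel \<alpha> c s = (if 0 < s then s powr (\<alpha> - 1) * mittag_leffler \<alpha> \<alpha> (c * s powr \<alpha>) else 0)"

lemma rl_kernel_measurable [measurable]: "rl_kernel \<beta> \<in> borel_measurable borel"
  unfolding rl_kernel_def[abs_def] by measurable

lemma ml_kernel_measurable:
  assumes "0 < \<alpha>"
  shows "ml_kernel \<alpha> c \<in> borel_measurable borel"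
proof -
  note [measurable] = mittag_leffler_measurable[OF assms assms]
  show ?thesis unfolding ml_kernel_def[abs_def] by measurable
qed

lemma rl_kernel_nonneg: "0 < \<beta> \<Longrightarrow> 0 \<le> rl_kernel \<beta> s"
  by (simp add: rl_kernel_def)

text \<open>
  After the substitution \<open>y = x t\<close> this is Euler's Beta integral.
\<close>

lemma rl_kernel_convolution:
  assumes b: "0 < \<beta>" and g: "0 < \<gamma>"
  shows "has_bochner_integral lborel (\<lambda>y. rl_kernel \<beta> (x - y) * rl_kernel \<gamma> y) (rl_kernel (\<beta> + \<gamma>) x)"
proof (cases "0 < x")
  case False
  then have "(\<lambda>y. rl_kernel \<beta> (x - y) * rl_kernel \<gamma> y) = (\<lambda>y. 0)"
    by (auto simp: rl_kernel_def)
  with False show ?thesis by (simp add: rl_kernel_def has_bochner_integral_zero)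
next
  case True
  let ?B = "\<lambda>t. if t \<in> {0<..<1} then t powr (\<gamma> - 1) * (1 - t) powr (\<beta> - 1) else 0"
  have "((\<lambda>t. t powr (\<gamma> - 1) * (1 - t) powr (\<beta> - 1)) has_integral Beta \<gamma> \<beta>) {0<..<1}"
    using has_integral_Beta_real[OF g b] by (simp add: has_integral_Icc_iff_Ioo)
  then have I: "(?B has_integral Beta \<gamma> \<beta>) UNIV"
    by (subst has_integral_restrict_UNIV)
  have m: "?B \<in> borel_measurable borel" by measurable
  have B0: "0 \<le> Beta \<gamma> \<beta>" using b g by (simp add: Beta_def)
  have "has_bochner_integral lborel ?B (Beta \<gamma> \<beta>)"
    using nn_integral_has_integral_lborel[OF m _ I] m B0
    by (intro has_bochner_integral_nn_integral) auto
  then have "has_bochner_integral lborel (\<lambda>t. ?B t * (x powr (\<beta> + \<gamma> - 2) / (Gamma \<beta> * Gamma \<gamma>)))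
       (Beta \<gamma> \<beta> * (x powr (\<beta> + \<gamma> - 2) / (Gamma \<beta> * Gamma \<gamma>)))"
    by (rule has_bochner_integral_mult_left)
  also have "(\<lambda>t. ?B t * (x powr (\<beta> + \<gamma> - 2) / (Gamma \<beta> * Gamma \<gamma>)))
     = (\<lambda>t. rl_kernel \<beta> (x - (0 + x * t)) * rl_kernel \<gamma> (0 + x * t))"
  proof
    fix t
    have e: "x - x * t = x * (1 - t)" by (simp add: algebra_simps)
    have "t \<in> {0<..<1} \<Longrightarrow> x powr (\<beta> - 1) * x powr (\<gamma> - 1) = x powr (\<beta> + \<gamma> - 2)"
      using True by (simp add: powr_add[symmetric])
    then show "?B t * (x powr (\<beta> + \<gamma> - 2) / (Gamma \<beta> * Gamma \<gamma>))
       = rl_kernel \<beta> (x - (0 + x * t)) * rl_kernel \<gamma> (0 + x * t)"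
      using True by (auto simp: rl_kernel_def e zero_less_mult_iff powr_mult)
  qed
  also have "Beta \<gamma> \<beta> * (x powr (\<beta> + \<gamma> - 2) / (Gamma \<beta> * Gamma \<gamma>)) = rl_kernel (\<beta> + \<gamma>) x /\<^sub>R \<bar>x\<bar>"
  proof -
    have "x powr (\<beta> + \<gamma> - 2) = x powr (\<beta> + \<gamma> - 1) / x"
      using powr_diff[of x "\<beta> + \<gamma> - 1" 1] True by simp
    moreover have "Gamma \<beta> > 0" "Gamma \<gamma> > 0" using b g by auto
    ultimately show ?thesis using True by (simp add: rl_kernel_def Beta_def add.commute) (simp add: divide_inverse mult_ac)
  qed
  finally show ?thesis using True
    by (subst lborel_has_bochner_integral_real_affine_iff[where c=x and t=0]) auto
qed

text \<open>
  The kernel is a geometric series \<open>\<Sum> c\<^sup>n k\<^sup>n\<^sup>+\<^sup>1\<close>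
  in the convolution powers of the Riemann-Liouville kernel \<open>k\<close> of order
  \<open>\<alpha>\<close>. Formally it equals \<open>k / (1 - c k)\<close>, which explains the
  identities that follow.
\<close>

lemma ml_kernel_sums:
  assumes a: "0 < \<alpha>"
  shows "(\<lambda>n. c ^ n * rl_kernel (\<alpha> * real (Suc n)) s) sums ml_kernel \<alpha> c s"
proof (cases "0 < s")
  case False
  then show ?thesis by (simp add: rl_kernel_def ml_kernel_def)
next
  case True
  have "(\<lambda>n. (c * s powr \<alpha>) ^ n / Gamma (\<alpha> * real n + \<alpha>)) sums mittag_leffler \<alpha> \<alpha> (c * s powr \<alpha>)"
    unfolding mittag_leffler_def by (intro summable_sums mittag_leffler_summable a)
  then have "(\<lambda>n. s powr (\<alpha> - 1) * ((c * s powr \<alpha>) ^ n / Gamma (\<alpha> * real n + \<alpha>)))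
      sums (s powr (\<alpha> - 1) * mittag_leffler \<alpha> \<alpha> (c * s powr \<alpha>))"
    by (rule sums_mult)
  moreover have "s powr (\<alpha> - 1) * ((c * s powr \<alpha>) ^ n / Gamma (\<alpha> * real n + \<alpha>))
      = c ^ n * rl_kernel (\<alpha> * real (Suc n)) s" for n
  proof -
    have "s powr (\<alpha> - 1) * (s powr \<alpha>) ^ n = s powr (\<alpha> * real (Suc n) - 1)"
      using True by (simp add: powr_power powr_add[symmetric] algebra_simps)
    then show ?thesis using True by (simp add: rl_kernel_def power_mult_distrib algebra_simps)
  qed
  ultimately show ?thesis using True by (simp add: ml_kernel_def)
qed

lemma ml_kernel_summable_norm:
  assumes a: "0 < \<alpha>"
  shows "summable (\<lambda>n. norm (c ^ n * rl_kernel (\<alpha> * real (Suc n)) s))"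
  using sums_summable[OF ml_kernel_sums[OF a, of "\<bar>c\<bar>" s]] rl_kernel_nonneg a
  by (simp add: abs_mult power_abs)

text \<open>
  In terms of the geometric series \<open>k / (1 - c k)\<close> this is the partial fraction
  decomposition of a product of two such terms. Multiplying the two series as a Cauchy product
  leaves a single interchange of sum and integral; its domination is the same identity with
  \<open>\<bar>c\<bar>\<close> and \<open>\<bar>c\<bar> + \<bar>d\<bar> + 1\<close>, which are
  distinct and dominate \<open>c\<close> and \<open>d\<close>.
\<close>

lemma ml_kernel_resolvent:
  assumes a: "0 < \<alpha>" and cd: "c \<noteq> d"
  shows "has_bochner_integral lborel (\<lambda>y. ml_kernel \<alpha> c (x - y) * ml_kernel \<alpha> d y)
           ((ml_kernel \<alpha> c x - ml_kernel \<alpha> d x) / (c - d))"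
proof -
  define T where "T c d n y = (\<Sum>i\<le>n. (c ^ i * rl_kernel (\<alpha> * real (Suc i)) (x - y)) *
      (d ^ (n - i) * rl_kernel (\<alpha> * real (Suc (n - i))) y))" for c d n y
  define w where "w c d n = (\<Sum>i\<le>n. c ^ i * d ^ (n - i)) * rl_kernel (\<alpha> * real (n + 2)) x" for c d :: real and n
  have T_int: "has_bochner_integral lborel (T c d n) (w c d n)" for c d n
  proof -
    have "has_bochner_integral lborel
        (\<lambda>y. \<Sum>i\<le>n. (c ^ i * d ^ (n - i)) * (rl_kernel (\<alpha> * real (Suc i)) (x - y) * rl_kernel (\<alpha> * real (Suc (n - i))) y))
        (\<Sum>i\<le>n. (c ^ i * d ^ (n - i)) * rl_kernel (\<alpha> * real (Suc i) + \<alpha> * real (Suc (n - i))) x)"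
      using a by (intro has_bochner_integral_sum has_bochner_integral_mult_right rl_kernel_convolution) auto
    also have "(\<Sum>i\<le>n. (c ^ i * d ^ (n - i)) * rl_kernel (\<alpha> * real (Suc i) + \<alpha> * real (Suc (n - i))) x) = w c d n"
      unfolding w_def sum_distrib_right
      by (intro sum.cong refl arg_cong2[of _ _ _ _ "(*)"] arg_cong2[of _ _ _ _ rl_kernel])
         (auto simp: algebra_simps)
    finally show ?thesis by (simp add: T_def[abs_def] mult_ac)
  qed
  have T_sums: "(\<lambda>n. T c d n y) sums (ml_kernel \<alpha> c (x - y) * ml_kernel \<alpha> d y)" for c d y
    using Cauchy_product_sums[OF ml_kernel_summable_norm[OF a] ml_kernel_summable_norm[OF a], of c "x - y" d y]
    unfolding T_def sums_unique[OF ml_kernel_sums[OF a], symmetric] .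
  have T_norm: "norm (T c d n y) \<le> T \<bar>c\<bar> \<bar>d\<bar> n y" for c d n y
    unfolding T_def by (rule order.trans[OF norm_sum])
      (use a rl_kernel_nonneg in \<open>auto simp: abs_mult power_abs intro!: sum_mono\<close>)
  have w_sums: "(\<lambda>n. w c d n) sums ((ml_kernel \<alpha> c x - ml_kernel \<alpha> d x) / (c - d))" if "c \<noteq> d" for c d
  proof -
    \<comment> \<open>The terms of index 0 of the two kernels agree and cancel in the difference.\<close>
  have tl: "(\<lambda>n. c ^ Suc n * rl_kernel (\<alpha> * real (n + 2)) x) sums (ml_kernel \<alpha> c x - rl_kernel \<alpha> x)" for c
    proof -
      let ?h = "\<lambda>n. c ^ n * rl_kernel (\<alpha> * real (Suc n)) x"
      have "?h sums ((ml_kernel \<alpha> c x - rl_kernel \<alpha> x) + ?h 0)"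
        using ml_kernel_sums[OF a, of c x] by simp
      from iffD2[OF sums_Suc_iff this] show ?thesis by (simp only: add_2_eq_Suc')
    qed
    have "(\<lambda>n. (c ^ Suc n * rl_kernel (\<alpha> * real (n + 2)) x - d ^ Suc n * rl_kernel (\<alpha> * real (n + 2)) x) / (c - d))
       sums ((ml_kernel \<alpha> c x - rl_kernel \<alpha> x - (ml_kernel \<alpha> d x - rl_kernel \<alpha> x)) / (c - d))"
      by (intro sums_divide sums_diff tl)
    moreover have "(c ^ Suc n * rl_kernel (\<alpha> * real (n + 2)) x - d ^ Suc n * rl_kernel (\<alpha> * real (n + 2)) x) / (c - d) = w c d n" for n
      using that diff_power_eq_sum[of c n d] unfolding w_def left_diff_distrib[symmetric]
      by (simp add: lessThan_Suc_atMost del: power_Suc)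
    ultimately show ?thesis by simp
  qed
  have w_summ: "summable (\<lambda>n. w \<bar>c\<bar> \<bar>d\<bar> n)"
  proof -
    have "summable (\<lambda>n. w \<bar>c\<bar> (\<bar>c\<bar> + \<bar>d\<bar> + 1) n)" using w_sums[of "\<bar>c\<bar>" "\<bar>c\<bar> + \<bar>d\<bar> + 1"] by (simp add: sums_iff)
    moreover have "norm (w \<bar>c\<bar> \<bar>d\<bar> n) \<le> w \<bar>c\<bar> (\<bar>c\<bar> + \<bar>d\<bar> + 1) n" for n
      using a rl_kernel_nonneg
      by (auto simp: w_def sum_nonneg abs_mult intro!: mult_right_mono sum_mono mult_left_mono power_mono)
    ultimately show ?thesis by (rule summable_comparison_test'[where N=0])
  qed
  have 1: "\<And>n. integrable lborel (T c d n)" using T_int by (auto simp: has_bochner_integral_iff)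
  have 2: "AE y in lborel. summable (\<lambda>n. norm (T c d n y))"
  proof (rule AE_I2)
    fix y
    show "summable (\<lambda>n. norm (T c d n y))"
      using T_norm
      by (intro summable_comparison_test'[OF sums_summable[OF T_sums[of "\<bar>c\<bar>" "\<bar>d\<bar>" y]], where N=0]) simp
  qed
  have 3: "summable (\<lambda>n. \<integral>y. norm (T c d n y) \<partial>lborel)"
  proof (rule summable_comparison_test'[OF w_summ, where N=0])
    fix n
    have "(\<integral>y. norm (T c d n y) \<partial>lborel) \<le> (\<integral>y. T \<bar>c\<bar> \<bar>d\<bar> n y \<partial>lborel)"
      using T_int T_norm by (intro integral_mono) (auto simp: has_bochner_integral_iff)
    also have "\<dots> = w \<bar>c\<bar> \<bar>d\<bar> n" using T_int by (auto simp: has_bochner_integral_iff)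
    finally show "norm (\<integral>y. norm (T c d n y) \<partial>lborel) \<le> w \<bar>c\<bar> \<bar>d\<bar> n" by simp
  qed
  have S: "(\<lambda>y. \<Sum>n. T c d n y) = (\<lambda>y. ml_kernel \<alpha> c (x - y) * ml_kernel \<alpha> d y)"
    using T_sums by (auto simp: sums_iff)
  have "integral\<^sup>L lborel (T c d n) = w c d n" for n using T_int by (auto simp: has_bochner_integral_iff)
  then show ?thesis
    using integrable_suminf[OF 1 2 3] sums_integral[OF 1 2 3] w_sums[OF cd]
    unfolding S has_bochner_integral_iff by (auto dest: sums_unique2)
qed

text \<open>
  This links the two Mittag-Leffler functions of the theorem: \<open>E\<^sub>\<alpha>\<close>
  gives tails and \<open>E\<^sub>\<alpha>\<^sub>,\<^sub>\<alpha>\<close> gives densities.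
\<close>

lemma ml_kernel_deriv:
  assumes a: "0 < \<alpha>" and s: "0 < s"
  shows "((\<lambda>s. mittag_leffler \<alpha> 1 (c * s powr \<alpha>)) has_real_derivative c * ml_kernel \<alpha> c s) (at s)"
proof -
  have "((\<lambda>s. c * s powr \<alpha>) has_real_derivative c * (\<alpha> * s powr (\<alpha> - 1))) (at s)"
    using s by (auto intro!: derivative_eq_intros)
  from DERIV_chain2[OF mittag_leffler_deriv[OF a] this] show ?thesis
    using s a by (simp add: ml_kernel_def field_simps)
qed

lemma ml_kernel_isCont:
  assumes a: "0 < \<alpha>" and s: "0 < s"
  shows "isCont (ml_kernel \<alpha> c) s"
proof -
  have "isCont (\<lambda>s. s powr (\<alpha> - 1) * mittag_leffler \<alpha> \<alpha> (c * s powr \<alpha>)) s"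
    using s by (intro continuous_intros isCont_o2[OF _ mittag_leffler_isCont[OF a a]]) auto
  moreover have "eventually (\<lambda>x. 0 < x) (nhds s)"
    using s order_tendstoD(1)[OF tendsto_ident_at, of 0 s UNIV] by (auto simp: eventually_nhds_conv_at)
  then have "eventually (\<lambda>s. ml_kernel \<alpha> c s = s powr (\<alpha> - 1) * mittag_leffler \<alpha> \<alpha> (c * s powr \<alpha>)) (nhds s)"
    by eventually_elim (simp add: ml_kernel_def)
  ultimately show ?thesis by (subst isCont_cong)
qed

lemma mittag_leffler_powr_tendsto:
  assumes a: "0 < \<alpha>"
  shows "((\<lambda>s. mittag_leffler \<alpha> 1 (c * s powr \<alpha>)) \<longlongrightarrow> 1) (at_right 0)"
proof -
  have "((\<lambda>s. s powr \<alpha>) \<longlongrightarrow> 0 powr \<alpha>) (at_right (0::real))"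
    using a by (intro tendsto_powr' tendsto_ident_at tendsto_const) (auto simp: eventually_at_filter)
  then have "((\<lambda>s. c * s powr \<alpha>) \<longlongrightarrow> c * 0) (at_right (0::real))"
    using a by (intro tendsto_mult tendsto_const) auto
  from isCont_tendsto_compose[OF mittag_leffler_isCont[OF a zero_less_one] this] show ?thesis
    by (simp add: mittag_leffler_0)
qed
lemma ml_kernel_nonneg:
  assumes "0 < \<alpha>" "0 \<le> c"
  shows "0 \<le> ml_kernel \<alpha> c s"
  using assms rl_kernel_nonneg
  by (intro sums_le[OF _ sums_zero ml_kernel_sums[OF assms(1)]]) auto

text \<open>
  The integrand may be unbounded at 0, as Mittag-Leffler kernels with \<open>\<alpha> <
  1\<close> are; hence only a right limit of the primitive is asked for there.
\<close>

lemma nn_integral_FTC_pos: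
  fixes F f :: "real \<Rightarrow> real"
  assumes deriv: "\<And>x. 0 < x \<Longrightarrow> (F has_real_derivative f x) (at x)"
    and cont: "\<And>x. 0 < x \<Longrightarrow> isCont f x"
    and nonneg: "\<And>x. 0 \<le> f x" and zero: "\<And>x. x \<le> 0 \<Longrightarrow> f x = 0"
    and lim: "(F \<longlongrightarrow> A) (at_right 0)" and t: "0 < t"
  shows "(\<integral>\<^sup>+x. ennreal (f x) * indicator {..t} x \<partial>lborel) = ennreal (F t - A)"
    and "A \<le> F t"
proof -
  have lim0: "((F \<circ> real_of_ereal) \<longlongrightarrow> A) (at_right (ereal 0))"
    using lim by (simp add: ereal_tendsto_simps)
  have "(F \<longlongrightarrow> F t) (at t)"
    using DERIV_isCont[OF deriv[OF t]] by (simp add: isCont_def)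
  then have "(F \<longlongrightarrow> F t) (at_left t)" by (simp add: filterlim_at_split)
  then have limt: "((F \<circ> real_of_ereal) \<longlongrightarrow> F t) (at_left (ereal t))"
    by (simp add: ereal_tendsto_simps)
  have I: "set_integrable lborel (einterval (ereal 0) (ereal t)) f"
    "(LBINT x=ereal 0..ereal t. f x) = F t - A"
    by (rule interval_integral_FTC_nonneg[OF _ _ _ _ lim0 limt], use t deriv cont nonneg in auto)+
  have "(\<integral>\<^sup>+x. ennreal (f x) * indicator {..t} x \<partial>lborel)
      = (\<integral>\<^sup>+x. ennreal (indicator {0<..<t} x * f x) \<partial>lborel)"
    using AE_lborel_singleton[of t] zero
    by (intro nn_integral_cong_AE) (auto simp: indicator_def not_less)
  also have "\<dots> = ennreal (\<integral>x. indicator {0<..<t} x * f x \<partial>lborel)"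
    using I(1) nonneg by (intro nn_integral_eq_integral) (auto simp: set_integrable_def)
  also have "(\<integral>x. indicator {0<..<t} x * f x \<partial>lborel) = F t - A"
    using I(2) t by (simp add: interval_lebesgue_integral_def set_lebesgue_integral_def)
  finally show "(\<integral>\<^sup>+x. ennreal (f x) * indicator {..t} x \<partial>lborel) = ennreal (F t - A)" .
  have "0 \<le> (\<integral>x. indicator {0<..<t} x * f x \<partial>lborel)"
    using nonneg by (intro integral_nonneg_AE AE_I2) auto
  then show "A \<le> F t"
    using I(2) t by (simp add: interval_lebesgue_integral_def set_lebesgue_integral_def)
qed

section \<open>Convolutions of Mittag-Leffler kernels\<close>

text \<open>
  The convolution of the kernels \<open>j c e\<^sub>j\<close>, \<open>1 \<le> j \<le>
  m\<close>, where \<open>e\<^sub>j\<close> is the kernel with parameter \<open>- j c\<close>,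
  written out by the partial fractions of \<open>\<Prod> j z / (1 + j z)\<close>, where
  \<open>z\<close> stands for \<open>c\<close> times the Riemann-Liouville kernel. For
  \<open>\<alpha> = 1\<close> it is the density of the time at which a Yule process with rate
  \<open>c\<close> reaches \<open>m + 1\<close> individuals.
\<close>

definition yule_density :: "real \<Rightarrow> real \<Rightarrow> nat \<Rightarrow> real \<Rightarrow> real" where
  "yule_density \<alpha> c m s =
     real m * c * (\<Sum>i<m. (-1) ^ i * real ((m - 1) choose i) * ml_kernel \<alpha> (- (real (Suc i) * c)) s)"

definition yule_cdf :: "real \<Rightarrow> real \<Rightarrow> nat \<Rightarrow> real \<Rightarrow> real" where
  "yule_cdf \<alpha> c m s =
     (\<Sum>j\<le>m. (-1) ^ j * real (m choose j) * mittag_leffler \<alpha> 1 (- (real j * c) * s powr \<alpha>))"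

lemma yule_density_one: "yule_density \<alpha> c (Suc 0) s = c * ml_kernel \<alpha> (- c) s"
  by (simp add: yule_density_def)

lemma yule_density_nonpos: "s \<le> 0 \<Longrightarrow> yule_density \<alpha> c m s = 0"
  by (simp add: yule_density_def ml_kernel_def)

text \<open>
  Pascal's rule turns the difference of two consecutive distribution functions into the
  alternating sum that appears in the theorem.
\<close>

lemma alternating_binomial_diff:
  fixes e :: "nat \<Rightarrow> real"
  shows "(\<Sum>j\<le>m. (-1) ^ j * real (m choose j) * e j) - (\<Sum>j\<le>Suc m. (-1) ^ j * real (Suc m choose j) * e j)
     = (\<Sum>j\<le>m. (-1) ^ j * real (m choose j) * e (Suc j))"
proof -
  have "(\<Sum>j\<le>m. (-1) ^ j * real (m choose j) * e j) = (\<Sum>j\<le>Suc m. (-1) ^ j * real (m choose j) * e j)"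
    by simp
  then have "(\<Sum>j\<le>m. (-1) ^ j * real (m choose j) * e j) - (\<Sum>j\<le>Suc m. (-1) ^ j * real (Suc m choose j) * e j)
     = (\<Sum>j\<le>Suc m. (-1) ^ j * real (m choose j) * e j - (-1) ^ j * real (Suc m choose j) * e j)"
    by (simp only: sum_subtractf)
  also have "\<dots> = (\<Sum>j\<le>m. (-1) ^ Suc j * real (m choose Suc j) * e (Suc j) - (-1) ^ Suc j * real (Suc m choose Suc j) * e (Suc j))"
    by (subst sum.atMost_Suc_shift) (simp del: power_Suc binomial_Suc_Suc)
  also have "\<dots> = (\<Sum>j\<le>m. (-1) ^ j * real (m choose j) * e (Suc j))"
    by (intro sum.cong refl) (simp add: algebra_simps)
  finally show ?thesis .
qed

lemma yule_cdf_diff: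
  "yule_cdf \<alpha> c m s - yule_cdf \<alpha> c (Suc m) s =
     (\<Sum>j\<le>m. (-1) ^ j * real (m choose j) * mittag_leffler \<alpha> 1 (- (real (Suc j) * c) * s powr \<alpha>))"
  unfolding yule_cdf_def by (rule alternating_binomial_diff)

lemma ennreal_le_cancel:
  assumes d: "0 < d" and z: "0 \<le> z" and le: "ennreal d * X \<le> ennreal (d * z)"
  shows "X \<le> ennreal z"
proof -
  have e: "ennreal (1 / d) * ennreal d = 1" using d by (simp add: ennreal_mult[symmetric])
  have le': "ennreal d * X \<le> ennreal d * ennreal z" using le d z by (simp add: ennreal_mult)
  have "ennreal (1 / d) * (ennreal d * X) \<le> ennreal (1 / d) * (ennreal d * ennreal z)"
    by (rule mult_left_mono[OF le' zero_le])
  then show ?thesis by (simp only: mult.assoc[symmetric] e mult_1)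
qed

lemma growth_constants:
  fixes y c g :: real
  assumes "0 \<le> y"
  shows "(y + 1) * c * (6 / ((y + 1) * (y + 2) * (y + 3)) * g) = 6 * c / ((y + 2) * (y + 3)) * g"
    and "(y + 4) * c * (6 / ((y + 2) * (y + 3) * (y + 4)) * g) = 6 * c / ((y + 2) * (y + 3)) * g"
proof -
  have "y + 1 \<noteq> 0" "y + 2 \<noteq> 0" "y + 3 \<noteq> 0" "y + 4 \<noteq> 0" using assms by auto
  then show "(y + 1) * c * (6 / ((y + 1) * (y + 2) * (y + 3)) * g) = 6 * c / ((y + 2) * (y + 3)) * g"
    and "(y + 4) * c * (6 / ((y + 2) * (y + 3) * (y + 4)) * g) = 6 * c / ((y + 2) * (y + 3)) * g"
    by (simp_all add: divide_simps)
qed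

text \<open>
  Nonnegativity of the kernels is assumed for the parameters in use only. For waiting times it
  follows from monotonicity of their tails.
\<close>

locale yule_kernel =
  fixes \<alpha> c :: real
  assumes alpha_pos: "0 < \<alpha>" and rate: "0 < c"
    and kernel_nonneg: "\<And>n s. 1 \<le> n \<Longrightarrow> 0 \<le> ml_kernel \<alpha> (- (real n * c)) s"
begin

abbreviation "f \<equiv> yule_density \<alpha> c"

lemma measurable_kernel [measurable]: "ml_kernel \<alpha> d \<in> borel_measurable borel"
  by (rule ml_kernel_measurable[OF alpha_pos])

lemma measurable_density [measurable]: "f m \<in> borel_measurable borel"
  unfolding yule_density_def[abs_def] by measurable

lemma density_isCont: "0 < s \<Longrightarrow> isCont (f m) s"
  unfolding yule_density_def[abs_def]
  by (intro continuous_intros ml_kernel_isCont[OF alpha_pos])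

text \<open>
  Each of the \<open>m\<close> kernels is convolved with the new one by the resolvent
  identity. Up to a common factor, the coefficients of the new kernel add up to
  \<open>\<plusminus> 1\<close> because an alternating sum of binomial coefficients vanishes.
\<close>

lemma density_Suc:
  assumes m: "1 \<le> m"
  shows "has_bochner_integral lborel (\<lambda>y. f m (x - y) * (real (Suc m) * c * ml_kernel \<alpha> (- (real (Suc m) * c)) y))
     (f (Suc m) x)"
proof -
  let ?k = "\<lambda>i. ml_kernel \<alpha> (- (real (Suc i) * c))"
  let ?w = "\<lambda>i. real m * c * ((-1) ^ i * real ((m - 1) choose i)) * (real (Suc m) * c)"
  have distr: "(\<Sum>i<m. A * (g i * (K i - Km))) = A * ((\<Sum>i<m. g i * K i) - (\<Sum>i<m. g i) * Km)"
    for A Km :: real and g K :: "nat \<Rightarrow> real"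
    by (simp add: sum_distrib_left sum_distrib_right right_diff_distrib sum_subtractf)
  have neq: "- (real (Suc i) * c) \<noteq> - (real (Suc m) * c)" if "i < m" for i
    using that rate by simp
  have "has_bochner_integral lborel (\<lambda>y. \<Sum>i<m. ?w i * (?k i (x - y) * ?k m y))
     (\<Sum>i<m. ?w i * ((?k i x - ?k m x) / (- (real (Suc i) * c) - - (real (Suc m) * c))))"
    using neq by (intro has_bochner_integral_sum has_bochner_integral_mult_right ml_kernel_resolvent[OF alpha_pos]) auto
  also have "(\<lambda>y. \<Sum>i<m. ?w i * (?k i (x - y) * ?k m y)) = (\<lambda>y. f m (x - y) * (real (Suc m) * c * ?k m y))"
    unfolding yule_density_def sum_distrib_right sum_distrib_left
    by (intro ext sum.cong) (simp_all add: mult_ac del: of_nat_Suc)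
  also have "(\<Sum>i<m. ?w i * ((?k i x - ?k m x) / (- (real (Suc i) * c) - - (real (Suc m) * c))))
      = (\<Sum>i<m. real (Suc m) * c * ((-1) ^ i * real (m choose i) * (?k i x - ?k m x)))"
  proof (intro sum.cong refl)
    fix i assume "i \<in> {..<m}"
    then have i: "i < m" by simp
    have "real ((m - i) * (m choose i)) = real (m * ((m - 1) choose i))"
      using binomial_absorb_comp[of m i] by simp
    then have e: "(real m - real i) * real (m choose i) = real m * real ((m - 1) choose i)"
      using i by (simp add: of_nat_diff)
    have d: "- (real (Suc i) * c) - - (real (Suc m) * c) = (real m - real i) * c" by (simp add: algebra_simps)
    have "?w i = ((real m - real i) * c) * (real (Suc m) * c * ((-1) ^ i * real (m choose i)))"
      using e by (simp add: mult_ac del: of_nat_Suc)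
    moreover have "D * (E * b) * (z / D) = E * (b * z)" if "D \<noteq> 0" for D E b z :: real using that by simp
    moreover have "(real m - real i) * c \<noteq> 0" using i rate by simp
    ultimately show "?w i * ((?k i x - ?k m x) / (- (real (Suc i) * c) - - (real (Suc m) * c)))
      = real (Suc m) * c * ((-1) ^ i * real (m choose i) * (?k i x - ?k m x))"
      unfolding d by (simp only:)
  qed
  also have "\<dots> = real (Suc m) * c * ((\<Sum>i<m. (-1) ^ i * real (m choose i) * ?k i x)
       - (\<Sum>i<m. (-1) ^ i * real (m choose i)) * ?k m x)"
    by (rule distr)
  also have "(\<Sum>i<m. (-1) ^ i * real (m choose i)) = - ((-1) ^ m)"
    using choose_alternating_sum[of m, where 'a=real] m
    by (simp add: lessThan_Suc_atMost[symmetric] eq_neg_iff_add_eq_0)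
  also have "real (Suc m) * c * ((\<Sum>i<m. (-1) ^ i * real (m choose i) * ?k i x) - - ((-1) ^ m) * ?k m x) = f (Suc m) x"
    by (simp add: yule_density_def del: of_nat_Suc)
  finally show ?thesis .
qed

lemma density_nonneg: "0 \<le> f m x"
proof (induction m arbitrary: x)
  case (Suc m)
  show ?case
  proof (cases "m = 0")
    case True
    then show ?thesis using kernel_nonneg[of 1] rate by (simp add: yule_density_one)
  next
    case False
    then show ?thesis
      using density_Suc[of m x] kernel_nonneg[of "Suc m"] rate Suc
      by (auto simp: has_bochner_integral_iff dest!: sym[of _ "f (Suc m) x"] intro!: integral_nonneg_AE AE_I2)
  qed
qed (simp add: yule_density_def)

lemma density_Suc_nn:
  assumes m: "1 \<le> m"
  shows "(\<integral>\<^sup>+y. ennreal (f m (x - y)) * ennreal (real (Suc m) * c * ml_kernel \<alpha> (- (real (Suc m) * c)) y) \<partial>lborel)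
     = ennreal (f (Suc m) x)"
  using density_Suc[OF m, of x] density_nonneg kernel_nonneg[of "Suc m"] rate
  by (simp add: ennreal_mult[symmetric] has_bochner_integral_iff nn_integral_eq_integral del: of_nat_Suc)

text \<open>
  The density convolved with an exponentially growing kernel. Comparing two such convolutions
  bounds the densities by terms that are summable in their index; the parameter \<open>3
  c\<close> yields cubic decay here, hence quadratic decay of the densities, whereas with
  \<open>c\<close> the densities would merely be bounded.
\<close>

definition growth :: "nat \<Rightarrow> real \<Rightarrow> ennreal" where
  "growth M x = (\<integral>\<^sup>+y. ennreal (f M (x - y)) * ennreal (ml_kernel \<alpha> (3 * c) y) \<partial>lborel)"

lemma resolvent_nn:
  assumes n: "1 \<le> n"
  shows "ennreal (ml_kernel \<alpha> (3 * c) y) = ennreal (ml_kernel \<alpha> (- (real n * c)) y) +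
    ennreal ((real n + 3) * c) *
      (\<integral>\<^sup>+z. ennreal (ml_kernel \<alpha> (- (real n * c)) (y - z)) * ennreal (ml_kernel \<alpha> (3 * c) z) \<partial>lborel)"
proof -
  let ?k = "ml_kernel \<alpha> (- (real n * c))" and ?g = "ml_kernel \<alpha> (3 * c)"
  have "- (real n * c) \<noteq> 3 * c" using rate n by (simp add: add_nonneg_eq_0_iff minus_equation_iff) (smt (verit) mult_nonneg_nonneg of_nat_0_le_iff)
  from ml_kernel_resolvent[OF alpha_pos this, of y]
  have I: "has_bochner_integral lborel (\<lambda>z. ?k (y - z) * ?g z) ((?k y - ?g y) / (- (real n * c) - 3 * c))" .
  have nn: "0 \<le> ?k s" "0 \<le> ?g s" for s
    using kernel_nonneg[OF n] ml_kernel_nonneg[OF alpha_pos, of "3 * c"] rate by auto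
  have e: "(?k y - ?g y) / (- (real n * c) - 3 * c) = (?g y - ?k y) / ((real n + 3) * c)"
  proof -
    have "- (real n * c) - 3 * c = - ((real n + 3) * c)" by (simp add: algebra_simps)
    then show ?thesis by (metis minus_diff_eq minus_divide_divide)
  qed
  have i: "(\<integral>\<^sup>+z. ennreal (?k (y - z)) * ennreal (?g z) \<partial>lborel) = ennreal ((?g y - ?k y) / ((real n + 3) * c))"
    using I nn unfolding e by (simp add: ennreal_mult[symmetric] has_bochner_integral_iff nn_integral_eq_integral)
  have "0 \<le> (\<integral>z. ?k (y - z) * ?g z \<partial>lborel)"
    using nn by (intro integral_nonneg_AE AE_I2) auto
  then have ge: "0 \<le> (?g y - ?k y) / ((real n + 3) * c)"
    using I unfolding e by (simp add: has_bochner_integral_iff)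
  have p: "0 < (real n + 3) * c" using rate by (intro mult_pos_pos) auto
  have "D * (z / D) = z" if "0 < D" for D z :: real using that by simp
  from this[OF p, of "?g y - ?k y"]
  have "?g y = ?k y + (real n + 3) * c * ((?g y - ?k y) / ((real n + 3) * c))" by linarith
  then have "ennreal (?g y) = ennreal (?k y + (real n + 3) * c * ((?g y - ?k y) / ((real n + 3) * c)))"
    by (rule arg_cong)
  also have "\<dots> = ennreal (?k y) + ennreal ((real n + 3) * c) * ennreal ((?g y - ?k y) / ((real n + 3) * c))"
    using nn p ge by (simp only: ennreal_plus ennreal_mult mult_nonneg_nonneg less_imp_le)
  finally show ?thesis unfolding i .
qed

text \<open>
  The resolvent identity in the form \<open>e\<^sub>3 = e + (n + 3) c (e * e\<^sub>3)\<close>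
  for \<open>n = M + 1\<close>, convolved with the \<open>M\<close>-th density. All terms are
  nonnegative, so the equation bounds both terms on the right by the left-hand side.
\<close>

lemma growth_step:
  assumes M: "1 \<le> M"
  shows "ennreal (real (Suc M) * c) * growth M x = ennreal (f (Suc M) x) + ennreal ((real (Suc M) + 3) * c) * growth (Suc M) x"
proof -
  let ?n = "Suc M"
  let ?k = "ml_kernel \<alpha> (- (real ?n * c))" and ?g = "ml_kernel \<alpha> (3 * c)"
  let ?a = "ennreal (real ?n * c)" and ?b = "ennreal ((real ?n + 3) * c)"
  have nn: "0 \<le> ?k s" "0 \<le> ?g s" for s
    using kernel_nonneg[of ?n] ml_kernel_nonneg[OF alpha_pos, of "3 * c"] rate by auto
  have F: "?a * (\<integral>\<^sup>+y. ennreal (f M (x - y)) * ennreal (?k y) \<partial>lborel) = ennreal (f ?n x)" for x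
    using density_Suc_nn[OF M, of x] rate nn
    by (simp add: nn_integral_cmult[symmetric] ennreal_mult mult_ac del: of_nat_Suc)
  have "growth M x = (\<integral>\<^sup>+y. ennreal (f M (x - y)) * ennreal (?k y) +
      ?b * (ennreal (f M (x - y)) * (\<integral>\<^sup>+z. ennreal (?k (y - z)) * ennreal (?g z) \<partial>lborel)) \<partial>lborel)"
    unfolding growth_def
    by (subst resolvent_nn[of ?n]) (simp_all add: ring_distribs mult_ac del: of_nat_Suc)
  also have "\<dots> = (\<integral>\<^sup>+y. ennreal (f M (x - y)) * ennreal (?k y) \<partial>lborel) +
      ?b * (\<integral>\<^sup>+y. ennreal (f M (x - y)) * (\<integral>\<^sup>+z. ennreal (?k (y - z)) * ennreal (?g z) \<partial>lborel) \<partial>lborel)"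
    by (simp add: nn_integral_add nn_integral_cmult)
  also have "(\<integral>\<^sup>+y. ennreal (f M (x - y)) * (\<integral>\<^sup>+z. ennreal (?k (y - z)) * ennreal (?g z) \<partial>lborel) \<partial>lborel)
     = (\<integral>\<^sup>+y. (\<integral>\<^sup>+z. ennreal (f M (x - y)) * (ennreal (?k (y - z)) * ennreal (?g z)) \<partial>lborel) \<partial>lborel)"
    by (simp add: nn_integral_cmult)
  also have "\<dots> = (\<integral>\<^sup>+z. (\<integral>\<^sup>+y. ennreal (f M (x - y)) * (ennreal (?k (y - z)) * ennreal (?g z)) \<partial>lborel) \<partial>lborel)"
    by (rule lborel_pair.Fubini') measurable
  also have "\<dots> = (\<integral>\<^sup>+z. (\<integral>\<^sup>+y. ennreal (f M (x - z - y)) * ennreal (?k y) \<partial>lborel) * ennreal (?g z) \<partial>lborel)"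
  proof (intro nn_integral_cong)
    fix z
    have "(\<integral>\<^sup>+y. ennreal (f M (x - y)) * (ennreal (?k (y - z)) * ennreal (?g z)) \<partial>lborel)
      = (\<integral>\<^sup>+y. ennreal (f M (x - (z + 1 * y))) * (ennreal (?k (z + 1 * y - z)) * ennreal (?g z)) \<partial>lborel)"
      by (subst nn_integral_real_affine[where c=1 and t=z]) simp_all
    also have "\<dots> = (\<integral>\<^sup>+y. (ennreal (f M (x - z - y)) * ennreal (?k y)) * ennreal (?g z) \<partial>lborel)"
      by (simp add: mult.assoc diff_diff_eq del: of_nat_Suc)
    also have "\<dots> = (\<integral>\<^sup>+y. ennreal (f M (x - z - y)) * ennreal (?k y) \<partial>lborel) * ennreal (?g z)"
      by (rule nn_integral_multc) measurable
    finally show "(\<integral>\<^sup>+y. ennreal (f M (x - y)) * (ennreal (?k (y - z)) * ennreal (?g z)) \<partial>lborel)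
      = (\<integral>\<^sup>+y. ennreal (f M (x - z - y)) * ennreal (?k y) \<partial>lborel) * ennreal (?g z)" .
  qed
  finally have "?a * growth M x = ?a * (\<integral>\<^sup>+y. ennreal (f M (x - y)) * ennreal (?k y) \<partial>lborel) +
      ?b * (?a * (\<integral>\<^sup>+z. (\<integral>\<^sup>+y. ennreal (f M (x - z - y)) * ennreal (?k y) \<partial>lborel) * ennreal (?g z) \<partial>lborel))"
    unfolding mult.left_commute[of ?b ?a] distrib_left[symmetric] by (rule arg_cong)
  also have "?a * (\<integral>\<^sup>+z. (\<integral>\<^sup>+y. ennreal (f M (x - z - y)) * ennreal (?k y) \<partial>lborel) * ennreal (?g z) \<partial>lborel)
      = growth ?n x"
    unfolding growth_def F[symmetric] by (subst nn_integral_cmult[symmetric]) (simp_all only: mult.assoc, measurable)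
  finally show ?thesis unfolding F .
qed

text \<open>
  Dropping the density from the preceding recursion multiplies the bound by \<open>(M + 1) /
  (M + 4)\<close> in each step; the product of these factors telescopes.
\<close>

lemma growth_bound:
  assumes "1 \<le> M"
  shows "growth M x \<le> ennreal (6 / ((real M + 1) * (real M + 2) * (real M + 3)) * ml_kernel \<alpha> (3 * c) x)"
  using assms
proof (induction M rule: dec_induct)
  case base
  let ?g = "ml_kernel \<alpha> (3 * c)"
  have g0: "0 \<le> ?g x" using ml_kernel_nonneg[OF alpha_pos, of "3 * c"] rate by simp
  have k0: "0 \<le> ml_kernel \<alpha> (- c) s" for s using kernel_nonneg[of 1] by simp
  have "growth 1 x = ennreal c * (\<integral>\<^sup>+z. ennreal (ml_kernel \<alpha> (- c) (x - z)) * ennreal (?g z) \<partial>lborel)"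
    unfolding growth_def using rate k0
    by (simp add: yule_density_one ennreal_mult mult.assoc nn_integral_cmult)
  then have "ennreal 4 * growth 1 x = ennreal (4 * c) * (\<integral>\<^sup>+z. ennreal (ml_kernel \<alpha> (- c) (x - z)) * ennreal (?g z) \<partial>lborel)"
    using rate by (simp add: ennreal_mult mult.assoc)
  also have "\<dots> \<le> ennreal (ml_kernel \<alpha> (- c) x) + \<dots>" by simp
  also have "\<dots> = ennreal (4 * (1/4 * ?g x))" using resolvent_nn[of 1 x] by simp
  finally have "growth 1 x \<le> ennreal (1/4 * ?g x)"
    by (rule ennreal_le_cancel[rotated 2]) (use g0 in auto)
  then show ?case by simp
next
  case (step M)
  let ?g = "ml_kernel \<alpha> (3 * c) x"
  have g0: "0 \<le> ?g" using ml_kernel_nonneg[OF alpha_pos, of "3 * c"] rate by simp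
  let ?n = "real (Suc M)"
  have p: "0 < (?n + 3) * c" "0 < ?n" using rate by auto
  have "ennreal ((?n + 3) * c) * growth (Suc M) x \<le> ennreal (?n * c) * growth M x"
    unfolding growth_step[OF step(1)] by simp
  also have "\<dots> \<le> ennreal (?n * c) * ennreal (6 / ((real M + 1) * (real M + 2) * (real M + 3)) * ?g)"
    by (intro mult_left_mono step) auto
  also have "\<dots> = ennreal (?n * c * (6 / ((real M + 1) * (real M + 2) * (real M + 3)) * ?g))"
    using p rate by (subst ennreal_mult'') (auto simp: ennreal_mult' g0)
  also have "?n * c * (6 / ((real M + 1) * (real M + 2) * (real M + 3)) * ?g)
      = (?n + 3) * c * (6 / ((?n + 1) * (?n + 2) * (?n + 3)) * ?g)"
    using growth_constants(1)[of "real M" c ?g] growth_constants(2)[of "real M" c ?g]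
    by (simp add: add.commute add.left_commute)
  finally show ?case
    by (rule ennreal_le_cancel[rotated 2]) (use p g0 in auto)
qed

text \<open>
  The central estimate: summable in \<open>m\<close>, and locally uniform in \<open>x\<close>
  because the kernel on the right is continuous. It is the other half of the recursion for
  \<^const>\<open>growth\<close>.
\<close>

lemma density_bound:
  assumes m: "1 \<le> m"
  shows "f m x \<le> 6 * c / ((real m + 1) * (real m + 2)) * ml_kernel \<alpha> (3 * c) x"
proof (cases "m = 1")
  case True
  have g0: "0 \<le> ml_kernel \<alpha> (3 * c) x" using ml_kernel_nonneg[OF alpha_pos, of "3 * c"] rate by simp
  have "ennreal (ml_kernel \<alpha> (- c) x) \<le> ennreal (ml_kernel \<alpha> (3 * c) x)"
    using resolvent_nn[of 1 x] by simp
  then have "ml_kernel \<alpha> (- c) x \<le> ml_kernel \<alpha> (3 * c) x" using g0 by (simp add: ennreal_le_iff)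
  then show ?thesis using True rate by (simp add: yule_density_one)
next
  case False
  then obtain M where M: "m = Suc M" "1 \<le> M" using m by (cases m) auto
  let ?g = "ml_kernel \<alpha> (3 * c) x"
  have g0: "0 \<le> ?g" using ml_kernel_nonneg[OF alpha_pos, of "3 * c"] rate by simp
  have "ennreal (f m x) \<le> ennreal (real m * c) * growth M x"
    unfolding M(1) growth_step[OF M(2)] by simp
  also have "\<dots> \<le> ennreal (real m * c) * ennreal (6 / ((real M + 1) * (real M + 2) * (real M + 3)) * ?g)"
    by (intro mult_left_mono growth_bound M) auto
  also have "\<dots> = ennreal (real m * c * (6 / ((real M + 1) * (real M + 2) * (real M + 3)) * ?g))"
    using rate g0 by (intro ennreal_mult[symmetric] mult_nonneg_nonneg divide_nonneg_nonneg) auto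
  also have "real m * c * (6 / ((real M + 1) * (real M + 2) * (real M + 3)) * ?g)
      = 6 * c / ((real m + 1) * (real m + 2)) * ?g"
    using growth_constants(1)[of "real M" c ?g] unfolding M(1) by (simp add: add.commute add.left_commute)
  finally show ?thesis using rate g0 by (subst (asm) ennreal_le_iff) auto
qed

lemma cdf_deriv:
  assumes m: "1 \<le> m" and s: "0 < s"
  shows "(yule_cdf \<alpha> c m has_real_derivative f m s) (at s)"
proof -
  have "((\<lambda>s. \<Sum>j\<le>m. (-1) ^ j * real (m choose j) * mittag_leffler \<alpha> 1 (- (real j * c) * s powr \<alpha>))
     has_real_derivative (\<Sum>j\<le>m. (-1) ^ j * real (m choose j) * (- (real j * c) * ml_kernel \<alpha> (- (real j * c)) s))) (at s)"
    by (intro DERIV_sum DERIV_cmult ml_kernel_deriv alpha_pos s)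
  also have "(\<Sum>j\<le>m. (-1) ^ j * real (m choose j) * (- (real j * c) * ml_kernel \<alpha> (- (real j * c)) s)) = f m s"
  proof -
    obtain M where M: "m = Suc M" using m by (cases m) auto
    have "(\<Sum>j\<le>m. (-1) ^ j * real (m choose j) * (- (real j * c) * ml_kernel \<alpha> (- (real j * c)) s))
      = (\<Sum>i\<le>M. (-1) ^ Suc i * real (m choose Suc i) * (- (real (Suc i) * c) * ml_kernel \<alpha> (- (real (Suc i) * c)) s))"
      unfolding M by (subst sum.atMost_Suc_shift) simp
    also have "\<dots> = (\<Sum>i\<le>M. real m * c * ((-1) ^ i * real ((m - 1) choose i) * ml_kernel \<alpha> (- (real (Suc i) * c)) s))"
    proof (intro sum.cong refl)
      fix i
      have "real (Suc i * (m choose Suc i)) = real (m * ((m - 1) choose i))"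
        using binomial_absorption[of i m] by simp
      then have e: "real (Suc i) * real (m choose Suc i) = real m * real ((m - 1) choose i)"
        by (simp only: of_nat_mult)
      have "(-1) ^ Suc i * real (m choose Suc i) * (- (real (Suc i) * c) * ml_kernel \<alpha> (- (real (Suc i) * c)) s)
         = (-1) ^ i * (real (Suc i) * real (m choose Suc i)) * c * ml_kernel \<alpha> (- (real (Suc i) * c)) s"
        by (simp del: of_nat_Suc)
      then show "(-1) ^ Suc i * real (m choose Suc i) * (- (real (Suc i) * c) * ml_kernel \<alpha> (- (real (Suc i) * c)) s)
         = real m * c * ((-1) ^ i * real ((m - 1) choose i) * ml_kernel \<alpha> (- (real (Suc i) * c)) s)"
        unfolding e by (simp only: mult_ac)
    qed
    finally show ?thesis
      unfolding yule_density_def M by (simp add: sum_distrib_left lessThan_Suc_atMost)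
  qed
  finally show ?thesis unfolding yule_cdf_def[abs_def] .
qed

lemma nn_integral_density:
  assumes m: "1 \<le> m" and t: "0 < t"
  shows "(\<integral>\<^sup>+x. ennreal (f m x) * indicator {..t} x \<partial>lborel) = ennreal (yule_cdf \<alpha> c m t)"
    and "0 \<le> yule_cdf \<alpha> c m t"
proof -
  have "((\<lambda>s. \<Sum>j\<le>m. (-1) ^ j * real (m choose j) * mittag_leffler \<alpha> 1 (- (real j * c) * s powr \<alpha>))
     \<longlongrightarrow> (\<Sum>j\<le>m. (-1) ^ j * real (m choose j) * 1)) (at_right 0)"
    by (intro tendsto_sum tendsto_mult tendsto_const mittag_leffler_powr_tendsto alpha_pos)
  then have "(yule_cdf \<alpha> c m \<longlongrightarrow> 0) (at_right 0)"
    using choose_alternating_sum[of m, where 'a=real] m by (simp add: yule_cdf_def[abs_def])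
  note FTC = nn_integral_FTC_pos[OF cdf_deriv[OF m] density_isCont density_nonneg yule_density_nonpos this t]
  show "(\<integral>\<^sup>+x. ennreal (f m x) * indicator {..t} x \<partial>lborel) = ennreal (yule_cdf \<alpha> c m t)"
    using FTC(1) by simp
  show "0 \<le> yule_cdf \<alpha> c m t" using FTC(2) .
qed

lemma yule_cdf_bound:
  assumes m: "1 \<le> m" and t: "0 < t"
  shows "yule_cdf \<alpha> c m t \<le> 2 * (mittag_leffler \<alpha> 1 (3 * c * t powr \<alpha>) - 1) / ((real m + 1) * (real m + 2))"
proof -
  let ?g = "ml_kernel \<alpha> (3 * c)"
  let ?F = "\<lambda>s. mittag_leffler \<alpha> 1 (3 * c * s powr \<alpha>)" and ?q = "2 / ((real m + 1) * (real m + 2))"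
  have g0: "0 \<le> ?g x" for x using ml_kernel_nonneg[OF alpha_pos, of "3 * c"] rate by simp
  have "(\<integral>\<^sup>+x. ennreal (3 * c * ?g x) * indicator {..t} x \<partial>lborel) = ennreal (?F t - 1)"
    using g0 rate by (intro nn_integral_FTC_pos(1) ml_kernel_deriv ml_kernel_isCont mittag_leffler_powr_tendsto
        alpha_pos t continuous_intros) (auto simp: ml_kernel_def)
  note mass = this
  have le: "f m x \<le> ?q * (3 * c * ?g x)" for x
    using density_bound[OF m, of x] by simp
  have "(\<integral>\<^sup>+x. ennreal (f m x) * indicator {..t} x \<partial>lborel)
      \<le> (\<integral>\<^sup>+x. ennreal ?q * (ennreal (3 * c * ?g x) * indicator {..t} x) \<partial>lborel)"
  proof (rule nn_integral_mono)
    fix x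
    have "ennreal (f m x) \<le> ennreal (?q * (3 * c * ?g x))" by (rule ennreal_leI[OF le])
    also have "\<dots> = ennreal ?q * ennreal (3 * c * ?g x)"
      using g0 rate by (intro ennreal_mult) auto
    finally show "ennreal (f m x) * indicator {..t} x \<le> ennreal ?q * (ennreal (3 * c * ?g x) * indicator {..t} x)"
      by (auto split: split_indicator)
  qed
  also have "\<dots> = ennreal ?q * ennreal (?F t - 1)"
    unfolding mass[symmetric] by (rule nn_integral_cmult) measurable
  finally have le: "ennreal (yule_cdf \<alpha> c m t) \<le> ennreal ?q * ennreal (?F t - 1)"
    unfolding nn_integral_density(1)[OF m t] .
  have "0 \<le> ?F t - 1"
    using mittag_leffler_ge_1[OF alpha_pos, of "3 * c * t powr \<alpha>"] rate by simp
  then show ?thesis using le by (simp add: ennreal_mult[symmetric] ennreal_le_iff mult.commute)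
qed

lemma density_locally_bounded:
  assumes "0 < s0"
  shows "\<exists>C\<ge>0. \<forall>m\<ge>1. \<forall>s\<in>{s0..s1}. f m s \<le> C / ((real m + 1) * (real m + 2))"
proof -
  have "continuous_on {s0..s1} (ml_kernel \<alpha> (3 * c))"
    using assms by (intro continuous_at_imp_continuous_on ballI ml_kernel_isCont alpha_pos) auto
  then have "bounded (ml_kernel \<alpha> (3 * c) ` {s0..s1})"
    by (intro compact_imp_bounded compact_continuous_image) auto
  then obtain B where B: "0 < B" "\<And>s. s \<in> {s0..s1} \<Longrightarrow> \<bar>ml_kernel \<alpha> (3 * c) s\<bar> \<le> B"
    by (auto simp: bounded_pos)
  show ?thesis
  proof (intro exI[of _ "6 * c * B"] conjI allI impI ballI)
    fix m :: nat and s assume m: "1 \<le> m" and s: "s \<in> {s0..s1}"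
    have "f m s \<le> 6 * c / ((real m + 1) * (real m + 2)) * ml_kernel \<alpha> (3 * c) s" by (rule density_bound[OF m])
    also have "\<dots> \<le> 6 * c / ((real m + 1) * (real m + 2)) * B"
      using B(2)[OF s] rate by (intro mult_left_mono divide_nonneg_nonneg) auto
    finally show "f m s \<le> 6 * c * B / ((real m + 1) * (real m + 2))" by simp
  qed (use rate B in auto)
qed

end
section \<open>Sums of independent Mittag-Leffler waiting times\<close>

locale yule_sums = prob_space M for M :: "'a measure" +
  fixes \<alpha> c :: real and W :: "nat \<Rightarrow> 'a \<Rightarrow> real"
  assumes alpha0: "0 < \<alpha>" and rate0: "0 < c"
    and W_pos: "\<And>n \<omega>. 1 \<le> n \<Longrightarrow> \<omega> \<in> space M \<Longrightarrow> 0 < W n \<omega>"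
    and W_tail: "\<And>n t. 1 \<le> n \<Longrightarrow> 0 \<le> t \<Longrightarrow>
      \<P>(\<omega> in M. W n \<omega> > t) = mittag_leffler \<alpha> 1 (- real n * c * t powr \<alpha>)"
    and W_indep: "indep_vars (\<lambda>_. borel) W {1..}"
begin

lemma W_measurable [measurable]: "1 \<le> n \<Longrightarrow> W n \<in> borel_measurable M"
  using W_indep by (auto simp: indep_vars_def)

text \<open>
  Were the kernel negative at some point, the tail of \<open>W n\<close> would increase to the
  right of that point.
\<close>

lemma tail_kernel_nonneg:
  assumes n: "1 \<le> n"
  shows "0 \<le> ml_kernel \<alpha> (- (real n * c)) s"
proof (cases "0 < s")
  case True
  note [measurable] = W_measurable[OF n]
  let ?F = "\<lambda>s. mittag_leffler \<alpha> 1 (- (real n * c) * s powr \<alpha>)"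
  have anti: "?F t \<le> ?F s" if "0 \<le> s" "s \<le> t" for s t
  proof -
    have "\<P>(\<omega> in M. W n \<omega> > t) \<le> \<P>(\<omega> in M. W n \<omega> > s)"
      using that by (intro finite_measure_mono) auto
    then show ?thesis using that W_tail[OF n, of s] W_tail[OF n, of t] by simp
  qed
  show ?thesis
  proof (rule ccontr)
    assume "\<not> ?thesis"
    then have "0 < - (real n * c) * ml_kernel \<alpha> (- (real n * c)) s"
      using n rate0 by (intro mult_neg_neg) auto
    from DERIV_pos_inc_right[OF ml_kernel_deriv[OF alpha0 True] this]
    obtain d where "d > 0" and d: "\<And>h. 0 < h \<Longrightarrow> h < d \<Longrightarrow> ?F s < ?F (s + h)" by auto
    then show False using d[of "d / 2"] anti[of s "s + d / 2"] True by linarith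
  qed
qed (simp add: ml_kernel_def)

sublocale yule_kernel \<alpha> c
  by unfold_locales (use alpha0 rate0 tail_kernel_nonneg in auto)

lemma W_distributed:
  assumes n: "1 \<le> n"
  shows "distributed M lborel (W n) (\<lambda>x. ennreal (real n * c * ml_kernel \<alpha> (- (real n * c)) x))"
proof (rule distributedI_borel_atMost)
  let ?k = "ml_kernel \<alpha> (- (real n * c))"
  let ?F = "\<lambda>t. mittag_leffler \<alpha> 1 (- (real n * c) * t powr \<alpha>)"
  let ?g = "\<lambda>a. if 0 < a then 1 - ?F a else 0"
  note [measurable] = W_measurable[OF n]
  show "W n \<in> borel_measurable M" "(\<lambda>x. real n * c * ?k x) \<in> borel_measurable borel" by measurable
  show "AE x in lborel. 0 \<le> real n * c * ?k x"
    using kernel_nonneg[OF n] rate by (intro AE_I2) auto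
  have "(\<integral>\<^sup>+x. ennreal (real n * c * ?k x) * indicator {..a} x \<partial>lborel) = ennreal (?g a)" for a
  proof (cases "0 < a")
    case True
    have "(\<integral>\<^sup>+x. ennreal (real n * c * ?k x) * indicator {..a} x \<partial>lborel) = ennreal (- ?F a - (- 1))"
    proof (rule nn_integral_FTC_pos(1)[OF _ _ _ _ _ True])
      show "((\<lambda>x. - ?F x) has_real_derivative real n * c * ?k x) (at x)" if "0 < x" for x
        using DERIV_minus[OF ml_kernel_deriv[OF alpha0 that, of "- (real n * c)"]] by simp
      show "isCont (\<lambda>x. real n * c * ?k x) x" if "0 < x" for x
        by (intro continuous_intros ml_kernel_isCont alpha0 that)
      show "((\<lambda>x. - ?F x) \<longlongrightarrow> - 1) (at_right 0)"
        by (intro tendsto_minus mittag_leffler_powr_tendsto alpha0)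
    qed (use kernel_nonneg[OF n] rate in \<open>auto simp: ml_kernel_def\<close>)
    then show ?thesis using True by simp
  next
    case False
    then have "(\<integral>\<^sup>+x. ennreal (real n * c * ?k x) * indicator {..a} x \<partial>lborel) = (\<integral>\<^sup>+x. 0 \<partial>(lborel :: real measure))"
      by (intro nn_integral_cong) (auto simp: ml_kernel_def indicator_def)
    then show ?thesis using False by simp
  qed
  then show "(\<integral>\<^sup>+x. ennreal (real n * c * ?k x * indicator {..a} x) \<partial>lborel) = ennreal (?g a)" for a
    by (simp only: nn_integral_set_ennreal)
  show "emeasure M {x \<in> space M. W n x \<le> a} = ennreal (?g a)" for a
  proof (cases "0 < a")
    case True
    have "\<P>(\<omega> in M. W n \<omega> \<le> a) = \<P>(\<omega> in M. \<not> W n \<omega> > a)" by (simp add: not_less)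
    also have "\<dots> = 1 - \<P>(\<omega> in M. W n \<omega> > a)"
      by (rule prob_neg) simp
    finally show ?thesis using True W_tail[OF n, of a] by (simp add: emeasure_eq_measure)
  next
    case False
    then have "\<not> W n x \<le> a" if "x \<in> space M" for x using W_pos[OF n that] by linarith
    then have e: "{x \<in> space M. W n x \<le> a} = {}" by auto
    show ?thesis unfolding e using False by simp
  qed
qed

definition waiting :: "nat \<Rightarrow> 'a \<Rightarrow> real" where "waiting k \<omega> = (\<Sum>i=1..k. W i \<omega>)"

lemma waiting_0: "waiting 0 \<omega> = 0" and waiting_Suc: "waiting (Suc k) \<omega> = waiting k \<omega> + W (Suc k) \<omega>"
  by (simp_all add: waiting_def)

lemma waiting_measurable [measurable]: "waiting k \<in> borel_measurable M"
  unfolding waiting_def[abs_def] by measurable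

lemma waiting_nonneg: "\<omega> \<in> space M \<Longrightarrow> 0 \<le> waiting k \<omega>"
  unfolding waiting_def by (intro sum_nonneg) (metis W_pos atLeastAtMost_iff less_imp_le)

lemma waiting_Suc_gt: "\<omega> \<in> space M \<Longrightarrow> waiting k \<omega> < waiting (Suc k) \<omega>"
  using W_pos[of "Suc k" \<omega>] by (simp add: waiting_Suc)

lemma waiting_distributed:
  assumes "1 \<le> m"
  shows "distributed M lborel (waiting m) (\<lambda>x. ennreal (f m x))"
  using assms
proof (induction m rule: dec_induct)
  case base
  have "waiting 1 = W 1" by (auto simp: waiting_def)
  then show ?case using W_distributed[of 1] by (simp add: yule_density_one)
next
  case (step m)
  have "indep_var borel ((\<lambda>g. \<Sum>i=1..m. g i) \<circ> (\<lambda>\<omega>. restrict (\<lambda>i. W i \<omega>) {1..m}))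
     borel ((\<lambda>g. g (Suc m)) \<circ> (\<lambda>\<omega>. restrict (\<lambda>i. W i \<omega>) {Suc m}))"
    by (intro indep_var_compose[OF indep_var_restrict[OF W_indep]]) auto
  also have "((\<lambda>g. \<Sum>i=1..m. g i) \<circ> (\<lambda>\<omega>. restrict (\<lambda>i. W i \<omega>) {1..m})) = waiting m"
    by (auto simp: waiting_def)
  also have "((\<lambda>g. g (Suc m)) \<circ> (\<lambda>\<omega>. restrict (\<lambda>i. W i \<omega>) {Suc m})) = W (Suc m)"
    by auto
  finally have "distributed M lborel (\<lambda>\<omega>. waiting m \<omega> + W (Suc m) \<omega>)
     (\<lambda>x. \<integral>\<^sup>+y. ennreal (f m (x - y)) * ennreal (real (Suc m) * c * ml_kernel \<alpha> (- (real (Suc m) * c)) y) \<partial>lborel)"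
    using step W_distributed[of "Suc m"] by (intro distributed_convolution) auto
  moreover have "waiting (Suc m) = (\<lambda>\<omega>. waiting m \<omega> + W (Suc m) \<omega>)" by (auto simp: waiting_Suc)
  ultimately show ?case by (simp only: density_Suc_nn[OF step(1)])
qed

lemma prob_waiting_le:
  assumes t: "0 < t"
  shows "\<P>(\<omega> in M. waiting m \<omega> \<le> t) = yule_cdf \<alpha> c m t"
proof (cases "m = 0")
  case True
  then show ?thesis using t by (simp add: waiting_0 yule_cdf_def mittag_leffler_0 prob_space)
next
  case False
  then have m: "1 \<le> m" by simp
  have e: "waiting m -` {..t} \<inter> space M = {\<omega> \<in> space M. waiting m \<omega> \<le> t}" by auto
  have "emeasure M (waiting m -` {..t} \<inter> space M) = (\<integral>\<^sup>+x. ennreal (f m x) * indicator {..t} x \<partial>lborel)"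
    by (rule distributed_emeasure[OF waiting_distributed[OF m]]) simp
  then have "ennreal \<P>(\<omega> in M. waiting m \<omega> \<le> t) = ennreal (yule_cdf \<alpha> c m t)"
    unfolding nn_integral_density[OF m t] e by (simp add: emeasure_eq_measure)
  then show ?thesis using nn_integral_density(2)[OF m t] by simp
qed

definition count_prob :: "nat \<Rightarrow> real \<Rightarrow> real" where
  "count_prob m t = \<P>(\<omega> in M. waiting m \<omega> \<le> t \<and> t < waiting (Suc m) \<omega>)"

lemma count_prob_eq:
  assumes t: "0 < t"
  shows "count_prob m t = yule_cdf \<alpha> c m t - yule_cdf \<alpha> c (Suc m) t"
proof -
  have "{\<omega> \<in> space M. waiting m \<omega> \<le> t \<and> t < waiting (Suc m) \<omega>}
      = {\<omega> \<in> space M. waiting m \<omega> \<le> t} - {\<omega> \<in> space M. waiting (Suc m) \<omega> \<le> t}"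
    by auto
  moreover have "{\<omega> \<in> space M. waiting (Suc m) \<omega> \<le> t} \<subseteq> {\<omega> \<in> space M. waiting m \<omega> \<le> t}"
    using waiting_Suc_gt[of _ m] by force
  ultimately have "count_prob m t = \<P>(\<omega> in M. waiting m \<omega> \<le> t) - \<P>(\<omega> in M. waiting (Suc m) \<omega> \<le> t)"
    unfolding count_prob_def by (simp add: finite_measure_Diff)
  then show ?thesis by (simp only: prob_waiting_le[OF t])
qed

lemma count_prob_nonneg: "0 \<le> count_prob m t"
  by (simp add: count_prob_def)

lemma count_prob_zero:
  assumes "t < 0 \<or> (1 \<le> m \<and> t \<le> 0)"
  shows "count_prob m t = 0"
proof -
  have "\<not> waiting m \<omega> \<le> t" if "\<omega> \<in> space M" for \<omega>
    using assms waiting_nonneg[OF that, of m] waiting_nonneg[OF that, of "m - 1"] waiting_Suc_gt[OF that, of "m - 1"]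
    by (cases m) auto
  then have "{\<omega> \<in> space M. waiting m \<omega> \<le> t \<and> t < waiting (Suc m) \<omega>} = {}" by auto
  then show ?thesis unfolding count_prob_def by (simp only: measure_empty)
qed

lemma count_prob_measurable [measurable]: "count_prob m \<in> borel_measurable borel"
proof -
  have "(\<lambda>t. emeasure M {\<omega> \<in> space M. waiting m \<omega> \<le> t \<and> t < waiting (Suc m) \<omega>}) \<in> borel_measurable borel"
    by measurable
  then show ?thesis unfolding count_prob_def[abs_def] measure_def by measurable
qed

lemma prob_waiting_bound:
  assumes t: "0 < t"
  shows "\<P>(\<omega> in M. waiting m \<omega> \<le> t) \<le> 2 * mittag_leffler \<alpha> 1 (3 * c * t powr \<alpha>) / ((real m + 1) * (real m + 2))"
proof (cases "m = 0")
  case True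
  have "1 \<le> mittag_leffler \<alpha> 1 (3 * c * t powr \<alpha>)"
    using rate by (intro mittag_leffler_ge_1 alpha_pos) auto
  then show ?thesis unfolding True by (intro order.trans[OF prob_le_1]) simp
next
  case False
  then have m: "1 \<le> m" by simp
  have "yule_cdf \<alpha> c m t \<le> 2 * (mittag_leffler \<alpha> 1 (3 * c * t powr \<alpha>) - 1) / ((real m + 1) * (real m + 2))"
    by (rule yule_cdf_bound[OF m t])
  also have "\<dots> \<le> 2 * mittag_leffler \<alpha> 1 (3 * c * t powr \<alpha>) / ((real m + 1) * (real m + 2))"
    by (rule divide_right_mono) simp_all
  finally show ?thesis unfolding prob_waiting_le[OF t] .
qed

lemma count_prob_bound:
  assumes t: "0 < t" and u: "u \<le> t"
  shows "count_prob m u \<le> 2 * mittag_leffler \<alpha> 1 (3 * c * t powr \<alpha>) / ((real m + 1) * (real m + 2))"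
proof -
  have "count_prob m u \<le> \<P>(\<omega> in M. waiting m \<omega> \<le> t)"
    unfolding count_prob_def using u by (intro finite_measure_mono) auto
  with prob_waiting_bound[OF t, of m] show ?thesis by linarith
qed

lemma count_prob_isCont:
  assumes t: "0 < t"
  shows "isCont (count_prob m) t"
proof -
  have "isCont (\<lambda>t. yule_cdf \<alpha> c m t - yule_cdf \<alpha> c (Suc m) t) t"
    unfolding yule_cdf_def using t
    by (intro continuous_intros DERIV_isCont[OF ml_kernel_deriv[OF alpha_pos t]])
  moreover have "eventually (\<lambda>x. 0 < x) (nhds t)"
    using t order_tendstoD(1)[OF tendsto_ident_at, of 0 t UNIV] by (auto simp: eventually_nhds_conv_at)
  then have "eventually (\<lambda>t. count_prob m t = yule_cdf \<alpha> c m t - yule_cdf \<alpha> c (Suc m) t) (nhds t)"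
    by eventually_elim (rule count_prob_eq)
  ultimately show ?thesis by (subst isCont_cong)
qed

lemma prob_waiting_tendsto_0:
  assumes t: "0 < t"
  shows "(\<lambda>m. \<P>(\<omega> in M. waiting m \<omega> \<le> t)) \<longlonglongrightarrow> 0"
proof (rule tendsto_sandwich[OF _ _ tendsto_const])
  show "(\<lambda>m. 2 * mittag_leffler \<alpha> 1 (3 * c * t powr \<alpha>) / ((real m + 1) * (real m + 2))) \<longlonglongrightarrow> 0"
    by real_asymp
qed (use prob_waiting_bound[OF t] in auto)

end
section \<open>Independence of blocks of a family\<close>

lemma (in prob_space) indep_vars_reindex:
  assumes X: "indep_vars (\<lambda>_. N) X I" and h: "inj_on h J" "h ` J \<subseteq> I"
  shows "indep_vars (\<lambda>_. N) (\<lambda>j. X (h j)) J"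
proof -
  have "indep_vars (\<lambda>j. PiM {h j} (\<lambda>_. N)) (\<lambda>j \<omega>. restrict (\<lambda>i. X i \<omega>) {h j}) J"
    using h by (intro indep_vars_restrict[OF X]) (auto simp: disjoint_family_on_def inj_on_def)
  then have "indep_vars (\<lambda>_. N) (\<lambda>j \<omega>. (\<lambda>g. g (h j)) (restrict (\<lambda>i. X i \<omega>) {h j})) J"
    by (rule indep_vars_compose2) simp
  then show ?thesis by simp
qed

lemma measurable_nat_of_real:
  fixes h :: "'a \<Rightarrow> nat"
  assumes [measurable]: "(\<lambda>\<omega>. real (h \<omega>)) \<in> borel_measurable M"
  shows "h \<in> measurable M (count_space UNIV)"
proof -
  have "(\<lambda>\<omega>. nat \<lfloor>real (h \<omega>)\<rfloor>) \<in> measurable M (count_space UNIV)" by measurable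
  then show ?thesis by simp
qed

text \<open>
  The two variables may have different types, as an event about trials and an event about
  waiting times require.
\<close>

definition (in prob_space) indep_pair ::
    "'b measure \<Rightarrow> ('a \<Rightarrow> 'b) \<Rightarrow> 'c measure \<Rightarrow> ('a \<Rightarrow> 'c) \<Rightarrow> bool" where
  "indep_pair N1 U N2 V \<longleftrightarrow> U \<in> measurable M N1 \<and> V \<in> measurable M N2 \<and>
     distr M N1 U \<Otimes>\<^sub>M distr M N2 V = distr M (N1 \<Otimes>\<^sub>M N2) (\<lambda>\<omega>. (U \<omega>, V \<omega>))"

lemma (in prob_space) indep_pair_compose:
  assumes ind: "indep_var S X T W" and F: "F \<in> measurable S N1" and G: "G \<in> measurable T N2"
  shows "indep_pair N1 (\<lambda>\<omega>. F (X \<omega>)) N2 (\<lambda>\<omega>. G (W \<omega>))"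
proof -
  have X: "X \<in> measurable M S" and W: "W \<in> measurable M T"
    and D: "distr M S X \<Otimes>\<^sub>M distr M T W = distr M (S \<Otimes>\<^sub>M T) (\<lambda>\<omega>. (X \<omega>, W \<omega>))"
    using ind by (auto simp: indep_var_distribution_eq)
  have GW: "(\<lambda>\<omega>. G (W \<omega>)) \<in> measurable M N2" and FX: "(\<lambda>\<omega>. F (X \<omega>)) \<in> measurable M N1"
    using X W F G by measurable
  have "distr M N1 (\<lambda>\<omega>. F (X \<omega>)) \<Otimes>\<^sub>M distr M N2 (\<lambda>\<omega>. G (W \<omega>))
      = distr (distr M S X) N1 F \<Otimes>\<^sub>M distr (distr M T W) N2 G"
    using X W F G by (simp add: distr_distr comp_def)
  also have "\<dots> = distr (distr M S X \<Otimes>\<^sub>M distr M T W) (N1 \<Otimes>\<^sub>M N2) (\<lambda>(x, y). (F x, G y))"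
  proof (rule pair_measure_distr)
    have "distr (distr M T W) N2 G = distr M N2 (\<lambda>\<omega>. G (W \<omega>))"
      using W G by (simp add: distr_distr comp_def)
    then show "sigma_finite_measure (distr (distr M T W) N2 G)"
      using prob_space_distr[OF GW] by (simp add: prob_space_imp_sigma_finite)
  qed (use F G in auto)
  also have "\<dots> = distr M (N1 \<Otimes>\<^sub>M N2) (\<lambda>\<omega>. (F (X \<omega>), G (W \<omega>)))"
    unfolding D using X W F G by (subst distr_distr) (auto simp: comp_def)
  finally show ?thesis using FX GW by (simp add: indep_pair_def)
qed

text \<open>
  Tonelli's theorem on the joint law: the first variable may be frozen while the probability
  is taken over the second.
\<close>

lemma (in prob_space) indep_section:
  assumes ind: "indep_pair N1 U N2 V" and Q: "Measurable.pred (N1 \<Otimes>\<^sub>M N2) (\<lambda>x. Q (fst x) (snd x))"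
  shows "emeasure M {\<omega> \<in> space M. Q (U \<omega>) (V \<omega>)}
     = (\<integral>\<^sup>+\<omega>. emeasure M {\<omega>' \<in> space M. Q (U \<omega>) (V \<omega>')} \<partial>M)"
proof -
  have U: "U \<in> measurable M N1" and V: "V \<in> measurable M N2"
    using ind by (auto simp: indep_pair_def)
  interpret V: prob_space "distr M N2 V" by (rule prob_space_distr[OF V])
  let ?S = "{x \<in> space (N1 \<Otimes>\<^sub>M N2). Q (fst x) (snd x)}"
  have S: "?S \<in> sets (N1 \<Otimes>\<^sub>M N2)" using Q by (simp add: pred_def)
  then have S': "?S \<in> sets (distr M N1 U \<Otimes>\<^sub>M distr M N2 V)"
    by (simp cong: sets_pair_measure_cong)
  have UV: "(\<lambda>x. (U x, V x)) \<in> measurable M (N1 \<Otimes>\<^sub>M N2)" using U V by simp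
  have "{\<omega> \<in> space M. Q (U \<omega>) (V \<omega>)} = (\<lambda>x. (U x, V x)) -` ?S \<inter> space M"
    using measurable_space[OF U] measurable_space[OF V] by (auto simp: space_pair_measure)
  then have "emeasure M {\<omega> \<in> space M. Q (U \<omega>) (V \<omega>)} = emeasure (distr M (N1 \<Otimes>\<^sub>M N2) (\<lambda>x. (U x, V x))) ?S"
    using S UV by (simp add: emeasure_distr)
  also have "distr M (N1 \<Otimes>\<^sub>M N2) (\<lambda>x. (U x, V x)) = distr M N1 U \<Otimes>\<^sub>M distr M N2 V"
    using ind by (simp add: indep_pair_def)
  also have "emeasure (distr M N1 U \<Otimes>\<^sub>M distr M N2 V) ?S
      = (\<integral>\<^sup>+s. emeasure (distr M N2 V) (Pair s -` ?S) \<partial>distr M N1 U)"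
    by (rule V.emeasure_pair_measure_alt[OF S'])
  also have "\<dots> = (\<integral>\<^sup>+\<omega>. emeasure (distr M N2 V) (Pair (U \<omega>) -` ?S) \<partial>M)"
    using V.measurable_emeasure_Pair[OF S'] by (intro nn_integral_distr[OF U]) simp
  also have "\<dots> = (\<integral>\<^sup>+\<omega>. emeasure M {\<omega>' \<in> space M. Q (U \<omega>) (V \<omega>')} \<partial>M)"
  proof (rule nn_integral_cong)
    fix \<omega> assume w: "\<omega> \<in> space M"
    have "V -` (Pair (U \<omega>) -` ?S) \<inter> space M = {\<omega>' \<in> space M. Q (U \<omega>) (V \<omega>')}"
      using measurable_space[OF U w] measurable_space[OF V] by (auto simp: space_pair_measure)
    then show "emeasure (distr M N2 V) (Pair (U \<omega>) -` ?S) = emeasure M {\<omega>' \<in> space M. Q (U \<omega>) (V \<omega>')}"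
      using sets_Pair1[OF S, of "U \<omega>"] V by (simp add: emeasure_distr)
  qed
  finally show ?thesis .
qed

lemma (in prob_space) indep_pair_prob:
  assumes ind: "indep_pair N1 U N2 V" and P: "Measurable.pred N1 P" and Q: "Measurable.pred N2 Q"
  shows "\<P>(\<omega> in M. P (U \<omega>) \<and> Q (V \<omega>)) = \<P>(\<omega> in M. P (U \<omega>)) * \<P>(\<omega> in M. Q (V \<omega>))"
proof -
  have U: "U \<in> measurable M N1" using ind by (auto simp: indep_pair_def)
  have [measurable]: "Measurable.pred M (\<lambda>\<omega>. P (U \<omega>))" using U P by measurable
  have "Measurable.pred (N1 \<Otimes>\<^sub>M N2) (\<lambda>x. P (fst x) \<and> Q (snd x))" using P Q by measurable
  from indep_section[OF ind this]
  have "emeasure M {\<omega> \<in> space M. P (U \<omega>) \<and> Q (V \<omega>)}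
      = (\<integral>\<^sup>+\<omega>. emeasure M {\<omega>' \<in> space M. P (U \<omega>) \<and> Q (V \<omega>')} \<partial>M)" .
  also have "\<dots> = (\<integral>\<^sup>+\<omega>. emeasure M {\<omega>' \<in> space M. Q (V \<omega>')} * indicator {\<omega> \<in> space M. P (U \<omega>)} \<omega> \<partial>M)"
    by (intro nn_integral_cong) (auto simp: indicator_def)
  also have "\<dots> = emeasure M {\<omega> \<in> space M. Q (V \<omega>)} * emeasure M {\<omega> \<in> space M. P (U \<omega>)}"
    by (rule nn_integral_cmult_indicator) simp
  finally show ?thesis by (simp add: emeasure_eq_measure ennreal_mult[symmetric] mult.commute)
qed

text \<open>
  For the telegraph process, \<open>U\<close> is the total time spent at the velocity that
  does not hold at time \<open>t\<close>, so that \<open>t - U\<close> is left for the other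
  velocity, and \<open>V1\<close>, \<open>V2\<close> are consecutive totals of waiting times
  at that other velocity. Freezing \<open>U\<close> makes the position \<open>a + d U\<close>
  deterministic; the affine substitution then produces a density in the position.
\<close>

lemma (in prob_space) indep_section_density:
  fixes U V1 V2 :: "'a \<Rightarrow> real" and f :: "real \<Rightarrow> real"
  assumes ind: "indep_pair borel U (borel \<Otimes>\<^sub>M borel) (\<lambda>\<omega>. (V1 \<omega>, V2 \<omega>))"
    and U: "distributed M lborel U (\<lambda>x. ennreal (f x))" and f0: "\<And>x. 0 \<le> f x"
    and d: "d \<noteq> 0" and A[measurable]: "A \<in> sets borel"
  shows "emeasure M {\<omega> \<in> space M. a + d * U \<omega> \<in> A \<and> V1 \<omega> + U \<omega> \<le> t \<and> t < V2 \<omega> + U \<omega>}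
    = (\<integral>\<^sup>+x. ennreal (f ((x - a) / d) * \<P>(\<omega> in M. V1 \<omega> \<le> t - (x - a) / d \<and> t - (x - a) / d < V2 \<omega>) / \<bar>d\<bar>)
         * indicator A x \<partial>lborel)"
proof -
  have "random_variable (borel \<Otimes>\<^sub>M borel) (\<lambda>\<omega>. (V1 \<omega>, V2 \<omega>))" using ind by (simp add: indep_pair_def)
  from measurable_compose[OF this measurable_fst] measurable_compose[OF this measurable_snd]
  have V[measurable]: "V1 \<in> borel_measurable M" "V2 \<in> borel_measurable M" by simp_all
  have U'[measurable]: "U \<in> borel_measurable M" using ind by (simp add: indep_pair_def)
  have f[measurable]: "f \<in> borel_measurable borel"
  proof -
    have "(\<lambda>x. ennreal (f x)) \<in> borel_measurable lborel" using U by (rule distributed_borel_measurable)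
    then have "(\<lambda>x. enn2real (ennreal (f x))) \<in> borel_measurable borel" by simp
    then show ?thesis using f0 by simp
  qed
  define cp where "cp s = emeasure M {\<omega> \<in> space M. V1 \<omega> \<le> s \<and> s < V2 \<omega>}" for s
  have cp[measurable]: "cp \<in> borel_measurable borel" unfolding cp_def[abs_def] by measurable
  have "emeasure M {\<omega> \<in> space M. a + d * U \<omega> \<in> A \<and> V1 \<omega> + U \<omega> \<le> t \<and> t < V2 \<omega> + U \<omega>}
      = (\<integral>\<^sup>+\<omega>. emeasure M {\<omega>' \<in> space M. a + d * U \<omega> \<in> A \<and> V1 \<omega>' + U \<omega> \<le> t \<and> t < V2 \<omega>' + U \<omega>} \<partial>M)"
    using indep_section[OF ind, where Q="\<lambda>u v. a + d * u \<in> A \<and> fst v + u \<le> t \<and> t < snd v + u"] by simp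
  also have "\<dots> = (\<integral>\<^sup>+\<omega>. indicator A (a + d * U \<omega>) * cp (t - U \<omega>) \<partial>M)"
    unfolding cp_def by (intro nn_integral_cong) (auto simp: indicator_def algebra_simps intro!: arg_cong[where f="emeasure M"])
  also have "\<dots> = (\<integral>\<^sup>+s. ennreal (f s) * (indicator A (a + d * s) * cp (t - s)) \<partial>lborel)"
    by (rule distributed_nn_integral[OF U, symmetric]) measurable
  also have "\<dots> = ennreal \<bar>1 / d\<bar> * (\<integral>\<^sup>+x. ennreal (f (- a / d + (1 / d) * x)) *
      (indicator A (a + d * (- a / d + (1 / d) * x)) * cp (t - (- a / d + (1 / d) * x))) \<partial>lborel)"
    using d by (intro nn_integral_real_affine) auto
  also have "\<dots> = (\<integral>\<^sup>+x. ennreal \<bar>1 / d\<bar> * (ennreal (f (- a / d + (1 / d) * x)) *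
      (indicator A (a + d * (- a / d + (1 / d) * x)) * cp (t - (- a / d + (1 / d) * x)))) \<partial>lborel)"
    by (rule nn_integral_cmult[symmetric]) measurable
  also have "\<dots> = (\<integral>\<^sup>+x. ennreal (f ((x - a) / d) * \<P>(\<omega> in M. V1 \<omega> \<le> t - (x - a) / d \<and> t - (x - a) / d < V2 \<omega>) / \<bar>d\<bar>)
         * indicator A x \<partial>lborel)"
  proof (rule nn_integral_cong)
    fix x
    let ?s = "(x - a) / d" and ?P = "\<P>(\<omega> in M. V1 \<omega> \<le> t - (x - a) / d \<and> t - (x - a) / d < V2 \<omega>)"
    have s: "- a / d + (1 / d) * x = ?s" using d by (simp add: field_simps)
    have x: "a + d * ?s = x" using d by simp
    have "ennreal (f ?s * ?P / \<bar>d\<bar>) = ennreal (\<bar>1 / d\<bar> * (f ?s * ?P))" by (simp add: field_simps)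
    also have "\<dots> = ennreal \<bar>1 / d\<bar> * (ennreal (f ?s) * cp (t - ?s))"
      unfolding cp_def emeasure_eq_measure
      by (simp only: ennreal_mult f0 measure_nonneg abs_ge_zero mult_nonneg_nonneg)
    finally have e: "ennreal (f ?s * ?P / \<bar>d\<bar>) = ennreal \<bar>1 / d\<bar> * (ennreal (f ?s) * cp (t - ?s))" .
    have ac: "D * (F * (I * C)) = D * (F * C) * I" for D F I C :: ennreal by (simp only: mult_ac)
    show "ennreal \<bar>1 / d\<bar> * (ennreal (f (- a / d + (1 / d) * x)) *
      (indicator A (a + d * (- a / d + (1 / d) * x)) * cp (t - (- a / d + (1 / d) * x))))
      = ennreal (f ?s * ?P / \<bar>d\<bar>) * indicator A x"
      unfolding s x e by (rule ac)
  qed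
  finally show ?thesis .
qed

section \<open>Series and distribution functions on an interval\<close>

text \<open>
  The Weierstrass M-test on compact subintervals.
\<close>

lemma suminf_locally_uniform:
  fixes h :: "nat \<Rightarrow> real \<Rightarrow> real"
  assumes cont: "\<And>n x. x \<in> {l<..<u} \<Longrightarrow> isCont (h n) x"
    and bound: "\<And>a b. l < a \<Longrightarrow> b < u \<Longrightarrow> \<exists>B. summable B \<and> (\<forall>n. \<forall>x\<in>{a..b}. norm (h n x) \<le> B n)"
    and x: "x \<in> {l<..<u}"
  shows "summable (\<lambda>n. h n x)" "isCont (\<lambda>x. \<Sum>n. h n x) x"
proof -
  obtain a where a: "l < a" "a < x" using x dense by auto
  obtain b where b: "x < b" "b < u" using x dense by auto
  obtain B where B: "summable B" "\<And>n y. y \<in> {a..b} \<Longrightarrow> norm (h n y) \<le> B n"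
    using bound[OF a(1) b(2)] by blast
  show "summable (\<lambda>n. h n x)"
    using B(2)[of x] a b by (intro summable_comparison_test'[OF B(1), where N=0]) auto
  have "uniform_limit {a..b} (\<lambda>n x. \<Sum>i<n. h i x) (\<lambda>x. \<Sum>i. h i x) sequentially"
    by (rule Weierstrass_m_test[OF B(2) B(1)])
  then have "continuous_on {a..b} (\<lambda>x. \<Sum>i. h i x)"
  proof (rule uniform_limit_theorem[rotated])
    have "continuous_on {a..b} (h i)" for i
      using cont a b by (intro continuous_at_imp_continuous_on ballI) auto
    then show "\<forall>\<^sub>F n in sequentially. continuous_on {a..b} (\<lambda>x. \<Sum>i<n. h i x)"
      by (intro always_eventually allI continuous_on_sum)
  qed simp
  then show "isCont (\<lambda>x. \<Sum>n. h n x) x"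
    using a b by (intro continuous_on_interior[of "{a..b}"]) auto
qed

text \<open>
  Continuity of the density at every point gives the derivative at every point, not merely
  almost everywhere.
\<close>

lemma distribution_function_deriv:
  fixes F \<phi> :: "real \<Rightarrow> real"
  assumes x: "x \<in> {l<..<u}" and cont: "\<And>y. y \<in> {l<..<u} \<Longrightarrow> isCont \<phi> y"
    and [measurable]: "\<phi> \<in> borel_measurable borel" and \<phi>0: "\<And>y. 0 \<le> \<phi> y" and F0: "\<And>y. 0 \<le> F y"
    and F: "\<And>y. y \<in> {l<..<u} \<Longrightarrow> ennreal (F y) = (\<integral>\<^sup>+z. ennreal (\<phi> z) * indicator {..y} z \<partial>lborel)"
  shows "(F has_real_derivative \<phi> x) (at x)"
proof -
  obtain a where a: "l < a" "a < x" using x dense by auto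
  obtain b where b: "x < b" "b < u" using x dense by auto
  have c: "continuous_on {a..b} \<phi>"
    using cont a b by (intro continuous_at_imp_continuous_on ballI) auto
  have eq: "F y = F a + integral {a..y} \<phi>" if y: "y \<in> {a..b}" for y
  proof -
    have cy: "continuous_on {a..y} \<phi>" using c y by (rule_tac continuous_on_subset) auto
    have si: "set_integrable lborel {a..y} \<phi>" by (rule borel_integrable_atLeastAtMost'[OF cy])
    have I: "(LBINT z:{a..y}. \<phi> z) = integral {a..y} \<phi>" by (rule set_borel_integral_eq_integral(2)[OF si])
    have I0: "0 \<le> integral {a..y} \<phi>" using \<phi>0 by (intro integral_nonneg integrable_continuous_real cy) auto
    have "ennreal (F y) = (\<integral>\<^sup>+z. ennreal (\<phi> z) * indicator {..y} z \<partial>lborel)"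
      using y a b by (intro F) auto
    also have "\<dots> = (\<integral>\<^sup>+z. ennreal (\<phi> z) * indicator {..a} z + ennreal (indicator {a..y} z * \<phi> z) \<partial>lborel)"
      using AE_lborel_singleton[of a] y by (intro nn_integral_cong_AE) (auto simp: indicator_def)
    also have "\<dots> = (\<integral>\<^sup>+z. ennreal (\<phi> z) * indicator {..a} z \<partial>lborel) + (\<integral>\<^sup>+z. ennreal (indicator {a..y} z * \<phi> z) \<partial>lborel)"
      by (rule nn_integral_add) measurable
    also have "(\<integral>\<^sup>+z. ennreal (\<phi> z) * indicator {..a} z \<partial>lborel) = ennreal (F a)"
      using y a b by (intro F[symmetric]) auto
    also have "(\<integral>\<^sup>+z. ennreal (indicator {a..y} z * \<phi> z) \<partial>lborel) = ennreal (integral {a..y} \<phi>)"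
      using si \<phi>0 by (subst nn_integral_eq_integral)
        (auto simp: set_integrable_def I[symmetric] set_lebesgue_integral_def)
    also have "ennreal (F a) + ennreal (integral {a..y} \<phi>) = ennreal (F a + integral {a..y} \<phi>)"
      by (rule ennreal_plus[OF F0 I0, symmetric])
    finally show ?thesis
      using ennreal_inj[OF F0[of y] add_nonneg_nonneg[OF F0[of a] I0]] by blast
  qed
  have "((\<lambda>y. integral {a..y} \<phi>) has_real_derivative \<phi> x) (at x within {a..b})"
    using a b by (intro integral_has_real_derivative c) auto
  then have "((\<lambda>y. F a + integral {a..y} \<phi>) has_real_derivative \<phi> x) (at x within {a..b})"
    by (auto intro!: derivative_eq_intros)
  then have "(F has_real_derivative \<phi> x) (at x within {a..b})"
  proof (rule has_field_derivative_transform_within[OF _ zero_less_one])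
    show "x \<in> {a..b}" using a b by simp
  qed (rule eq[symmetric])
  then show ?thesis using a b by (simp add: at_within_Icc_at)
qed

text \<open>
  The decay in the index of both the densities and the counting probabilities of sums of
  waiting times.
\<close>

definition pair_weight :: "nat \<Rightarrow> real" where "pair_weight k = 1 / ((real k + 1) * (real k + 2))"

lemma pair_weight_nonneg: "0 \<le> pair_weight k"
  by (simp add: pair_weight_def)

lemma pair_weight_Suc_le: "pair_weight (Suc k) \<le> pair_weight k"
  unfolding pair_weight_def by (intro divide_left_mono mult_mono mult_pos_pos) auto

lemma pair_weight_summable: "summable pair_weight"
proof (rule summable_comparison_test'[where N=1])
  show "summable (\<lambda>k. inverse (real k ^ 2))" using inverse_power_summable[of 2, where 'a=real] by simp
  show "norm (pair_weight k) \<le> inverse (real k ^ 2)" if "1 \<le> k" for k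
  proof -
    have "real k * real k \<le> (real k + 1) * (real k + 2)" by (intro mult_mono) auto
    then show ?thesis using that
      by (simp add: pair_weight_def power2_eq_square inverse_eq_divide divide_left_mono)
  qed
qed

lemma pair_weight_convolution_summable: "summable (\<lambda>n. C * (\<Sum>k\<le>n. pair_weight k * pair_weight (n - k)))"
  using pair_weight_summable pair_weight_nonneg
  by (intro summable_mult summable_Cauchy_product) auto

lemma binomial_weight_le_1:
  fixes u :: real
  assumes u: "0 \<le> u" "u \<le> 1" and k: "k \<le> N"
  shows "real (N choose k) * u ^ k * (1 - u) ^ (N - k) \<le> 1"
proof -
  have "real (N choose k) * u ^ k * (1 - u) ^ (N - k) \<le> (\<Sum>k\<le>N. real (N choose k) * u ^ k * (1 - u) ^ (N - k))"
    using u k by (intro member_le_sum) auto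
  also have "\<dots> = (u + (1 - u)) ^ N" by (rule binomial_ring[symmetric])
  finally show ?thesis by simp
qed

text \<open>
  Pascal's rule for binomial weights, in the form produced by conditioning on the last trial.
\<close>

lemma binomial_weight_step:
  fixes u q :: real
  shows "real (N choose Suc l) * u ^ Suc (Suc l) * q ^ (N - Suc l) * q + real (N choose l) * u ^ Suc l * q ^ (N - l) * u
    = real (Suc N choose Suc l) * u ^ Suc (Suc l) * q ^ (N - l)"
proof (cases "Suc l \<le> N")
  case True
  then have "N - l = Suc (N - Suc l)" by simp
  then show ?thesis by (simp add: algebra_simps)
next
  case False
  then show ?thesis by (simp add: binomial_eq_0 algebra_simps)
qed

lemma weighted_sum_nn_integral:
  fixes h :: "nat \<Rightarrow> real \<Rightarrow> real"
  assumes [measurable]: "\<And>k. h k \<in> borel_measurable borel" "A \<in> sets borel" and w: "\<And>k. 0 \<le> w k" and h: "\<And>k x. 0 \<le> h k x" and q: "0 \<le> q"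
  shows "(\<Sum>k\<in>K. ennreal (w k * q) * (\<integral>\<^sup>+x. ennreal (h k x) * indicator A x \<partial>lborel))
    = ennreal q * (\<integral>\<^sup>+x. ennreal (\<Sum>k\<in>K. w k * h k x) * indicator A x \<partial>lborel)"
proof -
  have "(\<Sum>k\<in>K. ennreal (w k * q) * (\<integral>\<^sup>+x. ennreal (h k x) * indicator A x \<partial>lborel))
     = (\<Sum>k\<in>K. (\<integral>\<^sup>+x. ennreal q * (ennreal (w k * h k x) * indicator A x) \<partial>lborel))"
  proof (intro sum.cong refl)
    fix k
    have "ennreal (w k * q) * (\<integral>\<^sup>+x. ennreal (h k x) * indicator A x \<partial>lborel)
      = (\<integral>\<^sup>+x. ennreal (w k * q) * (ennreal (h k x) * indicator A x) \<partial>lborel)"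
      by (rule nn_integral_cmult[symmetric]) measurable
    also have "\<dots> = (\<integral>\<^sup>+x. ennreal q * (ennreal (w k * h k x) * indicator A x) \<partial>lborel)"
      using w h q by (intro nn_integral_cong) (simp add: ennreal_mult mult_ac)
    finally show "ennreal (w k * q) * (\<integral>\<^sup>+x. ennreal (h k x) * indicator A x \<partial>lborel)
      = (\<integral>\<^sup>+x. ennreal q * (ennreal (w k * h k x) * indicator A x) \<partial>lborel)" .
  qed
  also have "\<dots> = (\<integral>\<^sup>+x. (\<Sum>k\<in>K. ennreal q * (ennreal (w k * h k x) * indicator A x)) \<partial>lborel)"
    by (rule nn_integral_sum[symmetric]) measurable
  also have "\<dots> = (\<integral>\<^sup>+x. ennreal q * (ennreal (\<Sum>k\<in>K. w k * h k x) * indicator A x) \<partial>lborel)"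
  proof (rule nn_integral_cong)
    fix x
    have "(\<Sum>k\<in>K. ennreal (w k * h k x)) = ennreal (\<Sum>k\<in>K. w k * h k x)"
      using w h by (intro sum_ennreal) simp
    then show "(\<Sum>k\<in>K. ennreal q * (ennreal (w k * h k x) * indicator A x))
        = ennreal q * (ennreal (\<Sum>k\<in>K. w k * h k x) * indicator A x)"
      by (simp only: sum_distrib_left[symmetric] sum_distrib_right[symmetric])
  qed
  also have "\<dots> = ennreal q * (\<integral>\<^sup>+x. ennreal (\<Sum>k\<in>K. w k * h k x) * indicator A x \<partial>lborel)"
    by (rule nn_integral_cmult) measurable
  finally show ?thesis .
qed

lemma product_of_sums:
  fixes w m mu S V :: real and a e b g :: "nat \<Rightarrow> real"
  shows "w * ((m * mu * (\<Sum>i\<in>I. a i * (S * e i))) * (\<Sum>j\<in>J. b j * g j) / V)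
      = mu * S / V * (\<Sum>i\<in>I. \<Sum>j\<in>J. w * m * (a i * e i) * (b j * g j))"
proof -
  have 1: "(\<Sum>i\<in>I. a i * (S * e i)) = S * (\<Sum>i\<in>I. a i * e i)"
    unfolding sum_distrib_left by (intro sum.cong refl) (rule mult.left_commute)
  have 2: "(\<Sum>i\<in>I. \<Sum>j\<in>J. w * m * (a i * e i) * (b j * g j))
      = w * m * ((\<Sum>i\<in>I. a i * e i) * (\<Sum>j\<in>J. b j * g j))"
    unfolding sum_product by (simp only: sum_distrib_left mult.assoc)
  have "w * ((m * mu * (S * X)) * X' / V) = mu * S / V * (w * m * (X * X'))" for X X'
    by (simp only: divide_inverse mult_ac)
  then show ?thesis unfolding 1 2 .
qed

lemma ennreal_inverse_cancel:
  assumes "0 < u"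
  shows "ennreal (1 / u) * ennreal u = 1"
  using assms by (simp add: ennreal_mult[symmetric])

lemma ennreal_ratio_eq:
  assumes P: "ennreal P = ennreal u * X" "0 \<le> P" and u: "0 < u"
  shows "ennreal (P / u) = X"
proof -
  have "ennreal (P / u) = ennreal (1 / u) * ennreal P"
    using P(2) u by (simp add: ennreal_mult[symmetric])
  also have "\<dots> = X" unfolding P(1) mult.assoc[symmetric] ennreal_inverse_cancel[OF u] by simp
  finally show ?thesis .
qed

section \<open>Paths of the telegraph process\<close>

context ml_telegraph
begin

abbreviation "p \<equiv> b / (b + r)"

lemma p_bounds: "0 < p" "p < 1"
  using trial_pos by auto

sublocale fw: yule_sums M \<alpha> lam R
proof -
  have "indep_vars (\<lambda>_. borel) (\<lambda>n. case_sum (\<lambda>n \<omega>. real (Y n \<omega>)) (case_sum R L) (Inr (Inl n))) {1..}"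
    by (rule indep_vars_reindex[OF indep]) (auto simp: inj_on_def)
  then have "indep_vars (\<lambda>_. borel) R {1..}" by simp
  then show "yule_sums M \<alpha> lam R"
    by unfold_locales (rule alpha(1) rate_pos(1) R_pos R_tail | assumption)+
qed

sublocale bw: yule_sums M \<alpha> mu L
proof -
  have "indep_vars (\<lambda>_. borel) (\<lambda>n. case_sum (\<lambda>n \<omega>. real (Y n \<omega>)) (case_sum R L) (Inr (Inr n))) {1..}"
    by (rule indep_vars_reindex[OF indep]) (auto simp: inj_on_def)
  then have "indep_vars (\<lambda>_. borel) L {1..}" by simp
  then show "yule_sums M \<alpha> mu L"
    by unfold_locales (rule alpha(1) rate_pos(2) L_pos L_tail | assumption)+
qed

definition successes :: "nat \<Rightarrow> 'a \<Rightarrow> nat" where "successes n \<omega> = (\<Sum>k=1..n. Y k \<omega>)"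

lemma successes_0: "successes 0 \<omega> = 0" and successes_Suc: "successes (Suc n) \<omega> = successes n \<omega> + Y (Suc n) \<omega>"
  by (simp_all add: successes_def)

lemma Y_cases: "\<omega> \<in> space M \<Longrightarrow> Y (Suc n) \<omega> = 0 \<or> Y (Suc n) \<omega> = 1"
  using Y_range[of "Suc n" \<omega>] by auto

lemma successes_le: "\<omega> \<in> space M \<Longrightarrow> successes n \<omega> \<le> n"
proof (induction n)
  case (Suc n)
  then show ?case using Y_cases[of \<omega> n] by (auto simp: successes_Suc)
qed (simp add: successes_0)

lemma trial_velocity_iff:
  "trial_velocity n \<omega> = v1 \<longleftrightarrow> Y (Suc n) \<omega> = 1" "trial_velocity n \<omega> = - v2 \<longleftrightarrow> Y (Suc n) \<omega> \<noteq> 1"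
  using v_pos by (auto simp: trial_velocity_def)

declare epoch.simps(2) [simp del]

lemma epoch_Suc:
  "epoch (Suc n) \<omega> = epoch n \<omega> +
     (if Y (Suc n) \<omega> = 1 then R (successes n \<omega> + 1) \<omega> else L (n - successes n \<omega> + 1) \<omega>)"
  by (simp add: epoch.simps(2) trial_velocity_iff successes_def)

text \<open>
  Whatever the order of the trials, the completed waiting times are the first \<open>successes
  n\<close> of the \<open>R\<^sub>i\<close> and the first \<open>n - successes n\<close> of
  the \<open>L\<^sub>i\<close>.
\<close>

lemma epoch_eq:
  assumes w: "\<omega> \<in> space M"
  shows "epoch n \<omega> = fw.waiting (successes n \<omega>) \<omega> + bw.waiting (n - successes n \<omega>) \<omega>"
proof (induction n)
  case 0
  then show ?case by (simp add: successes_0 fw.waiting_0 bw.waiting_0)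
next
  case (Suc n)
  then show ?case
    using Y_cases[OF w, of n] successes_le[OF w, of n]
    by (auto simp: epoch_Suc successes_Suc fw.waiting_Suc bw.waiting_Suc Suc_diff_le)
qed

lemma epoch_less: "\<omega> \<in> space M \<Longrightarrow> epoch n \<omega> < epoch (Suc n) \<omega>"
  using R_pos[of "successes n \<omega> + 1" \<omega>] L_pos[of "n - successes n \<omega> + 1" \<omega>]
  by (simp add: epoch_Suc)

lemma epoch_strict_mono: "\<omega> \<in> space M \<Longrightarrow> strict_mono (\<lambda>n. epoch n \<omega>)"
  by (intro strict_monoI_Suc epoch_less)

lemma epoch_nonneg: "\<omega> \<in> space M \<Longrightarrow> 0 \<le> epoch n \<omega>"
  using strict_mono_less_eq[OF epoch_strict_mono, of \<omega> 0 n] by simp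

lemma num_epochs_eq:
  assumes w: "\<omega> \<in> space M" and n: "epoch n \<omega> \<le> s" "s < epoch (Suc n) \<omega>"
  shows "num_epochs s \<omega> = n"
proof -
  have lt: "epoch i \<omega> < epoch j \<omega> \<longleftrightarrow> i < j" for i j
    using strict_mono_less[OF epoch_strict_mono[OF w]] .
  have "epoch k \<omega> \<le> s \<longleftrightarrow> k \<le> n" for k
    using lt[of k "Suc n"] lt[of n k] n by linarith
  then have "{k. epoch k \<omega> \<le> s} = {..n}" by auto
  then show ?thesis unfolding num_epochs_def by (auto intro!: Max_eqI)
qed

lemma velocity_0_iff:
  assumes w: "\<omega> \<in> space M"
  shows "velocity 0 \<omega> = v1 \<longleftrightarrow> Y 1 \<omega> = 1"
proof -
  have "num_epochs 0 \<omega> = 0"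
    using epoch_less[OF w, of 0] by (intro num_epochs_eq[OF w]) simp_all
  then show ?thesis by (simp add: velocity_def trial_velocity_iff)
qed

lemma epoch_covers:
  assumes w: "\<omega> \<in> space M" and s: "0 \<le> s" "s < epoch n \<omega>"
  shows "\<exists>k<n. epoch k \<omega> \<le> s \<and> s < epoch (Suc k) \<omega>"
  using s(2)
proof (induction n)
  case 0
  then show ?case using s(1) by simp
next
  case (Suc n)
  then show ?case
    by (cases "s < epoch n \<omega>") (auto intro: less_SucI)
qed

lemma travelled_eq:
  assumes w: "\<omega> \<in> space M"
  shows "(\<Sum>k<n. trial_velocity k \<omega> * (epoch (Suc k) \<omega> - epoch k \<omega>))
    = v1 * fw.waiting (successes n \<omega>) \<omega> - v2 * bw.waiting (n - successes n \<omega>) \<omega>"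
proof (induction n)
  case 0
  then show ?case by (simp add: successes_0 fw.waiting_0 bw.waiting_0)
next
  case (Suc n)
  then show ?case
    using Y_cases[OF w, of n] successes_le[OF w, of n]
    by (auto simp: epoch_Suc successes_Suc fw.waiting_Suc bw.waiting_Suc Suc_diff_le trial_velocity_def ring_distribs
)
qed

text \<open>
  The velocity is a step function on \<open>{0..s}\<close>; its integral telescopes to the two
  total waiting times, plus the part of the current interval that has elapsed.
\<close>

lemma position_eq:
  assumes w: "\<omega> \<in> space M" and n: "epoch n \<omega> \<le> s" "s < epoch (Suc n) \<omega>"
  shows "position s \<omega> = v1 * fw.waiting (successes n \<omega>) \<omega> - v2 * bw.waiting (n - successes n \<omega>) \<omega>
     + trial_velocity n \<omega> * (s - epoch n \<omega>)"
proof -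
  let ?tv = "\<lambda>k. trial_velocity k \<omega>" and ?T = "\<lambda>k. epoch k \<omega>"
  have mono: "?T i \<le> ?T j \<longleftrightarrow> i \<le> j" for i j
    using strict_mono_less_eq[OF epoch_strict_mono[OF w]] .
  have pw: "indicator {0..s} x *\<^sub>R velocity x \<omega> =
      (\<Sum>k<n. ?tv k * indicator {?T k..<?T (Suc k)} x) + ?tv n * indicator {?T n..s} x" for x
  proof (cases "x \<in> {0..s}")
    case True
    then have x: "0 \<le> x" "x < ?T (Suc n)" using n by auto
    obtain k where k: "k < Suc n" "?T k \<le> x" "x < ?T (Suc k)"
      using epoch_covers[OF w x] by auto
    have v: "velocity x \<omega> = ?tv k"
      using num_epochs_eq[OF w k(2,3)] by (simp add: velocity_def)
    \<comment> \<open>Exactly one of the intervals contains \<open>x\<close>.\<close>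
    have other: "indicator {?T j..<?T (Suc j)} x = (if j = k then 1 else 0 :: real)" for j
    proof (cases "j = k")
      case False
      then consider "Suc j \<le> k" | "Suc k \<le> j" by linarith
      then show ?thesis
      proof cases
        case 1
        then have "?T (Suc j) \<le> ?T k" by (simp only: mono)
        then show ?thesis using k False by auto
      next
        case 2
        then have "?T (Suc k) \<le> ?T j" by (simp only: mono)
        then show ?thesis using k False by auto
      qed
    qed (use k in auto)
    have last: "indicator {?T n..s} x = (if k = n then 1 else 0 :: real)"
    proof (cases "k = n")
      case False
      then have "?T (Suc k) \<le> ?T n" using k(1) False unfolding mono by simp
      then show ?thesis using k False by auto
    qed (use k True in auto)
    have "(\<Sum>j<n. ?tv j * (if j = k then 1 else 0)) = (\<Sum>j<n. if j = k then ?tv j else 0)"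
      by (intro sum.cong) auto
    also have "\<dots> = (if k < n then ?tv k else 0)" by (subst sum.delta) auto
    finally have "(\<Sum>j<n. ?tv j * (if j = k then 1 else 0)) = (if k < n then ?tv k else 0)" .
    then show ?thesis
      unfolding v other last using k(1) True by (cases "k = n") auto
  next
    case False
    then have x: "x < 0 \<or> s < x" by auto
    have "indicator {?T k..<?T (Suc k)} x = (0::real)" if "k < n" for k
    proof -
      have "?T (Suc k) \<le> ?T n" using that unfolding mono by simp
      then have "\<not> (?T k \<le> x \<and> x < ?T (Suc k))"
        using x n(1) epoch_nonneg[OF w, of k] by linarith
      then show ?thesis by simp
    qed
    then have "(\<Sum>k<n. ?tv k * indicator {?T k..<?T (Suc k)} x) = 0"
      by (intro sum.neutral) simp
    moreover have "\<not> (?T n \<le> x \<and> x \<le> s)"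
      using x epoch_nonneg[OF w, of n] by linarith
    then have "indicator {?T n..s} x = (0::real)" by simp
    ultimately show ?thesis using False by simp
  qed
  have fin: "emeasure lborel {?T k..<?T (Suc k)} < \<infinity>" for k
    using emeasure_lborel_Ico[OF less_imp_le[OF epoch_less[OF w, of k]]] by simp
  have fin': "emeasure lborel {?T n..s} < \<infinity>"
    using emeasure_lborel_Icc[OF n(1)] by simp
  have "has_bochner_integral lborel
     (\<lambda>x. (\<Sum>k<n. ?tv k * indicator {?T k..<?T (Suc k)} x) + ?tv n * indicator {?T n..s} x)
     ((\<Sum>k<n. ?tv k * measure lborel {?T k..<?T (Suc k)}) + ?tv n * measure lborel {?T n..s})"
    using fin fin'
    by (intro has_bochner_integral_add has_bochner_integral_sum has_bochner_integral_mult_right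
        has_bochner_integral_real_indicator) auto
  from has_bochner_integral_integral_eq[OF this]
  have "position s \<omega> = (\<Sum>k<n. ?tv k * measure lborel {?T k..<?T (Suc k)}) + ?tv n * measure lborel {?T n..s}"
    by (simp only: position_def set_lebesgue_integral_def pw)
  moreover have "measure lborel {?T k..<?T (Suc k)} = ?T (Suc k) - ?T k" for k
    using less_imp_le[OF epoch_less[OF w, of k]] by (rule measure_lborel_Ico)
  moreover have "measure lborel {?T n..s} = s - ?T n"
    using n(1) by (rule measure_lborel_Icc)
  ultimately show ?thesis by (simp only: travelled_eq[OF w, of n])
qed

lemma Y_measurable: "Y (Suc n) \<in> measurable M (count_space UNIV)"
proof (rule measurable_nat_of_real)
  show "(\<lambda>\<omega>. real (Y (Suc n) \<omega>)) \<in> borel_measurable M"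
    using indep_vars_reindex[OF indep, of Inl "{1..}"] by (auto simp: indep_vars_def)
qed

lemma successes_measurable [measurable]: "successes n \<in> measurable M (count_space UNIV)"
proof (induction n)
  case (Suc n)
  note [measurable] = Suc Y_measurable[of n]
  have "(\<lambda>\<omega>. real (successes n \<omega>) + real (Y (Suc n) \<omega>)) \<in> borel_measurable M" by measurable
  then show ?case by (intro measurable_nat_of_real) (simp add: successes_Suc[abs_def])
qed (simp add: successes_0[abs_def])

lemma epoch_measurable [measurable]: "epoch n \<in> borel_measurable M"
proof (induction n)
  case (Suc n)
  note [measurable] = Suc Y_measurable[of n]
  have [measurable]: "(\<lambda>\<omega>. R (successes n \<omega> + 1) \<omega>) \<in> borel_measurable M"
    by (rule measurable_compose_countable[OF _ successes_measurable, where f="\<lambda>i. R (i + 1)"]) simp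
  have [measurable]: "(\<lambda>\<omega>. L (n - successes n \<omega> + 1) \<omega>) \<in> borel_measurable M"
    by (rule measurable_compose_countable[OF _ successes_measurable, where f="\<lambda>i. L (n - i + 1)"]) simp
  show ?case unfolding epoch_Suc[abs_def] by measurable
qed simp

text \<open>
  Joint measurability is needed because the position is an integral over time. The maximum
  over an infinite set of indices is a fixed number, so the paths that explode cause no
  difficulty.
\<close>

lemma velocity_measurable2 [measurable]:
  "(\<lambda>x. velocity (snd x) (fst x)) \<in> borel_measurable (M \<Otimes>\<^sub>M borel)"
proof -
  have n: "(\<lambda>x. num_epochs (snd x) (fst x)) \<in> measurable (M \<Otimes>\<^sub>M borel) (count_space UNIV)"
    unfolding num_epochs_def by measurable
  note [measurable] = Y_measurable
  have "(\<lambda>x. trial_velocity i (fst x)) \<in> borel_measurable (M \<Otimes>\<^sub>M borel)" for i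
    unfolding trial_velocity_def by measurable
  from measurable_compose_countable[OF this n] show ?thesis by (simp add: velocity_def)
qed

lemma velocity_measurable [measurable]: "velocity s \<in> borel_measurable M"
  using measurable_compose[OF _ velocity_measurable2, of "\<lambda>\<omega>. (\<omega>, s)" M] by simp

lemma position_measurable [measurable]: "position s \<in> borel_measurable M"
proof -
  have "(\<lambda>\<omega>. \<integral>x. indicator {0..s} x *\<^sub>R velocity x \<omega> \<partial>lborel) \<in> borel_measurable M"
  proof (rule lborel.borel_measurable_lebesgue_integral)
    show "(\<lambda>(\<omega>, x). indicator {0..s} x *\<^sub>R velocity x \<omega>) \<in> borel_measurable (M \<Otimes>\<^sub>M lborel)"
      using velocity_measurable2 by (simp add: case_prod_beta') measurable
  qed
  then show ?thesis by (simp add: position_def[abs_def] set_lebesgue_integral_def)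
qed

text \<open>
  Among \<open>2 n\<close> completed waiting times at least \<open>n\<close> belong to the
  same direction, and the total of the first \<open>n\<close> waiting times of one direction
  exceeds \<open>t\<close> with probability tending to 1.
\<close>

lemma no_explosion:
  assumes t: "0 < t"
  shows "AE \<omega> in M. \<exists>n. t < epoch n \<omega>"
proof -
  let ?E = "{\<omega> \<in> space M. \<forall>n. epoch n \<omega> \<le> t}"
  have le: "\<P>(\<omega> in M. \<forall>n. epoch n \<omega> \<le> t) \<le> \<P>(\<omega> in M. fw.waiting n \<omega> \<le> t) + \<P>(\<omega> in M. bw.waiting n \<omega> \<le> t)" for n
  proof -
    have "?E \<subseteq> {\<omega> \<in> space M. fw.waiting n \<omega> \<le> t} \<union> {\<omega> \<in> space M. bw.waiting n \<omega> \<le> t}"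
    proof
      fix \<omega> assume w: "\<omega> \<in> ?E"
      then have ws: "\<omega> \<in> space M" and ep: "epoch (n + n) \<omega> \<le> t" by auto
      have smf: "strict_mono (\<lambda>k. fw.waiting k \<omega>)" and smb: "strict_mono (\<lambda>k. bw.waiting k \<omega>)"
        using fw.waiting_Suc_gt[OF ws] bw.waiting_Suc_gt[OF ws] by (auto intro: strict_monoI_Suc)
      let ?s = "successes (n + n) \<omega>"
      have e: "fw.waiting ?s \<omega> + bw.waiting (n + n - ?s) \<omega> \<le> t" using ep epoch_eq[OF ws, of "n + n"] by simp
      consider "n \<le> ?s" | "n \<le> n + n - ?s" by linarith
      then show "\<omega> \<in> {\<omega> \<in> space M. fw.waiting n \<omega> \<le> t} \<union> {\<omega> \<in> space M. bw.waiting n \<omega> \<le> t}"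
      proof cases
        case 1
        then have "fw.waiting n \<omega> \<le> fw.waiting ?s \<omega>" using strict_mono_less_eq[OF smf] by simp
        then show ?thesis using e bw.waiting_nonneg[OF ws, of "n + n - ?s"] ws by auto
      next
        case 2
        then have "bw.waiting n \<omega> \<le> bw.waiting (n + n - ?s) \<omega>" using strict_mono_less_eq[OF smb] by simp
        then show ?thesis using e fw.waiting_nonneg[OF ws, of ?s] ws by auto
      qed
    qed
    then have "\<P>(\<omega> in M. \<forall>n. epoch n \<omega> \<le> t)
      \<le> prob ({\<omega> \<in> space M. fw.waiting n \<omega> \<le> t} \<union> {\<omega> \<in> space M. bw.waiting n \<omega> \<le> t})"
      by (intro finite_measure_mono) auto
    also have "\<dots> \<le> \<P>(\<omega> in M. fw.waiting n \<omega> \<le> t) + \<P>(\<omega> in M. bw.waiting n \<omega> \<le> t)"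
      by (rule measure_Un_le) measurable
    finally show ?thesis .
  qed
  have "(\<lambda>n. \<P>(\<omega> in M. fw.waiting n \<omega> \<le> t) + \<P>(\<omega> in M. bw.waiting n \<omega> \<le> t)) \<longlonglongrightarrow> 0 + 0"
    by (intro tendsto_add fw.prob_waiting_tendsto_0 bw.prob_waiting_tendsto_0 t)
  then have "\<P>(\<omega> in M. \<forall>n. epoch n \<omega> \<le> t) \<le> 0 + 0"
    by (rule LIMSEQ_le_const) (intro exI allI impI le)
  then have "prob ?E = 0" using measure_nonneg[of M ?E] by linarith
  then have "?E \<in> null_sets M"
    by (intro null_setsI) (auto simp: emeasure_eq_measure)
  then show ?thesis
    by (rule AE_I') (auto simp: not_less)
qed

section \<open>Trials and waiting times are independent\<close>

abbreviation (input) "ix \<equiv> {1::nat..} <+> ({1::nat..} <+> {1::nat..})"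
abbreviation "Z \<equiv> case_sum (\<lambda>n \<omega>. real (Y n \<omega>)) (case_sum R L)"

text \<open>
  All independence statements about the process reduce to this one: functions of disjoint
  blocks of the single independent family \<open>Z\<close>.
\<close>

lemma blocks_indep:
  assumes A: "A \<subseteq> ix" "B \<subseteq> ix" "A \<inter> B = {}"
    and F: "F \<in> measurable (PiM A (\<lambda>_. borel)) N1" and G: "G \<in> measurable (PiM B (\<lambda>_. borel)) N2"
  shows "indep_pair N1 (\<lambda>\<omega>. F (\<lambda>i\<in>A. Z i \<omega>)) N2 (\<lambda>\<omega>. G (\<lambda>i\<in>B. Z i \<omega>))"
  by (rule indep_pair_compose[OF indep_var_restrict[OF indep A(3,1,2)] F G])

abbreviation (input) "Rix \<equiv> (\<lambda>n. Inr (Inl n)) ` {1::nat..}"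
abbreviation (input) "Lix \<equiv> (\<lambda>n. Inr (Inr n)) ` {1::nat..}"

lemma waiting_pairs_indep:
  "indep_pair borel (bw.waiting m) (borel \<Otimes>\<^sub>M borel) (\<lambda>\<omega>. (fw.waiting k \<omega>, fw.waiting (Suc k) \<omega>))" (is ?th1)
  "indep_pair borel (fw.waiting k) (borel \<Otimes>\<^sub>M borel) (\<lambda>\<omega>. (bw.waiting m \<omega>, bw.waiting (Suc m) \<omega>))" (is ?th2)
proof -
  define F :: "nat \<Rightarrow> (nat + nat + nat \<Rightarrow> real) \<Rightarrow> real" where "F k g = (\<Sum>i=1..k. g (Inr (Inl i)))" for k g
  define G :: "nat \<Rightarrow> (nat + nat + nat \<Rightarrow> real) \<Rightarrow> real" where "G k g = (\<Sum>i=1..k. g (Inr (Inr i)))" for k g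
  have F: "F k \<in> measurable (PiM Rix (\<lambda>_. borel)) borel" for k
    unfolding F_def by (intro borel_measurable_sum measurable_component_singleton) auto
  have G: "G k \<in> measurable (PiM Lix (\<lambda>_. borel)) borel" for k
    unfolding G_def by (intro borel_measurable_sum measurable_component_singleton) auto
  have Fe: "F k (\<lambda>i\<in>Rix. Z i \<omega>) = fw.waiting k \<omega>" for k \<omega>
    unfolding F_def fw.waiting_def by (intro sum.cong) auto
  have Ge: "G k (\<lambda>i\<in>Lix. Z i \<omega>) = bw.waiting k \<omega>" for k \<omega>
    unfolding G_def bw.waiting_def by (intro sum.cong) auto
  have sub: "Rix \<subseteq> ix" "Lix \<subseteq> ix" "Lix \<inter> Rix = {}" "Rix \<inter> Lix = {}" by auto
  have "indep_pair borel (\<lambda>\<omega>. G m (\<lambda>i\<in>Lix. Z i \<omega>)) (borel \<Otimes>\<^sub>M borel)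
     (\<lambda>\<omega>. (\<lambda>g. (F k g, F (Suc k) g)) (\<lambda>i\<in>Rix. Z i \<omega>))"
    by (rule blocks_indep[OF sub(2,1,3) G measurable_Pair[OF F F]])
  then show ?th1 unfolding Fe Ge .
  have "indep_pair borel (\<lambda>\<omega>. F k (\<lambda>i\<in>Rix. Z i \<omega>)) (borel \<Otimes>\<^sub>M borel)
     (\<lambda>\<omega>. (\<lambda>g. (G m g, G (Suc m) g)) (\<lambda>i\<in>Lix. Z i \<omega>))"
    by (rule blocks_indep[OF sub(1,2,4) F measurable_Pair[OF G G]])
  then show ?th2 unfolding Fe Ge .
qed

lemma trials_times_indep:
  assumes Q: "Measurable.pred (borel \<Otimes>\<^sub>M borel \<Otimes>\<^sub>M borel \<Otimes>\<^sub>M borel) (\<lambda>x. Q (fst x) (fst (snd x)) (fst (snd (snd x))) (snd (snd (snd x))))"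
  shows "\<P>(\<omega> in M. (Y 1 \<omega> = 1 \<and> successes n \<omega> = j \<and> Y (Suc n) \<omega> = y)
        \<and> Q (fw.waiting k \<omega>) (fw.waiting (Suc k) \<omega>) (bw.waiting m \<omega>) (bw.waiting (Suc m) \<omega>))
    = \<P>(\<omega> in M. Y 1 \<omega> = 1 \<and> successes n \<omega> = j \<and> Y (Suc n) \<omega> = y)
      * \<P>(\<omega> in M. Q (fw.waiting k \<omega>) (fw.waiting (Suc k) \<omega>) (bw.waiting m \<omega>) (bw.waiting (Suc m) \<omega>))"
proof -
  define E :: "(nat + nat + nat \<Rightarrow> real) \<Rightarrow> bool" where
    "E g \<longleftrightarrow> g (Inl 1) = 1 \<and> (\<Sum>i=1..n. g (Inl i)) = real j \<and> g (Inl (Suc n)) = real y" for g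
  define F :: "nat \<Rightarrow> (nat + nat + nat \<Rightarrow> real) \<Rightarrow> real" where "F k g = (\<Sum>i=1..k. g (Inr (Inl i)))" for k g
  define G :: "nat \<Rightarrow> (nat + nat + nat \<Rightarrow> real) \<Rightarrow> real" where "G k g = (\<Sum>i=1..k. g (Inr (Inr i)))" for k g
  let ?A = "Inl ` {1::nat..} :: (nat + nat + nat) set" and ?B = "Rix \<union> Lix :: (nat + nat + nat) set"
  have F: "F k \<in> measurable (PiM ?B (\<lambda>_. borel)) borel" for k
    unfolding F_def by (intro borel_measurable_sum measurable_component_singleton) auto
  have G: "G k \<in> measurable (PiM ?B (\<lambda>_. borel)) borel" for k
    unfolding G_def by (intro borel_measurable_sum measurable_component_singleton) auto
  have c: "(\<lambda>g. g (Inl i)) \<in> measurable (PiM ?A (\<lambda>_. borel)) borel" if "1 \<le> i" for i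
    using that by (intro measurable_component_singleton) auto
  have s: "(\<lambda>g. \<Sum>i=1..n. g (Inl i)) \<in> measurable (PiM ?A (\<lambda>_. borel)) (borel :: real measure)"
    by (intro borel_measurable_sum c) auto
  have E: "Measurable.pred (PiM ?A (\<lambda>_. borel)) E"
    unfolding E_def[abs_def] using c[of 1] c[of "Suc n"] s by measurable
  have Fe: "F k (\<lambda>i\<in>?B. Z i \<omega>) = fw.waiting k \<omega>" for k \<omega>
    unfolding F_def fw.waiting_def by (intro sum.cong) auto
  have Ge: "G k (\<lambda>i\<in>?B. Z i \<omega>) = bw.waiting k \<omega>" for k \<omega>
    unfolding G_def bw.waiting_def by (intro sum.cong) auto
  have Ee: "E (\<lambda>i\<in>?A. Z i \<omega>) \<longleftrightarrow> Y 1 \<omega> = 1 \<and> successes n \<omega> = j \<and> Y (Suc n) \<omega> = y" for \<omega>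
  proof -
    have "(\<Sum>i=1..n. (\<lambda>i\<in>?A. Z i \<omega>) (Inl i)) = real (successes n \<omega>)"
      unfolding successes_def of_nat_sum by (intro sum.cong) auto
    then show ?thesis unfolding E_def by (simp del: of_nat_Suc)
  qed
  have sub: "?A \<subseteq> ix" "?B \<subseteq> ix" "?A \<inter> ?B = {}" by auto
  have ind: "indep_pair (count_space UNIV) (\<lambda>\<omega>. E (\<lambda>i\<in>?A. Z i \<omega>)) (borel \<Otimes>\<^sub>M borel \<Otimes>\<^sub>M borel \<Otimes>\<^sub>M borel)
     (\<lambda>\<omega>. (\<lambda>g. (F k g, F (Suc k) g, G m g, G (Suc m) g)) (\<lambda>i\<in>?B. Z i \<omega>))"
    by (rule blocks_indep[OF sub E]) (intro measurable_Pair F G)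
  have "Measurable.pred (count_space UNIV) (\<lambda>x. x)" by simp
  from indep_pair_prob[OF ind this Q] show ?thesis
    unfolding Fe Ge Ee by simp
qed

lemma Y_prob_cases: "\<P>(\<omega> in M. Y (Suc n) \<omega> = 1) = p" "\<P>(\<omega> in M. Y (Suc n) \<omega> = 0) = 1 - p"
proof -
  note [measurable] = Y_measurable
  show 1: "\<P>(\<omega> in M. Y (Suc n) \<omega> = 1) = p" using Y_prob[of "Suc n"] by simp
  have "{\<omega> \<in> space M. Y (Suc n) \<omega> = 0} = {\<omega> \<in> space M. \<not> Y (Suc n) \<omega> = 1}"
    using Y_cases by force
  then have "\<P>(\<omega> in M. Y (Suc n) \<omega> = 0) = \<P>(\<omega> in M. \<not> Y (Suc n) \<omega> = 1)" by (rule arg_cong)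
  also have "\<dots> = 1 - \<P>(\<omega> in M. Y (Suc n) \<omega> = 1)" by (rule prob_neg) simp
  finally show "\<P>(\<omega> in M. Y (Suc n) \<omega> = 0) = 1 - p" using 1 by simp
qed

lemma next_trial_indep:
  assumes n: "1 \<le> n"
  shows "\<P>(\<omega> in M. Y 1 \<omega> = 1 \<and> successes n \<omega> = j \<and> Y (Suc n) \<omega> = y)
    = \<P>(\<omega> in M. Y 1 \<omega> = 1 \<and> successes n \<omega> = j) * \<P>(\<omega> in M. Y (Suc n) \<omega> = y)"
proof -
  define E :: "(nat + nat + nat \<Rightarrow> real) \<Rightarrow> bool" where
    "E g \<longleftrightarrow> g (Inl 1) = 1 \<and> (\<Sum>i=1..n. g (Inl i)) = real j" for g
  let ?A = "Inl ` {1..n} :: (nat + nat + nat) set" and ?B = "{Inl (Suc n)} :: (nat + nat + nat) set"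
  have c: "(\<lambda>g. g (Inl i)) \<in> measurable (PiM ?A (\<lambda>_. borel)) borel" if "1 \<le> i" "i \<le> n" for i
    using that by (intro measurable_component_singleton) auto
  have s: "(\<lambda>g. \<Sum>i=1..n. g (Inl i)) \<in> measurable (PiM ?A (\<lambda>_. borel)) (borel :: real measure)"
    by (intro borel_measurable_sum c) auto
  have E: "Measurable.pred (PiM ?A (\<lambda>_. borel)) E"
    unfolding E_def[abs_def] using c[of 1] n s by measurable
  have Ee: "E (\<lambda>i\<in>?A. Z i \<omega>) \<longleftrightarrow> Y 1 \<omega> = 1 \<and> successes n \<omega> = j" for \<omega>
  proof -
    have "(\<Sum>i=1..n. (\<lambda>i\<in>?A. Z i \<omega>) (Inl i)) = real (successes n \<omega>)"
      unfolding successes_def of_nat_sum by (intro sum.cong) auto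
    then show ?thesis unfolding E_def using n by (simp del: of_nat_Suc)
  qed
  have sub: "?A \<subseteq> ix" "?B \<subseteq> ix" "?A \<inter> ?B = {}" by auto
  have ind: "indep_pair (count_space UNIV) (\<lambda>\<omega>. E (\<lambda>i\<in>?A. Z i \<omega>)) borel (\<lambda>\<omega>. (\<lambda>g. g (Inl (Suc n))) (\<lambda>i\<in>?B. Z i \<omega>))"
    by (rule blocks_indep[OF sub E]) (intro measurable_component_singleton, simp)
  have P: "Measurable.pred (count_space UNIV) (\<lambda>x. x)" by simp
  have Q: "Measurable.pred borel (\<lambda>x. x = real y)" by measurable
  from indep_pair_prob[OF ind P Q] show ?thesis
    unfolding Ee by (simp add: conj_assoc del: of_nat_Suc)
qed

text \<open>
  Since the first trial is a success, the remaining \<open>N\<close> trials contribute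
  \<open>j - 1\<close> successes.
\<close>

lemma trial_weight:
  "\<P>(\<omega> in M. Y 1 \<omega> = 1 \<and> successes (Suc N) \<omega> = j)
     = (if j = 0 then 0 else real (N choose (j - 1)) * p ^ j * (1 - p) ^ (Suc N - j))"
proof (induction N arbitrary: j)
  case 0
  \<comment> \<open>For a single trial both sides vanish unless \<open>j = 1\<close>.\<close>
  have e: "{\<omega> \<in> space M. Y 1 \<omega> = 1 \<and> successes (Suc 0) \<omega> = j} = (if j = 1 then {\<omega> \<in> space M. Y (Suc 0) \<omega> = 1} else {})"
    by (auto simp: successes_Suc successes_0)
  show ?case unfolding e using Y_prob_cases(1)[of 0] by (cases "j = 0"; cases "j = 1") (auto simp: binomial_eq_0)
next
  case (Suc N)
  note [measurable] = Y_measurable Y_measurable[of 0, simplified]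
  let ?n = "Suc N"
  let ?P = "\<lambda>j. \<P>(\<omega> in M. Y 1 \<omega> = 1 \<and> successes ?n \<omega> = j)"
  have split: "{\<omega> \<in> space M. Y 1 \<omega> = 1 \<and> successes (Suc ?n) \<omega> = j} =
     {\<omega> \<in> space M. Y 1 \<omega> = 1 \<and> successes ?n \<omega> = j \<and> Y (Suc ?n) \<omega> = 0} \<union>
     {\<omega> \<in> space M. Y 1 \<omega> = 1 \<and> successes ?n \<omega> + 1 = j \<and> Y (Suc ?n) \<omega> = 1}"
  proof (rule set_eqI)
    fix \<omega>
    show "\<omega> \<in> {\<omega> \<in> space M. Y 1 \<omega> = 1 \<and> successes (Suc ?n) \<omega> = j} \<longleftrightarrow> \<omega> \<in>
      {\<omega> \<in> space M. Y 1 \<omega> = 1 \<and> successes ?n \<omega> = j \<and> Y (Suc ?n) \<omega> = 0} \<union>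
      {\<omega> \<in> space M. Y 1 \<omega> = 1 \<and> successes ?n \<omega> + 1 = j \<and> Y (Suc ?n) \<omega> = 1}"
      using Y_cases[of \<omega> ?n] by (cases "\<omega> \<in> space M") (auto simp: successes_Suc[of ?n])
  qed
  have "\<P>(\<omega> in M. Y 1 \<omega> = 1 \<and> successes (Suc ?n) \<omega> = j) =
     \<P>(\<omega> in M. Y 1 \<omega> = 1 \<and> successes ?n \<omega> = j \<and> Y (Suc ?n) \<omega> = 0) +
     \<P>(\<omega> in M. Y 1 \<omega> = 1 \<and> successes ?n \<omega> + 1 = j \<and> Y (Suc ?n) \<omega> = 1)"
    unfolding split by (intro finite_measure_Union) auto
  also have "\<P>(\<omega> in M. Y 1 \<omega> = 1 \<and> successes ?n \<omega> = j \<and> Y (Suc ?n) \<omega> = 0) = ?P j * (1 - p)"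
    using next_trial_indep[of ?n j 0] Y_prob_cases(2)[of ?n] by simp
  finally have rec: "\<P>(\<omega> in M. Y 1 \<omega> = 1 \<and> successes (Suc ?n) \<omega> = j) = ?P j * (1 - p) +
     \<P>(\<omega> in M. Y 1 \<omega> = 1 \<and> successes ?n \<omega> + 1 = j \<and> Y (Suc ?n) \<omega> = 1)" .
  show ?case
  proof (cases j)
    case 0
    then show ?thesis using rec Suc[of 0] by simp
  next
    case (Suc i)
    have "\<P>(\<omega> in M. Y 1 \<omega> = 1 \<and> successes ?n \<omega> + 1 = j \<and> Y (Suc ?n) \<omega> = 1) = ?P i * p"
      using next_trial_indep[of ?n i 1] Y_prob_cases(1)[of ?n] Suc by simp
    with rec have r: "\<P>(\<omega> in M. Y 1 \<omega> = 1 \<and> successes (Suc ?n) \<omega> = j) = ?P j * (1 - p) + ?P i * p" by simp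
    show ?thesis
    proof (cases i)
      case 0
      then show ?thesis using r Suc.IH[of j] Suc.IH[of i] \<open>j = Suc i\<close> by simp
    next
      case (Suc l)
      then have j: "j = Suc (Suc l)" using \<open>j = Suc i\<close> by simp
      have "?P j = real (N choose Suc l) * p ^ Suc (Suc l) * (1 - p) ^ (N - Suc l)"
        using Suc.IH[of j] by (simp only: j) (simp del: power_Suc)
      moreover have "?P i = real (N choose l) * p ^ Suc l * (1 - p) ^ (N - l)"
        using Suc.IH[of i] by (simp only: Suc) (simp del: power_Suc)
      ultimately have "\<P>(\<omega> in M. Y 1 \<omega> = 1 \<and> successes (Suc ?n) \<omega> = j)
          = real (Suc N choose Suc l) * p ^ Suc (Suc l) * (1 - p) ^ (N - l)"
        using r by (simp only: binomial_weight_step)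
      then show ?thesis by (simp only: j) (simp del: power_Suc binomial_Suc_Suc)
    qed
  qed
qed

lemma p_nonneg: "0 \<le> p" "0 \<le> 1 - p"
  using p_bounds by auto

section \<open>The law of position and velocity as a series\<close>

text \<open>
  The time spent at velocity \<open>v1\<close> by a path that is at \<open>x\<close> at time
  \<open>t\<close>.
\<close>

definition theta :: "real \<Rightarrow> real \<Rightarrow> real" where "theta t x = (v2 * t + x) / (v1 + v2)"

lemma theta_compl: "t - theta t x = (v1 * t - x) / (v1 + v2)"
  using v_pos by (simp add: theta_def field_simps)

text \<open>
  The contribution of \<open>n + 2\<close> completed waiting times, \<open>k + 1\<close> of
  them rightward. The total of the leftward ones must equal \<open>t - \<theta>\<close>, while
  exactly \<open>k + 1\<close> rightward ones are completed within \<open>\<theta>\<close>. At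
  least one waiting time is leftward; the paths without one form the atom at \<open>v1
  t\<close>.
\<close>

definition fwd_summand :: "real \<Rightarrow> nat \<Rightarrow> real \<Rightarrow> real" where
  "fwd_summand t n x = (\<Sum>k\<le>n. real (Suc n choose k) * p ^ Suc k * (1 - p) ^ (Suc n - k) *
     (bw.f (Suc n - k) (t - theta t x) * fw.count_prob (Suc k) (theta t x) / (v1 + v2)))"

text \<open>
  The contribution of \<open>n + 1\<close> completed waiting times, \<open>k + 1\<close> of
  them rightward; now the total of the rightward ones must equal \<open>\<theta>\<close>.
\<close>

definition bwd_summand :: "real \<Rightarrow> nat \<Rightarrow> real \<Rightarrow> real" where
  "bwd_summand t n x = (\<Sum>k\<le>n. real (n choose k) * p ^ k * (1 - p) ^ Suc (n - k) *
     (fw.f (Suc k) (theta t x) * bw.count_prob (n - k) (t - theta t x) / (v1 + v2)))"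

lemma fwd_piece:
  assumes m: "1 \<le> m" and A: "A \<in> sets borel"
  shows "emeasure M {\<omega> \<in> space M. v1 * t - (v1 + v2) * bw.waiting m \<omega> \<in> A
       \<and> fw.waiting k \<omega> + bw.waiting m \<omega> \<le> t \<and> t < fw.waiting (Suc k) \<omega> + bw.waiting m \<omega>}
    = (\<integral>\<^sup>+x. ennreal (bw.f m (t - theta t x) * fw.count_prob k (theta t x) / (v1 + v2)) * indicator A x \<partial>lborel)"
proof -
  have d: "- (v1 + v2) \<noteq> 0" using v_pos by simp
  have s: "(x - v1 * t) / (- (v1 + v2)) = t - theta t x" for x
    unfolding theta_compl by (simp only: divide_minus_right minus_divide_left minus_diff_eq)
  have e: "v1 * t + (- (v1 + v2)) * u = v1 * t - (v1 + v2) * u" for u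
    by (simp only: mult_minus_left diff_conv_add_uminus)
  have ab: "\<bar>- (v1 + v2)\<bar> = v1 + v2" unfolding abs_minus_cancel using v_pos by simp
  have th: "t - (t - theta t x) = theta t x" for x by simp
  from indep_section_density[OF waiting_pairs_indep(1) bw.waiting_distributed[OF m] bw.density_nonneg d A, of "v1 * t" k t]
  show ?thesis unfolding s e ab th fw.count_prob_def .
qed

lemma bwd_piece:
  assumes k: "1 \<le> k" and A: "A \<in> sets borel"
  shows "emeasure M {\<omega> \<in> space M. - (v2 * t) + (v1 + v2) * fw.waiting k \<omega> \<in> A
       \<and> bw.waiting m \<omega> + fw.waiting k \<omega> \<le> t \<and> t < bw.waiting (Suc m) \<omega> + fw.waiting k \<omega>}
    = (\<integral>\<^sup>+x. ennreal (fw.f k (theta t x) * bw.count_prob m (t - theta t x) / (v1 + v2)) * indicator A x \<partial>lborel)"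
proof -
  have d: "v1 + v2 \<noteq> 0" using v_pos by simp
  have s: "(x - - (v2 * t)) / (v1 + v2) = theta t x" for x
    by (simp add: theta_def add.commute)
  have ab: "\<bar>v1 + v2\<bar> = v1 + v2" using v_pos by simp
  from indep_section_density[OF waiting_pairs_indep(2) fw.waiting_distributed[OF k] fw.density_nonneg d A, of "- (v2 * t)" m t]
  show ?thesis unfolding s ab bw.count_prob_def .
qed

text \<open>
  The trial with result \<open>y\<close> is the one that decides the velocity at time
  \<open>t\<close>.
\<close>

definition stage :: "real \<Rightarrow> nat \<Rightarrow> nat \<Rightarrow> real set \<Rightarrow> 'a set" where
  "stage t n y A = {\<omega> \<in> space M. Y 1 \<omega> = 1 \<and> epoch n \<omega> \<le> t \<and> t < epoch (Suc n) \<omega> \<and> Y (Suc n) \<omega> = y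
     \<and> position t \<omega> \<in> A}"

lemma stage_sets:
  assumes [measurable]: "A \<in> sets borel"
  shows "stage t n y A \<in> sets M"
proof -
  note [measurable] = Y_measurable[of 0, folded One_nat_def] Y_measurable[of n]
  show ?thesis unfolding stage_def by measurable
qed

lemma successes_pos: "Y 1 \<omega> = 1 \<Longrightarrow> 1 \<le> successes (Suc n) \<omega>"
  by (induction n) (simp_all add: successes_Suc successes_0)

lemma stage_split:
  assumes A: "A \<in> sets borel"
  shows "emeasure M (stage t (Suc N) y A)
    = (\<Sum>k\<le>N. emeasure M (stage t (Suc N) y A \<inter> {\<omega> \<in> space M. successes (Suc N) \<omega> = Suc k}))"
proof -
  let ?S = "\<lambda>k. stage t (Suc N) y A \<inter> {\<omega> \<in> space M. successes (Suc N) \<omega> = Suc k}"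
  have "stage t (Suc N) y A = (\<Union>k\<in>{..N}. ?S k)"
  proof (intro set_eqI iffI)
    fix \<omega> assume w: "\<omega> \<in> stage t (Suc N) y A"
    then have ws: "\<omega> \<in> space M" "Y 1 \<omega> = 1" by (auto simp: stage_def)
    have "1 \<le> successes (Suc N) \<omega>" "successes (Suc N) \<omega> \<le> Suc N"
      using successes_pos[OF ws(2)] successes_le[OF ws(1)] by auto
    then obtain k where "successes (Suc N) \<omega> = Suc k" "k \<le> N" by (cases "successes (Suc N) \<omega>") auto
    then show "\<omega> \<in> (\<Union>k\<in>{..N}. ?S k)" using w ws by auto
  qed auto
  then have "emeasure M (stage t (Suc N) y A) = emeasure M (\<Union>k\<in>{..N}. ?S k)" by simp
  also have "\<dots> = (\<Sum>k\<in>{..N}. emeasure M (?S k))"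
    using stage_sets[OF A] by (intro sum_emeasure[symmetric]) (auto simp: disjoint_family_on_def)
  finally show ?thesis .
qed

lemma trial_weight_next:
  assumes k: "k \<le> N" and y: "y = 1 \<and> q = p \<or> y = 0 \<and> q = 1 - p"
  shows "\<P>(\<omega> in M. Y 1 \<omega> = 1 \<and> successes (Suc N) \<omega> = Suc k \<and> Y (Suc (Suc N)) \<omega> = y)
    = real (N choose k) * p ^ Suc k * (1 - p) ^ (N - k) * q"
proof -
  have "\<P>(\<omega> in M. Y (Suc (Suc N)) \<omega> = y) = q" using y Y_prob_cases[of "Suc N"] by auto
  then show ?thesis using next_trial_indep[of "Suc N" "Suc k" y] trial_weight[of N "Suc k"]
    by (simp del: power_Suc)
qed

text \<open>
  On a stage with a known number of successes, the position at time \<open>t\<close> is an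
  affine function of a single total: that of the leftward waiting times if the path moves
  right at time \<open>t\<close>, and that of the rightward ones otherwise.
\<close>

lemma stage_geometry:
  assumes w: "\<omega> \<in> space M" and s: "successes (Suc N) \<omega> = Suc k"
  shows "epoch (Suc N) \<omega> = fw.waiting (Suc k) \<omega> + bw.waiting (N - k) \<omega>"
    and "Y (Suc (Suc N)) \<omega> = 1 \<Longrightarrow> epoch (Suc (Suc N)) \<omega> = fw.waiting (Suc (Suc k)) \<omega> + bw.waiting (N - k) \<omega>"
    and "Y (Suc (Suc N)) \<omega> = 0 \<Longrightarrow> epoch (Suc (Suc N)) \<omega> = bw.waiting (Suc (N - k)) \<omega> + fw.waiting (Suc k) \<omega>"
    and "Y (Suc (Suc N)) \<omega> = 1 \<Longrightarrow> epoch (Suc N) \<omega> \<le> t \<Longrightarrow> t < epoch (Suc (Suc N)) \<omega> \<Longrightarrow>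
      position t \<omega> = v1 * t - (v1 + v2) * bw.waiting (N - k) \<omega>"
    and "Y (Suc (Suc N)) \<omega> = 0 \<Longrightarrow> epoch (Suc N) \<omega> \<le> t \<Longrightarrow> t < epoch (Suc (Suc N)) \<omega> \<Longrightarrow>
      position t \<omega> = - (v2 * t) + (v1 + v2) * fw.waiting (Suc k) \<omega>"
proof -
  have kN: "k \<le> N" using successes_le[OF w, of "Suc N"] s by simp
  show e: "epoch (Suc N) \<omega> = fw.waiting (Suc k) \<omega> + bw.waiting (N - k) \<omega>"
    using epoch_eq[OF w, of "Suc N"] s by simp
  show "Y (Suc (Suc N)) \<omega> = 1 \<Longrightarrow> epoch (Suc (Suc N)) \<omega> = fw.waiting (Suc (Suc k)) \<omega> + bw.waiting (N - k) \<omega>"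
    using epoch_eq[OF w, of "Suc (Suc N)"] s successes_Suc[of "Suc N" \<omega>] by simp
  show "Y (Suc (Suc N)) \<omega> = 0 \<Longrightarrow> epoch (Suc (Suc N)) \<omega> = bw.waiting (Suc (N - k)) \<omega> + fw.waiting (Suc k) \<omega>"
    using epoch_eq[OF w, of "Suc (Suc N)"] s successes_Suc[of "Suc N" \<omega>] kN by (simp add: Suc_diff_le)
  show "position t \<omega> = v1 * t - (v1 + v2) * bw.waiting (N - k) \<omega>"
    if "Y (Suc (Suc N)) \<omega> = 1" and t: "epoch (Suc N) \<omega> \<le> t" "t < epoch (Suc (Suc N)) \<omega>"
    using position_eq[OF w t] that(1) s e by (simp add: trial_velocity_def algebra_simps)
  show "position t \<omega> = - (v2 * t) + (v1 + v2) * fw.waiting (Suc k) \<omega>"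
    if "Y (Suc (Suc N)) \<omega> = 0" and t: "epoch (Suc N) \<omega> \<le> t" "t < epoch (Suc (Suc N)) \<omega>"
    using position_eq[OF w t] that(1) s e by (simp add: trial_velocity_def algebra_simps)
qed

lemma emeasure_trials_times:
  assumes "Measurable.pred (borel \<Otimes>\<^sub>M borel \<Otimes>\<^sub>M borel \<Otimes>\<^sub>M borel) (\<lambda>x. Q (fst x) (fst (snd x)) (fst (snd (snd x))) (snd (snd (snd x))))"
    and "k \<le> N" and "y = 1 \<and> q = p \<or> y = 0 \<and> q = 1 - p"
  shows "emeasure M {\<omega> \<in> space M. (Y 1 \<omega> = 1 \<and> successes (Suc N) \<omega> = Suc k \<and> Y (Suc (Suc N)) \<omega> = y)
        \<and> Q (fw.waiting k' \<omega>) (fw.waiting (Suc k') \<omega>) (bw.waiting m \<omega>) (bw.waiting (Suc m) \<omega>)}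
    = ennreal (real (N choose k) * p ^ Suc k * (1 - p) ^ (N - k) * q)
      * emeasure M {\<omega> \<in> space M. Q (fw.waiting k' \<omega>) (fw.waiting (Suc k') \<omega>) (bw.waiting m \<omega>) (bw.waiting (Suc m) \<omega>)}"
  unfolding emeasure_eq_measure trials_times_indep[OF assms(1)] trial_weight_next[OF assms(2,3)]
proof (intro ennreal_mult mult_nonneg_nonneg zero_le_power p_nonneg of_nat_0_le_iff measure_nonneg)
  show "0 \<le> q" using assms(3) p_nonneg by blast
qed

lemma fwd_stage:
  assumes A[measurable]: "A \<in> sets borel" and k: "k < N"
  shows "emeasure M (stage t (Suc N) 1 A \<inter> {\<omega> \<in> space M. successes (Suc N) \<omega> = Suc k})
    = ennreal (real (N choose k) * p ^ Suc k * (1 - p) ^ (N - k) * p) *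
      (\<integral>\<^sup>+x. ennreal (bw.f (N - k) (t - theta t x) * fw.count_prob (Suc k) (theta t x) / (v1 + v2)) * indicator A x \<partial>lborel)"
proof -
  let ?Q = "\<lambda>u1 u2 w1 w2. v1 * t - (v1 + v2) * w1 \<in> A \<and> u1 + w1 \<le> t \<and> t < u2 + w1"
  have Q: "Measurable.pred (borel \<Otimes>\<^sub>M borel \<Otimes>\<^sub>M borel \<Otimes>\<^sub>M borel)
     (\<lambda>x. ?Q (fst x) (fst (snd x)) (fst (snd (snd x))) (snd (snd (snd x))))" by measurable
  have "stage t (Suc N) 1 A \<inter> {\<omega> \<in> space M. successes (Suc N) \<omega> = Suc k} =
     {\<omega> \<in> space M. (Y 1 \<omega> = 1 \<and> successes (Suc N) \<omega> = Suc k \<and> Y (Suc (Suc N)) \<omega> = 1)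
        \<and> ?Q (fw.waiting (Suc k) \<omega>) (fw.waiting (Suc (Suc k)) \<omega>) (bw.waiting (N - k) \<omega>) (bw.waiting (Suc (N - k)) \<omega>)}"
  proof (rule set_eqI)
    fix \<omega>
    show "\<omega> \<in> stage t (Suc N) 1 A \<inter> {\<omega> \<in> space M. successes (Suc N) \<omega> = Suc k} \<longleftrightarrow>
      \<omega> \<in> {\<omega> \<in> space M. (Y 1 \<omega> = 1 \<and> successes (Suc N) \<omega> = Suc k \<and> Y (Suc (Suc N)) \<omega> = 1)
        \<and> ?Q (fw.waiting (Suc k) \<omega>) (fw.waiting (Suc (Suc k)) \<omega>) (bw.waiting (N - k) \<omega>) (bw.waiting (Suc (N - k)) \<omega>)}"
    proof (cases "\<omega> \<in> space M \<and> successes (Suc N) \<omega> = Suc k \<and> Y (Suc (Suc N)) \<omega> = 1")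
      case True
      then have g: "epoch (Suc N) \<omega> = fw.waiting (Suc k) \<omega> + bw.waiting (N - k) \<omega>"
         "epoch (Suc (Suc N)) \<omega> = fw.waiting (Suc (Suc k)) \<omega> + bw.waiting (N - k) \<omega>"
         "epoch (Suc N) \<omega> \<le> t \<Longrightarrow> t < epoch (Suc (Suc N)) \<omega> \<Longrightarrow>
            position t \<omega> = v1 * t - (v1 + v2) * bw.waiting (N - k) \<omega>"
        using stage_geometry[of \<omega> N k] by blast+
      show ?thesis using True g(3)[unfolded g(1,2)] by (auto simp: stage_def g(1,2))
    qed (auto simp: stage_def)
  qed
  note event = this
  have y: "(1::nat) = 1 \<and> p = p \<or> (1::nat) = 0 \<and> p = 1 - p" by simp
  note weight = emeasure_trials_times[where Q="?Q" and k'="Suc k" and m="N - k", OF Q less_imp_le[OF k] y]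
  have m: "1 \<le> N - k" using k by simp
  show ?thesis by (simp only: event weight fwd_piece[OF m A])
qed

text \<open>
  Paths whose trials have all succeeded have moved right all the time.
\<close>

lemma fwd_stage_atom:
  "emeasure M (stage t (Suc N) 1 A \<inter> {\<omega> \<in> space M. successes (Suc N) \<omega> = Suc N})
    = emeasure M (stage t (Suc N) 1 UNIV \<inter> {\<omega> \<in> space M. successes (Suc N) \<omega> = Suc N}) * indicator A (v1 * t)"
proof -
  have "position t \<omega> = v1 * t" if "\<omega> \<in> stage t (Suc N) 1 UNIV" "successes (Suc N) \<omega> = Suc N" for \<omega>
    using that stage_geometry(4)[of \<omega> N N t] by (auto simp: stage_def bw.waiting_0)
  then have "stage t (Suc N) 1 A \<inter> {\<omega> \<in> space M. successes (Suc N) \<omega> = Suc N} =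
    (if v1 * t \<in> A then stage t (Suc N) 1 UNIV \<inter> {\<omega> \<in> space M. successes (Suc N) \<omega> = Suc N} else {})"
    by (auto simp: stage_def)
  then show ?thesis by simp
qed

lemma fwd_stage_0: "emeasure M (stage t 0 1 A) = emeasure M (stage t 0 1 UNIV) * indicator A (v1 * t)"
proof -
  have "position t \<omega> = v1 * t" if "\<omega> \<in> stage t 0 1 UNIV" for \<omega>
    using that position_eq[of \<omega> 0 t] by (auto simp: stage_def successes_0 fw.waiting_0 bw.waiting_0 trial_velocity_def)
  then have "stage t 0 1 A = (if v1 * t \<in> A then stage t 0 1 UNIV else {})" by (auto simp: stage_def)
  then show ?thesis by simp
qed

lemma bwd_stage:
  assumes A[measurable]: "A \<in> sets borel" and k: "k \<le> N"
  shows "emeasure M (stage t (Suc N) 0 A \<inter> {\<omega> \<in> space M. successes (Suc N) \<omega> = Suc k})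
    = ennreal (real (N choose k) * p ^ Suc k * (1 - p) ^ (N - k) * (1 - p)) *
      (\<integral>\<^sup>+x. ennreal (fw.f (Suc k) (theta t x) * bw.count_prob (N - k) (t - theta t x) / (v1 + v2)) * indicator A x \<partial>lborel)"
proof -
  let ?Q = "\<lambda>u1 u2 w1 w2. - (v2 * t) + (v1 + v2) * u1 \<in> A \<and> w1 + u1 \<le> t \<and> t < w2 + u1"
  have Q: "Measurable.pred (borel \<Otimes>\<^sub>M borel \<Otimes>\<^sub>M borel \<Otimes>\<^sub>M borel)
     (\<lambda>x. ?Q (fst x) (fst (snd x)) (fst (snd (snd x))) (snd (snd (snd x))))" by measurable
  have "stage t (Suc N) 0 A \<inter> {\<omega> \<in> space M. successes (Suc N) \<omega> = Suc k} =
     {\<omega> \<in> space M. (Y 1 \<omega> = 1 \<and> successes (Suc N) \<omega> = Suc k \<and> Y (Suc (Suc N)) \<omega> = 0)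
        \<and> ?Q (fw.waiting (Suc k) \<omega>) (fw.waiting (Suc (Suc k)) \<omega>) (bw.waiting (N - k) \<omega>) (bw.waiting (Suc (N - k)) \<omega>)}"
  proof (rule set_eqI)
    fix \<omega>
    show "\<omega> \<in> stage t (Suc N) 0 A \<inter> {\<omega> \<in> space M. successes (Suc N) \<omega> = Suc k} \<longleftrightarrow>
      \<omega> \<in> {\<omega> \<in> space M. (Y 1 \<omega> = 1 \<and> successes (Suc N) \<omega> = Suc k \<and> Y (Suc (Suc N)) \<omega> = 0)
        \<and> ?Q (fw.waiting (Suc k) \<omega>) (fw.waiting (Suc (Suc k)) \<omega>) (bw.waiting (N - k) \<omega>) (bw.waiting (Suc (N - k)) \<omega>)}"
    proof (cases "\<omega> \<in> space M \<and> successes (Suc N) \<omega> = Suc k \<and> Y (Suc (Suc N)) \<omega> = 0")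
      case True
      then have g: "epoch (Suc N) \<omega> = bw.waiting (N - k) \<omega> + fw.waiting (Suc k) \<omega>"
         "epoch (Suc (Suc N)) \<omega> = bw.waiting (Suc (N - k)) \<omega> + fw.waiting (Suc k) \<omega>"
         "epoch (Suc N) \<omega> \<le> t \<Longrightarrow> t < epoch (Suc (Suc N)) \<omega> \<Longrightarrow>
            position t \<omega> = - (v2 * t) + (v1 + v2) * fw.waiting (Suc k) \<omega>"
        using stage_geometry[of \<omega> N k] by (metis add.commute)+
      show ?thesis using True g(3)[unfolded g(1,2)] by (auto simp: stage_def g(1,2))
    qed (auto simp: stage_def)
  qed
  note event = this
  have y: "(0::nat) = 1 \<and> (1 - p) = p \<or> (0::nat) = 0 \<and> (1 - p) = 1 - p" by simp
  note weight = emeasure_trials_times[where Q="?Q" and k'="Suc k" and m="N - k", OF Q k y]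
  have m: "1 \<le> Suc k" using k by simp
  show ?thesis by (simp only: event weight bwd_piece[OF m A])
qed

lemma theta_measurable [measurable]: "theta t \<in> borel_measurable borel"
  unfolding theta_def[abs_def] by measurable

lemma fwd_summand_measurable [measurable]: "fwd_summand t n \<in> borel_measurable borel"
  unfolding fwd_summand_def[abs_def] by measurable

lemma bwd_summand_measurable [measurable]: "bwd_summand t n \<in> borel_measurable borel"
  unfolding bwd_summand_def[abs_def] by measurable

lemma fwd_summand_nonneg: "0 \<le> fwd_summand t n x"
  unfolding fwd_summand_def using v_pos
  by (intro sum_nonneg mult_nonneg_nonneg divide_nonneg_nonneg bw.density_nonneg fw.count_prob_nonneg
      zero_le_power p_nonneg of_nat_0_le_iff) simp

lemma bwd_summand_nonneg: "0 \<le> bwd_summand t n x"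
  unfolding bwd_summand_def using v_pos
  by (intro sum_nonneg mult_nonneg_nonneg divide_nonneg_nonneg fw.density_nonneg bw.count_prob_nonneg
      zero_le_power p_nonneg of_nat_0_le_iff) simp

lemma fwd_stage_total:
  assumes A: "A \<in> sets borel"
  shows "(\<Sum>k<Suc n. emeasure M (stage t (Suc (Suc n)) 1 A \<inter> {\<omega> \<in> space M. successes (Suc (Suc n)) \<omega> = Suc k}))
    = ennreal p * (\<integral>\<^sup>+x. ennreal (fwd_summand t n x) * indicator A x \<partial>lborel)"
proof -
  have "(\<Sum>k<Suc n. emeasure M (stage t (Suc (Suc n)) 1 A \<inter> {\<omega> \<in> space M. successes (Suc (Suc n)) \<omega> = Suc k}))
    = (\<Sum>k<Suc n. ennreal ((real (Suc n choose k) * p ^ Suc k * (1 - p) ^ (Suc n - k)) * p) *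
      (\<integral>\<^sup>+x. ennreal (bw.f (Suc n - k) (t - theta t x) * fw.count_prob (Suc k) (theta t x) / (v1 + v2)) * indicator A x \<partial>lborel))"
    by (intro sum.cong refl fwd_stage[OF A]) simp
  also have "\<dots> = ennreal p * (\<integral>\<^sup>+x. ennreal (\<Sum>k<Suc n. (real (Suc n choose k) * p ^ Suc k * (1 - p) ^ (Suc n - k)) *
      (bw.f (Suc n - k) (t - theta t x) * fw.count_prob (Suc k) (theta t x) / (v1 + v2))) * indicator A x \<partial>lborel)"

    by (intro weighted_sum_nn_integral A mult_nonneg_nonneg divide_nonneg_nonneg bw.density_nonneg
        fw.count_prob_nonneg zero_le_power p_nonneg of_nat_0_le_iff) (measurable, use v_pos trial_pos in simp_all)
  finally show ?thesis unfolding fwd_summand_def lessThan_Suc_atMost .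
qed

lemma bwd_stage_total:
  assumes A: "A \<in> sets borel"
  shows "emeasure M (stage t (Suc n) 0 A)
    = ennreal p * (\<integral>\<^sup>+x. ennreal (bwd_summand t n x) * indicator A x \<partial>lborel)"
proof -
  have "emeasure M (stage t (Suc n) 0 A)
    = (\<Sum>k\<le>n. ennreal ((real (n choose k) * p ^ k * (1 - p) ^ Suc (n - k)) * p) *
      (\<integral>\<^sup>+x. ennreal (fw.f (Suc k) (theta t x) * bw.count_prob (n - k) (t - theta t x) / (v1 + v2)) * indicator A x \<partial>lborel))"
    unfolding stage_split[OF A]
  proof (intro sum.cong refl)
    fix k assume "k \<in> {..n}"
    then have k: "k \<le> n" by simp
    have "C * u ^ Suc k * w ^ (n - k) * w = C * u ^ k * w ^ Suc (n - k) * u" for C u w :: real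
      by (simp only: power_Suc mult_ac)
    note e = this[of "real (n choose k)" p "1 - p"]
    show "emeasure M (stage t (Suc n) 0 A \<inter> {\<omega> \<in> space M. successes (Suc n) \<omega> = Suc k}) =
      ennreal ((real (n choose k) * p ^ k * (1 - p) ^ Suc (n - k)) * p) *
      (\<integral>\<^sup>+x. ennreal (fw.f (Suc k) (theta t x) * bw.count_prob (n - k) (t - theta t x) / (v1 + v2)) * indicator A x \<partial>lborel)"
      unfolding bwd_stage[OF A k] e by (rule refl)
  qed
  also have "\<dots> = ennreal p * (\<integral>\<^sup>+x. ennreal (\<Sum>k\<le>n. (real (n choose k) * p ^ k * (1 - p) ^ Suc (n - k)) *
      (fw.f (Suc k) (theta t x) * bw.count_prob (n - k) (t - theta t x) / (v1 + v2))) * indicator A x \<partial>lborel)"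

    by (intro weighted_sum_nn_integral A mult_nonneg_nonneg divide_nonneg_nonneg fw.density_nonneg
        bw.count_prob_nonneg zero_le_power p_nonneg of_nat_0_le_iff) (measurable, use v_pos trial_pos in simp_all)
  finally show ?thesis unfolding bwd_summand_def .
qed

text \<open>
  The stages exhaust almost all paths, because the epochs do not accumulate before
  \<open>t\<close>.
\<close>

lemma stages_sum:
  assumes t: "0 < t" and A: "A \<in> sets borel" and v: "v = v1 \<and> y = 1 \<or> v = - v2 \<and> y = 0"
  shows "emeasure M {\<omega> \<in> space M. Y 1 \<omega> = 1 \<and> velocity t \<omega> = v \<and> position t \<omega> \<in> A} = (\<Sum>n. emeasure M (stage t n y A))"
proof -
  note [measurable] = Y_measurable[of 0, folded One_nat_def] A
  have vel: "velocity t \<omega> = v \<longleftrightarrow> Y (Suc n) \<omega> = y"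
    if "\<omega> \<in> space M" "epoch n \<omega> \<le> t" "t < epoch (Suc n) \<omega>" for \<omega> n
    using num_epochs_eq[OF that] v Y_cases[OF that(1), of n] by (auto simp: velocity_def trial_velocity_iff)
  have num: "num_epochs t \<omega> = n" if "\<omega> \<in> stage t n y A" for \<omega> n
    using that num_epochs_eq[of \<omega> n t] by (simp add: stage_def)
  have disj: "disjoint_family (\<lambda>n. stage t n y A)"
    unfolding disjoint_family_on_def by (auto dest!: num)
  have "emeasure M {\<omega> \<in> space M. Y 1 \<omega> = 1 \<and> velocity t \<omega> = v \<and> position t \<omega> \<in> A} = emeasure M (\<Union>n. stage t n y A)"
  proof (rule emeasure_eq_AE)
    show "AE \<omega> in M. \<omega> \<in> {\<omega> \<in> space M. Y 1 \<omega> = 1 \<and> velocity t \<omega> = v \<and> position t \<omega> \<in> A} \<longleftrightarrow> \<omega> \<in> (\<Union>n. stage t n y A)"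
      using no_explosion[OF t] AE_space
    proof eventually_elim
      case (elim \<omega>)
      then obtain n where "t < epoch n \<omega>" by blast
      with epoch_covers[OF elim(2) less_imp_le[OF t], of n] obtain k where
        k: "epoch k \<omega> \<le> t" "t < epoch (Suc k) \<omega>" by blast
      have "num_epochs t \<omega> = k" by (rule num_epochs_eq[OF elim(2) k])
      then have "\<omega> \<in> (\<Union>n. stage t n y A) \<longleftrightarrow> \<omega> \<in> stage t k y A"
        using num[of \<omega>] by auto
      also have "\<dots> \<longleftrightarrow> Y 1 \<omega> = 1 \<and> velocity t \<omega> = v \<and> position t \<omega> \<in> A"
        unfolding vel[OF elim(2) k] using elim(2) k by (auto simp: stage_def)
      finally show ?case using elim(2) by simp
    qed
    show "(\<Union>n. stage t n y A) \<in> sets M" using stage_sets[OF A] by auto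
  qed measurable
  also have "\<dots> = (\<Sum>n. emeasure M (stage t n y A))"
    using stage_sets[OF A] disj by (intro suminf_emeasure[symmetric]) auto
  finally show ?thesis .
qed

lemma bwd_law:
  assumes t: "0 < t" and A[measurable]: "A \<in> sets borel"
  shows "emeasure M {\<omega> \<in> space M. Y 1 \<omega> = 1 \<and> velocity t \<omega> = - v2 \<and> position t \<omega> \<in> A}
    = ennreal p * (\<integral>\<^sup>+x. (\<Sum>n. ennreal (bwd_summand t n x)) * indicator A x \<partial>lborel)"
proof -
  have z: "stage t 0 0 A = {}" by (auto simp: stage_def)
  have "emeasure M {\<omega> \<in> space M. Y 1 \<omega> = 1 \<and> velocity t \<omega> = - v2 \<and> position t \<omega> \<in> A}
     = (\<Sum>n. emeasure M (stage t n 0 A))" by (rule stages_sum[OF t A]) simp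
  also have "\<dots> = (\<Sum>n. emeasure M (stage t (Suc n) 0 A))"
    by (subst suminf_offset[of _ 1]) (simp_all add: z)
  also have "\<dots> = ennreal p * (\<Sum>n. (\<integral>\<^sup>+x. ennreal (bwd_summand t n x) * indicator A x \<partial>lborel))"
    unfolding bwd_stage_total[OF A] by (rule ennreal_suminf_cmult)
  also have "(\<Sum>n. (\<integral>\<^sup>+x. ennreal (bwd_summand t n x) * indicator A x \<partial>lborel))
     = (\<integral>\<^sup>+x. (\<Sum>n. ennreal (bwd_summand t n x)) * indicator A x \<partial>lborel)"
    by (subst nn_integral_suminf[symmetric]) simp_all
  finally show ?thesis .
qed

text \<open>
  The mass of the paths that start at velocity \<open>v1\<close> and have not turned by time
  \<open>t\<close>.
\<close>

definition atom :: "real \<Rightarrow> ennreal" where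
  "atom t = emeasure M (stage t 0 1 UNIV) +
     (\<Sum>N. emeasure M (stage t (Suc N) 1 UNIV \<inter> {\<omega> \<in> space M. successes (Suc N) \<omega> = Suc N}))"

lemma fwd_law:
  assumes t: "0 < t" and A[measurable]: "A \<in> sets borel"
  shows "emeasure M {\<omega> \<in> space M. Y 1 \<omega> = 1 \<and> velocity t \<omega> = v1 \<and> position t \<omega> \<in> A}
    = atom t * indicator A (v1 * t) + ennreal p * (\<integral>\<^sup>+x. (\<Sum>n. ennreal (fwd_summand t n x)) * indicator A x \<partial>lborel)"
proof -
  let ?c = "\<lambda>N. emeasure M (stage t (Suc N) 1 UNIV \<inter> {\<omega> \<in> space M. successes (Suc N) \<omega> = Suc N})"
  \<comment> \<open>The term \<open>k = N\<close> has no leftward waiting time and goes into the atom.\<close>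
  let ?g = "\<lambda>N. \<Sum>k<N. emeasure M (stage t (Suc N) 1 A \<inter> {\<omega> \<in> space M. successes (Suc N) \<omega> = Suc k})"
  have S: "emeasure M (stage t (Suc N) 1 A) = ?c N * indicator A (v1 * t) + ?g N" for N
    unfolding stage_split[OF A] lessThan_Suc_atMost[symmetric] sum.lessThan_Suc fwd_stage_atom[of t N A]
    by (rule add.commute)
  have "emeasure M {\<omega> \<in> space M. Y 1 \<omega> = 1 \<and> velocity t \<omega> = v1 \<and> position t \<omega> \<in> A}
     = (\<Sum>n. emeasure M (stage t n 1 A))" by (rule stages_sum[OF t A]) simp
  also have "\<dots> = (\<Sum>n. emeasure M (stage t (Suc n) 1 A)) + emeasure M (stage t 0 1 A)"
    by (subst suminf_offset[of _ 1]) simp_all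
  also have "(\<Sum>n. emeasure M (stage t (Suc n) 1 A)) = (\<Sum>N. ?c N * indicator A (v1 * t)) + (\<Sum>N. ?g N)"
    unfolding S by (intro suminf_add[symmetric]) auto
  also have "(\<Sum>N. ?c N * indicator A (v1 * t)) = (\<Sum>N. ?c N) * indicator A (v1 * t)"
    by (rule ennreal_suminf_multc)
  also have "(\<Sum>N. ?g N) = (\<Sum>n. ?g (Suc n))"
    by (subst suminf_offset[of _ 1]) simp_all
  also have "\<dots> = ennreal p * (\<Sum>n. (\<integral>\<^sup>+x. ennreal (fwd_summand t n x) * indicator A x \<partial>lborel))"
    unfolding fwd_stage_total[OF A] by (rule ennreal_suminf_cmult)
  also have "(\<Sum>n. (\<integral>\<^sup>+x. ennreal (fwd_summand t n x) * indicator A x \<partial>lborel))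
     = (\<integral>\<^sup>+x. (\<Sum>n. ennreal (fwd_summand t n x)) * indicator A x \<partial>lborel)"
    by (subst nn_integral_suminf[symmetric]) simp_all
  finally show ?thesis unfolding fwd_stage_0[of t A] atom_def by (simp add: ring_distribs ac_simps)
qed

section \<open>Continuity of the series\<close>

lemma theta_bounds:
  assumes "x \<in> {- v2 * t<..<v1 * t}"
  shows "0 < theta t x" "0 < t - theta t x"
  using assms v_pos unfolding theta_compl unfolding theta_def by auto

lemma theta_isCont: "isCont (theta t) x"
  unfolding theta_def[abs_def] using v_pos by (intro continuous_intros) auto

lemma fwd_summand_isCont:
  assumes x: "x \<in> {- v2 * t<..<v1 * t}"
  shows "isCont (fwd_summand t n) x"
proof -
  have 1: "isCont (\<lambda>x. bw.f m (t - theta t x)) x" for m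
    by (rule isCont_o2[where g="bw.f m" and f="\<lambda>x. t - theta t x"])
       (intro continuous_intros theta_isCont, rule bw.density_isCont[OF theta_bounds(2)[OF x]])
  have 2: "isCont (\<lambda>x. fw.count_prob m (theta t x)) x" for m
    by (rule isCont_o2[where g="fw.count_prob m" and f="theta t"])
       (rule theta_isCont, rule fw.count_prob_isCont[OF theta_bounds(1)[OF x]])
  show ?thesis unfolding fwd_summand_def[abs_def] using v_pos
    by (intro continuous_intros 1 2) auto
qed

lemma bwd_summand_isCont:
  assumes x: "x \<in> {- v2 * t<..<v1 * t}"
  shows "isCont (bwd_summand t n) x"
proof -
  have 1: "isCont (\<lambda>x. bw.count_prob m (t - theta t x)) x" for m
    by (rule isCont_o2[where g="bw.count_prob m" and f="\<lambda>x. t - theta t x"])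
       (intro continuous_intros theta_isCont, rule bw.count_prob_isCont[OF theta_bounds(2)[OF x]])
  have 2: "isCont (\<lambda>x. fw.f m (theta t x)) x" for m
    by (rule isCont_o2[where g="fw.f m" and f="theta t"])
       (rule theta_isCont, rule fw.density_isCont[OF theta_bounds(1)[OF x]])
  show ?thesis unfolding bwd_summand_def[abs_def] using v_pos
    by (intro continuous_intros 1 2) auto
qed

lemma summand_bound:
  assumes w: "0 \<le> w" "w \<le> 1" and g: "0 \<le> g" "g \<le> C * pair_weight i"
    and h: "0 \<le> h" "h \<le> D * pair_weight j"
  shows "w * (g * h / (v1 + v2)) \<le> C * D / (v1 + v2) * (pair_weight i * pair_weight j)"
proof -
  have V: "0 < v1 + v2" using v_pos by simp
  have "g * h \<le> (C * pair_weight i) * (D * pair_weight j)"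
    using g h by (intro mult_mono) auto
  then have "g * h / (v1 + v2) \<le> (C * pair_weight i) * (D * pair_weight j) / (v1 + v2)"
    using V by (intro divide_right_mono) auto
  moreover have "w * (g * h / (v1 + v2)) \<le> 1 * (g * h / (v1 + v2))"
    using w g h V by (intro mult_right_mono divide_nonneg_nonneg mult_nonneg_nonneg) auto
  ultimately show ?thesis by (simp add: mult_ac)
qed

lemma theta_range:
  assumes "x \<in> {l..u}"
  shows "theta t x \<in> {theta t l..theta t u}" "t - theta t x \<in> {t - theta t u..t - theta t l}"
  using assms v_pos by (auto simp: theta_def intro!: divide_right_mono)

text \<open>
  The binomial weights are at most 1, and the two other factors decay like
  \<^const>\<open>pair_weight\<close> in their own index. So the series is dominated by the
  Cauchy product of two convergent series.
\<close>

lemma fwd_summand_locally_bounded: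
  assumes t: "0 < t" and ab: "- v2 * t < l" "u < v1 * t"
  shows "\<exists>B. summable B \<and> (\<forall>n. \<forall>x\<in>{l..u}. norm (fwd_summand t n x) \<le> B n)"
proof (cases "l \<le> u")
  case True
  then have b: "u \<in> {- v2 * t<..<v1 * t}" using ab by auto
  obtain C where C: "\<And>m s. 1 \<le> m \<Longrightarrow> s \<in> {t - theta t u..t - theta t l} \<Longrightarrow> bw.f m s \<le> C / ((real m + 1) * (real m + 2))"
    using bw.density_locally_bounded[OF theta_bounds(2)[OF b]] by meson
  \<comment> \<open>Counting probabilities are bounded by the distribution function at the right end of the range of \<open>\<theta>\<close>.\<close>
  define D where "D = 2 * mittag_leffler \<alpha> 1 (3 * lam * theta t u powr \<alpha>)"
  show ?thesis
  proof (intro exI[of _ "\<lambda>n. C * D / (v1 + v2) * (\<Sum>k\<le>n. pair_weight k * pair_weight (n - k))"] conjI allI ballI)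
    show "summable (\<lambda>n. C * D / (v1 + v2) * (\<Sum>k\<le>n. pair_weight k * pair_weight (n - k)))"
      by (rule pair_weight_convolution_summable)
    fix n x assume x: "x \<in> {l..u}"
    have "fwd_summand t n x \<le> (\<Sum>k\<le>n. C * D / (v1 + v2) * (pair_weight (n - k) * pair_weight k))"
      unfolding fwd_summand_def
    proof (rule sum_mono)
      fix k assume "k \<in> {..n}"
      then have k: "k \<le> n" by simp
      have C0: "0 \<le> C"
        using order.trans[OF bw.density_nonneg C[of 1 "t - theta t x"]] theta_range(2)[OF x, of t] by (simp add: zero_le_divide_iff)
      have "bw.f (Suc n - k) (t - theta t x) \<le> C * pair_weight (Suc n - k)"
        using C[OF _ theta_range(2)[OF x], of "Suc n - k"] k by (simp add: pair_weight_def)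
      also have "\<dots> \<le> C * pair_weight (n - k)"
        using C0 k pair_weight_Suc_le[of "n - k"] by (intro mult_left_mono) (auto simp: Suc_diff_le)
      finally have g: "bw.f (Suc n - k) (t - theta t x) \<le> C * pair_weight (n - k)" .
      have D0: "0 \<le> D" unfolding D_def using mittag_leffler_ge_1[OF alpha(1), of "3 * lam * theta t u powr \<alpha>"] rate_pos by simp
      have "fw.count_prob (Suc k) (theta t x) \<le> D * pair_weight (Suc k)"
        using fw.count_prob_bound[OF theta_bounds(1)[OF b], of "theta t x" "Suc k"] theta_range(1)[OF x, of t]
        by (simp add: D_def pair_weight_def)
      also have "\<dots> \<le> D * pair_weight k"
        using D0 by (intro mult_left_mono pair_weight_Suc_le)
      finally have h: "fw.count_prob (Suc k) (theta t x) \<le> D * pair_weight k" .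
      have "real (Suc n choose k) * p ^ Suc k * (1 - p) ^ (Suc n - k) = p * (real (Suc n choose k) * p ^ k * (1 - p) ^ (Suc n - k))"
        by (simp only: power_Suc mult_ac)
      also have "\<dots> \<le> 1 * 1"
        using k p_nonneg p_bounds by (intro mult_mono binomial_weight_le_1 mult_nonneg_nonneg zero_le_power of_nat_0_le_iff) auto
      finally have w: "real (Suc n choose k) * p ^ Suc k * (1 - p) ^ (Suc n - k) \<le> 1" by simp
      have w0: "0 \<le> real (Suc n choose k) * p ^ Suc k * (1 - p) ^ (Suc n - k)"
        by (intro mult_nonneg_nonneg zero_le_power p_nonneg of_nat_0_le_iff)
      show "real (Suc n choose k) * p ^ Suc k * (1 - p) ^ (Suc n - k) *
          (bw.f (Suc n - k) (t - theta t x) * fw.count_prob (Suc k) (theta t x) / (v1 + v2))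
         \<le> C * D / (v1 + v2) * (pair_weight (n - k) * pair_weight k)"
        by (rule summand_bound[OF w0 w bw.density_nonneg g fw.count_prob_nonneg h])
    qed
    then show "norm (fwd_summand t n x) \<le> C * D / (v1 + v2) * (\<Sum>k\<le>n. pair_weight k * pair_weight (n - k))"
      using fwd_summand_nonneg[of t n x] by (simp add: sum_distrib_left mult.commute mult.left_commute)
  qed
next
  case False
  then show ?thesis by (intro exI[of _ "\<lambda>n. 0"]) auto
qed

lemma bwd_summand_locally_bounded:
  assumes t: "0 < t" and ab: "- v2 * t < l" "u < v1 * t"
  shows "\<exists>B. summable B \<and> (\<forall>n. \<forall>x\<in>{l..u}. norm (bwd_summand t n x) \<le> B n)"
proof (cases "l \<le> u")
  case True
  then have a: "l \<in> {- v2 * t<..<v1 * t}" using ab by auto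
  obtain C where C: "\<And>m s. 1 \<le> m \<Longrightarrow> s \<in> {theta t l..theta t u} \<Longrightarrow> fw.f m s \<le> C / ((real m + 1) * (real m + 2))"
    using fw.density_locally_bounded[OF theta_bounds(1)[OF a]] by meson
  define D where "D = 2 * mittag_leffler \<alpha> 1 (3 * mu * (t - theta t l) powr \<alpha>)"
  show ?thesis
  proof (intro exI[of _ "\<lambda>n. C * D / (v1 + v2) * (\<Sum>k\<le>n. pair_weight k * pair_weight (n - k))"] conjI allI ballI)
    show "summable (\<lambda>n. C * D / (v1 + v2) * (\<Sum>k\<le>n. pair_weight k * pair_weight (n - k)))"
      by (rule pair_weight_convolution_summable)
    fix n x assume x: "x \<in> {l..u}"
    have "bwd_summand t n x \<le> (\<Sum>k\<le>n. C * D / (v1 + v2) * (pair_weight k * pair_weight (n - k)))"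
      unfolding bwd_summand_def
    proof (rule sum_mono)
      fix k assume "k \<in> {..n}"
      then have k: "k \<le> n" by simp
      have C0: "0 \<le> C"
        using order.trans[OF fw.density_nonneg C[of 1 "theta t x"]] theta_range(1)[OF x, of t] by (simp add: zero_le_divide_iff)
      have "fw.f (Suc k) (theta t x) \<le> C * pair_weight (Suc k)"
        using C[OF _ theta_range(1)[OF x], of "Suc k"] by (simp add: pair_weight_def)
      also have "\<dots> \<le> C * pair_weight k"
        using C0 by (intro mult_left_mono pair_weight_Suc_le)
      finally have g: "fw.f (Suc k) (theta t x) \<le> C * pair_weight k" .
      have h: "bw.count_prob (n - k) (t - theta t x) \<le> D * pair_weight (n - k)"
        using bw.count_prob_bound[OF theta_bounds(2)[OF a], of "t - theta t x" "n - k"] theta_range(2)[OF x, of t]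
        by (simp add: D_def pair_weight_def)
      have "real (n choose k) * p ^ k * (1 - p) ^ Suc (n - k) = (1 - p) * (real (n choose k) * p ^ k * (1 - p) ^ (n - k))"
        by (simp only: power_Suc mult_ac)
      also have "\<dots> \<le> 1 * 1"
        using k p_nonneg p_bounds by (intro mult_mono binomial_weight_le_1 mult_nonneg_nonneg zero_le_power of_nat_0_le_iff) auto
      finally have w: "real (n choose k) * p ^ k * (1 - p) ^ Suc (n - k) \<le> 1" by simp
      have w0: "0 \<le> real (n choose k) * p ^ k * (1 - p) ^ Suc (n - k)"
        by (intro mult_nonneg_nonneg zero_le_power p_nonneg of_nat_0_le_iff)
      show "real (n choose k) * p ^ k * (1 - p) ^ Suc (n - k) *
          (fw.f (Suc k) (theta t x) * bw.count_prob (n - k) (t - theta t x) / (v1 + v2))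
         \<le> C * D / (v1 + v2) * (pair_weight k * pair_weight (n - k))"
        by (rule summand_bound[OF w0 w fw.density_nonneg g bw.count_prob_nonneg h])
    qed
    then show "norm (bwd_summand t n x) \<le> C * D / (v1 + v2) * (\<Sum>k\<le>n. pair_weight k * pair_weight (n - k))"
      using bwd_summand_nonneg[of t n x] by (simp add: sum_distrib_left)
  qed
next
  case False
  then show ?thesis by (intro exI[of _ "\<lambda>n. 0"]) auto
qed

lemma fwd_series:
  assumes "0 < t" "x \<in> {- v2 * t<..<v1 * t}"
  shows "summable (\<lambda>n. fwd_summand t n x)" "isCont (\<lambda>x. \<Sum>n. fwd_summand t n x) x"
  using suminf_locally_uniform[OF fwd_summand_isCont fwd_summand_locally_bounded[OF assms(1)] assms(2)] by simp_all

lemma bwd_series: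
  assumes "0 < t" "x \<in> {- v2 * t<..<v1 * t}"
  shows "summable (\<lambda>n. bwd_summand t n x)" "isCont (\<lambda>x. \<Sum>n. bwd_summand t n x) x"
  using suminf_locally_uniform[OF bwd_summand_isCont bwd_summand_locally_bounded[OF assms(1)] assms(2)] by simp_all

section \<open>Forward and backward densities\<close>

text \<open>
  Substituting the alternating sums for density and counting probability and multiplying out.
\<close>

lemma fwd_summand_eq:
  assumes x: "x \<in> {- v2 * t<..<v1 * t}"
  shows "fwd_summand t n x = mu * (t - theta t x) powr (\<alpha> - 1) / (v1 + v2) * forward_term \<alpha> lam mu p t (theta t x) (n + 2)"
proof -
  let ?th = "theta t x" and ?s = "t - theta t x"
  let ?S = "?s powr (\<alpha> - 1)" and ?V = "v1 + v2"
  let ?e = "\<lambda>i. mittag_leffler \<alpha> \<alpha> (- (real (Suc i) * mu) * ?s powr \<alpha>)"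
  let ?g = "\<lambda>j. mittag_leffler \<alpha> 1 (- (real (Suc j) * lam) * ?th powr \<alpha>)"
  have th: "0 < ?th" "0 < ?s" using theta_bounds[OF x] .
  have f: "bw.f (Suc n - k) ?s = real (Suc n - k) * mu * (\<Sum>i=0..n - k. (-1) ^ i * real ((n - k) choose i) * (?S * ?e i))" if "k \<le> n" for k
  proof -
    have "{..<Suc n - k} = {0..n - k}" using that by auto
    then show ?thesis using th(2) that by (simp add: yule_density_def ml_kernel_def)
  qed
  have c: "fw.count_prob (Suc k) ?th = (\<Sum>j=0..Suc k. (-1) ^ j * real (Suc k choose j) * ?g j)" for k
    unfolding fw.count_prob_eq[OF th(1)] yule_cdf_diff atMost_atLeast0 ..
  note prod = product_of_sums[where S = ?S and V = ?V and mu = mu]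
  have "fwd_summand t n x = (\<Sum>k\<le>n. mu * ?S / ?V * (\<Sum>i=0..n - k. \<Sum>j=0..Suc k.
      (real (Suc n choose k) * p ^ Suc k * (1 - p) ^ (Suc n - k)) * real (Suc n - k) *
      (((-1) ^ i * real ((n - k) choose i)) * ?e i) * (((-1) ^ j * real (Suc k choose j)) * ?g j)))"
    unfolding fwd_summand_def by (intro sum.cong refl) (simp only: f c prod atMost_iff)
  also have "\<dots> = mu * ?S / ?V * (\<Sum>k=0..n. \<Sum>i=0..n - k. \<Sum>j=0..Suc k.
      (real (Suc n choose k) * p ^ Suc k * (1 - p) ^ (Suc n - k)) * real (Suc n - k) *
      (((-1) ^ i * real ((n - k) choose i)) * ?e i) * (((-1) ^ j * real (Suc k choose j)) * ?g j))"
    unfolding sum_distrib_left[symmetric] atMost_atLeast0 ..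
  also have "(\<Sum>k=0..n. \<Sum>i=0..n - k. \<Sum>j=0..Suc k.
      (real (Suc n choose k) * p ^ Suc k * (1 - p) ^ (Suc n - k)) * real (Suc n - k) *
      (((-1) ^ i * real ((n - k) choose i)) * ?e i) * (((-1) ^ j * real (Suc k choose j)) * ?g j))
      = forward_term \<alpha> lam mu p t ?th (n + 2)"
    unfolding forward_term_def
  proof (intro sum.cong)
    fix k i j
    have e1: "- mu * real (i + 1) * ?s powr \<alpha> = - (real (Suc i) * mu) * ?s powr \<alpha>" by simp
    have e2: "- lam * real (j + 1) * ?th powr \<alpha> = - (real (Suc j) * lam) * ?th powr \<alpha>" by simp
    have n: "n + 2 - 1 = Suc n" "n + 2 - k - 2 = n - k" "k + 1 = Suc k" "n + 2 - k - 1 = Suc n - k" by auto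
    show "(real (Suc n choose k) * p ^ Suc k * (1 - p) ^ (Suc n - k)) * real (Suc n - k) *
      (((-1) ^ i * real ((n - k) choose i)) * ?e i) * (((-1) ^ j * real (Suc k choose j)) * ?g j)
      = (-1) ^ (i + j) * real ((n + 2 - 1) choose k) * real ((n + 2 - k - 2) choose i) * real ((k + 1) choose j)
        * real (n + 2 - k - 1) * p ^ (k + 1) * (1 - p) ^ (n + 2 - k - 1)
        * mittag_leffler \<alpha> 1 (- lam * real (j + 1) * ?th powr \<alpha>)
        * mittag_leffler \<alpha> \<alpha> (- mu * real (i + 1) * ?s powr \<alpha>)"
      unfolding e1 e2 n power_add by (simp only: mult_ac)
  qed auto
  finally show ?thesis .
qed

lemma bwd_summand_eq:
  assumes x: "x \<in> {- v2 * t<..<v1 * t}"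
  shows "bwd_summand t n x = lam * theta t x powr (\<alpha> - 1) / (v1 + v2) * backward_term \<alpha> lam mu p t (theta t x) (n + 1)"
proof -
  let ?th = "theta t x" and ?s = "t - theta t x"
  let ?S = "?th powr (\<alpha> - 1)" and ?V = "v1 + v2"
  let ?e = "\<lambda>i. mittag_leffler \<alpha> \<alpha> (- (real (Suc i) * lam) * ?th powr \<alpha>)"
  let ?g = "\<lambda>j. mittag_leffler \<alpha> 1 (- (real (Suc j) * mu) * ?s powr \<alpha>)"
  have th: "0 < ?th" "0 < ?s" using theta_bounds[OF x] .
  have f: "fw.f (Suc k) ?th = real (Suc k) * lam * (\<Sum>i=0..k. (-1) ^ i * real (k choose i) * (?S * ?e i))" for k
    unfolding yule_density_def lessThan_Suc_atMost atMost_atLeast0 diff_Suc_1 using th(1) by (simp add: ml_kernel_def)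
  have c: "bw.count_prob (n - k) ?s = (\<Sum>j=0..n - k. (-1) ^ j * real ((n - k) choose j) * ?g j)" for k
    unfolding bw.count_prob_eq[OF th(2)] yule_cdf_diff atMost_atLeast0 ..
  note prod = product_of_sums[where S = ?S and V = ?V and mu = lam]
  have "bwd_summand t n x = (\<Sum>k\<le>n. lam * ?S / ?V * (\<Sum>i=0..k. \<Sum>j=0..n - k.
      (real (n choose k) * p ^ k * (1 - p) ^ Suc (n - k)) * real (Suc k) *
      (((-1) ^ i * real (k choose i)) * ?e i) * (((-1) ^ j * real ((n - k) choose j)) * ?g j)))"
    unfolding bwd_summand_def by (intro sum.cong refl) (simp only: f c prod)
  also have "\<dots> = lam * ?S / ?V * (\<Sum>k=0..n. \<Sum>i=0..k. \<Sum>j=0..n - k.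
      (real (n choose k) * p ^ k * (1 - p) ^ Suc (n - k)) * real (Suc k) *
      (((-1) ^ i * real (k choose i)) * ?e i) * (((-1) ^ j * real ((n - k) choose j)) * ?g j))"
    unfolding sum_distrib_left[symmetric] atMost_atLeast0 ..
  also have "(\<Sum>k=0..n. \<Sum>i=0..k. \<Sum>j=0..n - k.
      (real (n choose k) * p ^ k * (1 - p) ^ Suc (n - k)) * real (Suc k) *
      (((-1) ^ i * real (k choose i)) * ?e i) * (((-1) ^ j * real ((n - k) choose j)) * ?g j))
      = backward_term \<alpha> lam mu p t ?th (n + 1)"
    unfolding backward_term_def
  proof (intro sum.cong)
    fix k i j assume "k \<in> {0..n + 1 - 1}"
    have e1: "- lam * real (i + 1) * ?th powr \<alpha> = - (real (Suc i) * lam) * ?th powr \<alpha>" by simp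
    have e2: "- mu * real (j + 1) * ?s powr \<alpha> = - (real (Suc j) * mu) * ?s powr \<alpha>" by simp
    have n: "n + 1 - 1 = n" "n + 1 - k - 1 = n - k" "k + 1 = Suc k" "n + 1 - k = Suc (n - k)"
      using \<open>k \<in> {0..n + 1 - 1}\<close> by auto
    show "(real (n choose k) * p ^ k * (1 - p) ^ Suc (n - k)) * real (Suc k) *
      (((-1) ^ i * real (k choose i)) * ?e i) * (((-1) ^ j * real ((n - k) choose j)) * ?g j)
      = (-1) ^ (i + j) * real ((n + 1 - 1) choose k) * real (k choose i) * real ((n + 1 - k - 1) choose j)
        * real (k + 1) * p ^ k * (1 - p) ^ (n + 1 - k)
        * mittag_leffler \<alpha> 1 (- mu * real (j + 1) * ?s powr \<alpha>)
        * mittag_leffler \<alpha> \<alpha> (- lam * real (i + 1) * ?th powr \<alpha>)"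
      unfolding e1 e2 n power_add diff_Suc_1 by (simp only: mult_ac)
  qed auto
  finally show ?thesis .
qed

definition fwd_density :: "real \<Rightarrow> real \<Rightarrow> real" where
  "fwd_density t x = indicator {- v2 * t<..<v1 * t} x * (\<Sum>n. fwd_summand t n x)"

text \<open>
  The indicator matters at \<open>v1 t\<close>, where the series can be nonzero.
\<close>

definition bwd_density :: "real \<Rightarrow> real \<Rightarrow> real" where
  "bwd_density t x = indicator {- v2 * t<..<v1 * t} x * (\<Sum>n. bwd_summand t n x)"

lemma densities_measurable [measurable]:
  "fwd_density t \<in> borel_measurable borel" "bwd_density t \<in> borel_measurable borel"
  unfolding fwd_density_def[abs_def] bwd_density_def[abs_def] by measurable

lemma densities_nonneg:
  assumes "0 < t"
  shows "0 \<le> fwd_density t x" "0 \<le> bwd_density t x"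
proof -
  have "0 \<le> fwd_density t x \<and> 0 \<le> bwd_density t x"
  proof (cases "x \<in> {- v2 * t<..<v1 * t}")
    case True
    have "0 \<le> (\<Sum>n. fwd_summand t n x)" "0 \<le> (\<Sum>n. bwd_summand t n x)"
      by (rule suminf_nonneg[OF fwd_series(1)[OF assms True] fwd_summand_nonneg]
          suminf_nonneg[OF bwd_series(1)[OF assms True] bwd_summand_nonneg])+
    then show ?thesis by (simp add: fwd_density_def bwd_density_def)
  qed (simp add: fwd_density_def bwd_density_def)
  then show "0 \<le> fwd_density t x" "0 \<le> bwd_density t x" by simp_all
qed

lemma summands_outside:
  assumes "x \<notin> {- v2 * t..v1 * t}"
  shows "fwd_summand t n x = 0" "bwd_summand t n x = 0"
proof -
  have V: "0 < v1 + v2" using v_pos by simp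
  consider "x < - v2 * t" | "v1 * t < x" using assms by force
  then have "fwd_summand t n x = 0 \<and> bwd_summand t n x = 0"
  proof cases
    case 1
    then have "theta t x \<le> 0" using V by (simp add: theta_def divide_le_0_iff)
    then show ?thesis
      by (simp_all add: fwd_summand_def bwd_summand_def fw.count_prob_zero yule_density_nonpos)
  next
    case 2
    then have "t - theta t x < 0" unfolding theta_compl using V by (simp add: divide_less_0_iff)
    then show ?thesis
      by (simp_all add: fwd_summand_def bwd_summand_def bw.count_prob_zero yule_density_nonpos)
  qed
  then show "fwd_summand t n x = 0" "bwd_summand t n x = 0" by simp_all
qed

text \<open>
  Outside the closed interval every summand vanishes, inside the open one the series
  converges; the two endpoints form a null set.
\<close>

lemma density_series_AE:
  assumes t: "0 < t"
  shows "AE x in lborel. (\<Sum>n. ennreal (fwd_summand t n x)) = ennreal (fwd_density t x)"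
    "AE x in lborel. (\<Sum>n. ennreal (bwd_summand t n x)) = ennreal (bwd_density t x)"
proof -
  have "(\<Sum>n. ennreal (fwd_summand t n x)) = ennreal (fwd_density t x) \<and>
      (\<Sum>n. ennreal (bwd_summand t n x)) = ennreal (bwd_density t x)"
    if "x \<noteq> - v2 * t" "x \<noteq> v1 * t" for x
  proof (cases "x \<in> {- v2 * t<..<v1 * t}")
    case True
    then show ?thesis
      using suminf_ennreal2[OF fwd_summand_nonneg fwd_series(1)[OF t True]]
        suminf_ennreal2[OF bwd_summand_nonneg bwd_series(1)[OF t True]]
      by (simp add: fwd_density_def bwd_density_def)
  next
    case False
    then have "x \<notin> {- v2 * t..v1 * t}" using that by force
    then show ?thesis using False by (simp add: summands_outside fwd_density_def bwd_density_def)
  qed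
  then show "AE x in lborel. (\<Sum>n. ennreal (fwd_summand t n x)) = ennreal (fwd_density t x)"
    "AE x in lborel. (\<Sum>n. ennreal (bwd_summand t n x)) = ennreal (bwd_density t x)"
    using AE_lborel_singleton[of "- v2 * t"] AE_lborel_singleton[of "v1 * t"] by auto
qed

lemma fwd_law_density:
  assumes t: "0 < t" and A[measurable]: "A \<in> sets borel"
  shows "emeasure M {\<omega> \<in> space M. Y 1 \<omega> = 1 \<and> velocity t \<omega> = v1 \<and> position t \<omega> \<in> A}
    = atom t * indicator A (v1 * t) + ennreal p * (\<integral>\<^sup>+x. ennreal (fwd_density t x) * indicator A x \<partial>lborel)"
proof -
  have "(\<integral>\<^sup>+x. (\<Sum>n. ennreal (fwd_summand t n x)) * indicator A x \<partial>lborel)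
      = (\<integral>\<^sup>+x. ennreal (fwd_density t x) * indicator A x \<partial>lborel)"
    using density_series_AE(1)[OF t] by (intro nn_integral_cong_AE) auto
  then show ?thesis by (simp only: fwd_law[OF t A])
qed

lemma bwd_law_density:
  assumes t: "0 < t" and A[measurable]: "A \<in> sets borel"
  shows "emeasure M {\<omega> \<in> space M. Y 1 \<omega> = 1 \<and> velocity t \<omega> = - v2 \<and> position t \<omega> \<in> A}
    = ennreal p * (\<integral>\<^sup>+x. ennreal (bwd_density t x) * indicator A x \<partial>lborel)"
proof -
  have "(\<integral>\<^sup>+x. (\<Sum>n. ennreal (bwd_summand t n x)) * indicator A x \<partial>lborel)
      = (\<integral>\<^sup>+x. ennreal (bwd_density t x) * indicator A x \<partial>lborel)"
    using density_series_AE(2)[OF t] by (intro nn_integral_cong_AE) auto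
  then show ?thesis by (simp only: bwd_law[OF t A])
qed

lemma prob_start: "\<P>(\<omega> in M. velocity 0 \<omega> = v1) = p"
proof -
  have "{\<omega> \<in> space M. velocity 0 \<omega> = v1} = {\<omega> \<in> space M. Y (Suc 0) \<omega> = 1}"
    using velocity_0_iff by auto
  then show ?thesis using Y_prob_cases(1)[of 0] by simp
qed

text \<open>
  For \<open>x < v1 t\<close> the atom at \<open>v1 t\<close> does not contribute.
\<close>

lemma forward_cdf_density:
  assumes t: "0 < t" and x: "x < v1 * t"
  shows "ennreal (forward_cdf t x) = (\<integral>\<^sup>+z. ennreal (fwd_density t z) * indicator {..x} z \<partial>lborel)"
proof -
  have "{\<omega> \<in> space M. (position t \<omega> \<le> x \<and> velocity t \<omega> = v1) \<and> velocity 0 \<omega> = v1}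
     = {\<omega> \<in> space M. Y 1 \<omega> = 1 \<and> velocity t \<omega> = v1 \<and> position t \<omega> \<in> {..x}}"
    using velocity_0_iff by auto
  then have cdf: "forward_cdf t x = \<P>(\<omega> in M. Y 1 \<omega> = 1 \<and> velocity t \<omega> = v1 \<and> position t \<omega> \<in> {..x}) / p"
    unfolding forward_cdf_def cond_prob_def prob_start by simp
  have law: "ennreal \<P>(\<omega> in M. Y 1 \<omega> = 1 \<and> velocity t \<omega> = v1 \<and> position t \<omega> \<in> {..x})
      = ennreal p * (\<integral>\<^sup>+z. ennreal (fwd_density t z) * indicator {..x} z \<partial>lborel)"
    using fwd_law_density[OF t, of "{..x}"] x unfolding emeasure_eq_measure by simp
  show ?thesis unfolding cdf by (rule ennreal_ratio_eq[OF law measure_nonneg p_bounds(1)])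
qed

lemma backward_cdf_density:
  assumes t: "0 < t"
  shows "ennreal (backward_cdf t x) = (\<integral>\<^sup>+z. ennreal (bwd_density t z) * indicator {..x} z \<partial>lborel)"
proof -
  have "{\<omega> \<in> space M. (position t \<omega> \<le> x \<and> velocity t \<omega> = - v2) \<and> velocity 0 \<omega> = v1}
     = {\<omega> \<in> space M. Y 1 \<omega> = 1 \<and> velocity t \<omega> = - v2 \<and> position t \<omega> \<in> {..x}}"
    using velocity_0_iff by auto
  then have cdf: "backward_cdf t x = \<P>(\<omega> in M. Y 1 \<omega> = 1 \<and> velocity t \<omega> = - v2 \<and> position t \<omega> \<in> {..x}) / p"
    unfolding backward_cdf_def cond_prob_def prob_start by simp
  have law: "ennreal \<P>(\<omega> in M. Y 1 \<omega> = 1 \<and> velocity t \<omega> = - v2 \<and> position t \<omega> \<in> {..x})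
      = ennreal p * (\<integral>\<^sup>+z. ennreal (bwd_density t z) * indicator {..x} z \<partial>lborel)"
    using bwd_law_density[OF t, of "{..x}"] unfolding emeasure_eq_measure by simp
  show ?thesis unfolding cdf by (rule ennreal_ratio_eq[OF law measure_nonneg p_bounds(1)])
qed

lemma densities_isCont:
  assumes t: "0 < t" and x: "x \<in> {- v2 * t<..<v1 * t}"
  shows "isCont (fwd_density t) x" "isCont (bwd_density t) x"
proof -
  have "eventually (\<lambda>y. y \<in> {- v2 * t<..<v1 * t}) (nhds x)"
    using x by (intro eventually_nhds_in_open) auto
  then have "eventually (\<lambda>y. fwd_density t y = (\<Sum>n. fwd_summand t n y)) (nhds x)"
    "eventually (\<lambda>y. bwd_density t y = (\<Sum>n. bwd_summand t n y)) (nhds x)"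
    by (auto elim!: eventually_mono simp: fwd_density_def bwd_density_def)
  then show "isCont (fwd_density t) x" "isCont (bwd_density t) x"
    using fwd_series(2)[OF t x] bwd_series(2)[OF t x] by (simp_all add: isCont_cong)
qed

lemma cdf_derivs:
  assumes t: "0 < t" and x: "x \<in> {- v2 * t<..<v1 * t}"
  shows "(forward_cdf t has_real_derivative fwd_density t x) (at x)"
    "(backward_cdf t has_real_derivative bwd_density t x) (at x)"
proof -
  have "0 \<le> forward_cdf t y" "0 \<le> backward_cdf t y" for y
    by (simp_all add: forward_cdf_def backward_cdf_def cond_prob_def)
  then show "(forward_cdf t has_real_derivative fwd_density t x) (at x)"
    "(backward_cdf t has_real_derivative bwd_density t x) (at x)"
    using t by (auto intro!: distribution_function_deriv[OF x] densities_isCont densities_nonneg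
        forward_cdf_density backward_cdf_density)
qed

lemma densities_eq:
  assumes "0 < t" "x \<in> {- v2 * t<..<v1 * t}"
  shows "forward_density t x = fwd_density t x" "backward_density t x = bwd_density t x"
  using cdf_derivs[OF assms] by (simp_all add: forward_density_def backward_density_def DERIV_imp_deriv)

lemma cond_law_eq:
  assumes t: "0 < t" and A[measurable]: "A \<in> sets borel"
  shows "emeasure (cond_law t) A = (\<integral>\<^sup>+x. ennreal (fwd_density t x + bwd_density t x) * indicator A x \<partial>lborel)
     + ennreal (1 / p) * atom t * indicator A (v1 * t)"
proof -
  note [measurable] = Y_measurable[of 0, folded One_nat_def]
  let ?F = "\<integral>\<^sup>+x. ennreal (fwd_density t x) * indicator A x \<partial>lborel"
  let ?B = "\<integral>\<^sup>+x. ennreal (bwd_density t x) * indicator A x \<partial>lborel"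
  have start: "{\<omega> \<in> space M. velocity 0 \<omega> = v1} = {\<omega> \<in> space M. Y 1 \<omega> = 1}"
    using velocity_0_iff by auto
  have S[measurable]: "{\<omega> \<in> space M. Y 1 \<omega> = 1} \<in> sets M" by measurable
  have P: "emeasure M {\<omega> \<in> space M. Y 1 \<omega> = 1} = ennreal p"
    using prob_start unfolding start by (simp add: emeasure_eq_measure)
  note e = ennreal_inverse_cancel[OF p_bounds(1)]
  have inv: "X / ennreal p = ennreal (1 / p) * X" for X
    by (simp only: divide_ennreal_def inverse_ennreal[OF p_bounds(1)] inverse_eq_divide mult.commute)
  have "emeasure (cond_law t) A = emeasure (uniform_measure M {\<omega> \<in> space M. Y 1 \<omega> = 1}) (position t -` A \<inter> space M)"
    unfolding cond_law_def start by (subst emeasure_distr) auto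
  also have "\<dots> = emeasure M ({\<omega> \<in> space M. Y 1 \<omega> = 1} \<inter> (position t -` A \<inter> space M)) / ennreal p"
    unfolding P[symmetric] by (rule emeasure_uniform_measure) measurable
  finally have law: "emeasure (cond_law t) A
    = emeasure M ({\<omega> \<in> space M. Y 1 \<omega> = 1} \<inter> (position t -` A \<inter> space M)) / ennreal p" .
  let ?E = "\<lambda>v. {\<omega> \<in> space M. Y 1 \<omega> = 1 \<and> velocity t \<omega> = v \<and> position t \<omega> \<in> A}"
  have split: "{\<omega> \<in> space M. Y 1 \<omega> = 1} \<inter> (position t -` A \<inter> space M) = ?E v1 \<union> ?E (- v2)"
    by (auto simp: velocity_def trial_velocity_def)
  have "?E v1 \<inter> ?E (- v2) = {}" using v_pos by auto
  then have "emeasure M (?E v1 \<union> ?E (- v2)) = emeasure M (?E v1) + emeasure M (?E (- v2))"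
    by (intro plus_emeasure[symmetric]) measurable
  also have "\<dots> = atom t * indicator A (v1 * t) + ennreal p * ?F + ennreal p * ?B"
    by (simp only: fwd_law_density[OF t A] bwd_law_density[OF t A])
  also have "\<dots> = atom t * indicator A (v1 * t) + ennreal p * (?F + ?B)"
    by (simp only: distrib_left add.assoc)
  finally have sum: "emeasure M (?E v1 \<union> ?E (- v2)) = atom t * indicator A (v1 * t) + ennreal p * (?F + ?B)" .
  have FB: "?F + ?B = (\<integral>\<^sup>+x. ennreal (fwd_density t x + bwd_density t x) * indicator A x \<partial>lborel)"
    by (subst nn_integral_add[symmetric], measurable)
       (simp only: ennreal_plus[OF densities_nonneg[OF t]] distrib_right)
  show ?thesis
    unfolding law split sum inv FB distrib_left mult.assoc[symmetric] e by (simp only: mult_1 add.commute)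
qed

text \<open>
  The singular part is the atom at \<open>v1 t\<close>.
\<close>

lemma cond_law_has_ac_component:
  assumes t: "0 < t"
  shows "has_ac_component (cond_law t)
    (\<lambda>x. indicator {- v2 * t<..<v1 * t} x * (forward_density t x + backward_density t x))"
proof -
  have g: "(\<lambda>x. indicator {- v2 * t<..<v1 * t} x * (forward_density t x + backward_density t x))
     = (\<lambda>x. fwd_density t x + bwd_density t x)"
  proof
    fix x
    show "indicator {- v2 * t<..<v1 * t} x * (forward_density t x + backward_density t x) = fwd_density t x + bwd_density t x"
      using densities_eq[OF t, of x]
      by (cases "x \<in> {- v2 * t<..<v1 * t}") (auto simp: fwd_density_def bwd_density_def)
  qed
  let ?\<sigma> = "scale_measure (ennreal (1 / p) * atom t) (return borel (v1 * t))"
  show ?thesis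
    unfolding has_ac_component_def g
  proof (intro conjI allI exI[of _ ?\<sigma>] exI[of _ "{v1 * t}"] ballI)
    show "0 \<le> fwd_density t x + bwd_density t x" for x using densities_nonneg[OF t] by (intro add_nonneg_nonneg)
    show "emeasure (cond_law t) A = (\<integral>\<^sup>+x. ennreal (fwd_density t x + bwd_density t x) * indicator A x \<partial>lborel) + emeasure ?\<sigma> A"
      if "A \<in> sets borel" for A
      using that by (simp add: cond_law_eq[OF t that])
  qed (auto simp: null_sets_def)
qed

end

theorem theorem3p2:
  fixes M :: "'a measure"
    and \<alpha> v1 v2 lam mu b r t :: real
    and Y :: "nat \<Rightarrow> 'a \<Rightarrow> nat"
    and R L :: "nat \<Rightarrow> 'a \<Rightarrow> real"
  assumes "ml_telegraph M \<alpha> v1 v2 lam mu b r Y R L"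
    and "0 < t"
  shows "has_ac_component (ml_telegraph.cond_law M v1 v2 Y R L t)
           (\<lambda>x. indicator {- v2 * t<..<v1 * t} x *
              (ml_telegraph.forward_density M v1 v2 Y R L t x
               + ml_telegraph.backward_density M v1 v2 Y R L t x)) \<and>
    (\<forall>x\<in>{- v2 * t<..<v1 * t}.
       let p = b / (b + r); \<theta> = (v2 * t + x) / (v1 + v2) in
         ml_telegraph.forward_cdf M v1 v2 Y R L t differentiable (at x) \<and>
         ml_telegraph.backward_cdf M v1 v2 Y R L t differentiable (at x) \<and>
         summable (\<lambda>n. forward_term \<alpha> lam mu p t \<theta> (n + 2)) \<and>
         summable (\<lambda>n. backward_term \<alpha> lam mu p t \<theta> (n + 1)) \<and>
         ml_telegraph.forward_density M v1 v2 Y R L t x =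
           mu * (t - \<theta>) powr (\<alpha> - 1) / (v1 + v2) *
             (\<Sum>n. forward_term \<alpha> lam mu p t \<theta> (n + 2)) \<and>
         ml_telegraph.backward_density M v1 v2 Y R L t x =
           lam * \<theta> powr (\<alpha> - 1) / (v1 + v2) *
             (\<Sum>n. backward_term \<alpha> lam mu p t \<theta> (n + 1)))"
proof -
  interpret ml_telegraph M \<alpha> v1 v2 lam mu b r Y R L by (rule assms(1))
  note t = assms(2)
  show ?thesis
  proof (intro conjI ballI)
    show "has_ac_component (cond_law t)
      (\<lambda>x. indicator {- v2 * t<..<v1 * t} x * (forward_density t x + backward_density t x))"
      by (rule cond_law_has_ac_component[OF t])
    fix x assume x: "x \<in> {- v2 * t<..<v1 * t}"
    define c where "c = mu * (t - theta t x) powr (\<alpha> - 1) / (v1 + v2)"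
    define d where "d = lam * theta t x powr (\<alpha> - 1) / (v1 + v2)"
    have cd: "c \<noteq> 0" "d \<noteq> 0"
      using theta_bounds[OF x] rate_pos v_pos by (auto simp: c_def d_def)
    have fs: "fwd_summand t n x = c * forward_term \<alpha> lam mu p t (theta t x) (n + 2)" for n
      unfolding c_def by (rule fwd_summand_eq[OF x])
    have bs: "bwd_summand t n x = d * backward_term \<alpha> lam mu p t (theta t x) (n + 1)" for n
      unfolding d_def by (rule bwd_summand_eq[OF x])
    have sf: "summable (\<lambda>n. forward_term \<alpha> lam mu p t (theta t x) (n + 2))"
      using fwd_series(1)[OF t x] cd unfolding fs by (simp add: summable_cmult_iff)
    have sb: "summable (\<lambda>n. backward_term \<alpha> lam mu p t (theta t x) (n + 1))"
      using bwd_series(1)[OF t x] cd unfolding bs by (simp add: summable_cmult_iff)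
    have "forward_density t x = c * (\<Sum>n. forward_term \<alpha> lam mu p t (theta t x) (n + 2))"
      unfolding densities_eq(1)[OF t x] fwd_density_def fs suminf_mult[OF sf] using x by simp
    moreover have "backward_density t x = d * (\<Sum>n. backward_term \<alpha> lam mu p t (theta t x) (n + 1))"
      unfolding densities_eq(2)[OF t x] bwd_density_def bs suminf_mult[OF sb] using x by simp
    moreover have "forward_cdf t differentiable (at x)" "backward_cdf t differentiable (at x)"
      using cdf_derivs[OF t x] by (auto intro: differentiableI simp: real_differentiable_def)
    ultimately show "let p = b / (b + r); \<theta> = (v2 * t + x) / (v1 + v2) in
         forward_cdf t differentiable (at x) \<and> backward_cdf t differentiable (at x) \<and>
         summable (\<lambda>n. forward_term \<alpha> lam mu p t \<theta> (n + 2)) \<and>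
         summable (\<lambda>n. backward_term \<alpha> lam mu p t \<theta> (n + 1)) \<and>
         forward_density t x = mu * (t - \<theta>) powr (\<alpha> - 1) / (v1 + v2) *
             (\<Sum>n. forward_term \<alpha> lam mu p t \<theta> (n + 2)) \<and>
         backward_density t x = lam * \<theta> powr (\<alpha> - 1) / (v1 + v2) *
             (\<Sum>n. backward_term \<alpha> lam mu p t \<theta> (n + 1))"
      using sf sb unfolding Let_def c_def d_def theta_def by (intro conjI)
  qed
qed

end
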